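(* Let $U\subset\mathbb H$ be a holomorphic submanifold and let $E$ be the family of elliptic curves obtained by restricting $\widetilde{\mathcal E}$ to $U$. (1) Any complex orientation of the complex analytic elliptic cohomology theory associated to $E$ admits a twisted equivariant refinement. (2) The data $(\mathcal L,\tilde{\mathsf c}_{\mathrm U(1)})$ of the twisted equivariant refinement are unique up to unique isomorphism, with any $(\mathcal L,\tilde{\mathsf c}_{\mathrm U(1)})$ having a unique isomorphism to the line bundle (with section) determined by the function $\upsilon(\tau,z)$.
   Context: $\widetilde{\mathcal E}=(\mathbb C\times\mathbb H)/\mathbb Z^2\to\mathbb H$, $(n,m)\cdot(z,\tau)=(z+\tau n+m,\tau)$, is the universal family of elliptic curves over the upper half plane, $\widetilde{\mathcal E}^\vee=(\mathbb C\times\mathbb H)/\mathbb Z^2$, $(n,m)\cdot(z,\tau)=(z+n-\tau m,\tau)$, the dual family; $E\to U$ and $E^\vee\to U$ are their restrictions to $U$. $\omega$ is the line bundle of holomorphic $1$-forms along the elliptic curves, trivialized over $\mathbb H$ by $dz$ (with $\beta^{-1}$ corresponding to the trivializing section); on $E^\vee$, $\omega$ denotes its pullback. $\mathcal O(-0)$ is the line bundle of functions vanishing to first order along the zero section $0\colon U\to E^\vee$. The complex analytic elliptic cohomology theory associated to $E$ is $H(-;\mathcal O(U)[\beta,\beta^{-1}])$, $|\beta|=-2$, with the isomorphism of the additive formal group with the formal group of the curve induced by $U\times\mathbb C\to E$. Complex orientations are classes $\tilde{\mathsf c}\in\tilde h^2(\mathbb{CP}^\infty)$ restricting to the canonical generator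 of $\tilde h^2(S^2)\simeq h^0(\mathrm{pt})$; equivalently, $\mathsf c=\beta\tilde{\mathsf c}$ is a coordinate, a power series in $z$ with coefficients in $\mathcal O(U)$ whose lowest order nonvanishing term is $z$. A twisted equivariant refinement of a complex orientation $\tilde{\mathsf c}$ is a holomorphic line bundle $\mathcal L$ on $E^\vee$ together with a nowhere vanishing section $\tilde{\mathsf c}_{\mathrm U(1)}\in\Gamma(E^\vee;\mathcal O(-0)\otimes\mathcal L\otimes\omega^{-1})$ (equivalently, a section of $\mathcal L\otimes\omega^{-1}$ that is nowhere vanishing away from the zero section and vanishes to precisely first order there) and a choice of trivialization of $\mathcal L$ near the zero section (where power-series coordinates are interpreted on the formal neighborhood of the zero section) that identifies the restriction of $\tilde{\mathsf c}_{\mathrm U(1)}$ with $\tilde{\mathsf c}$. An isomorphism $(\mathcal L,\tilde{\mathsf c}_{\mathrm U(1)})\to(\mathcal L',\tilde{\mathsf c}'_{\mathrm U(1)})$ is an isomorphism of line bundles $\mathcal L\simeq\mathcal L'$ carrying $\tilde{\mathsf c}_{\mathrm U(1)}$ to $\tilde{\mathsf c}'_{\mathrm U(1)}$. With $q=e^{2\pi i\tau}$, $y=e^{2\pi iz}$, $\upsilon(\tau,z)=(1-y)\prod_{m>0}\frac{(1-q^my)(1-q^my^{-1})}{(1-q^m)^2}\in\mathcal O(\mathbb H\times\mathbb C)$. The line bundle determined by $\upsilon$ is the trivial line bundle on $\mathbb H\times\mathbb C$ with descent data to $\widetilde{\mathcal E}^\vee$ given by the transformation cocycle of $\upsilon$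 under $\mathbb Z^2$ (twisted by $\omega$ so that $\beta^{-1}\upsilon$ is a section of $\mathcal L\otimes\omega^{-1}$), with section given by $\upsilon$, restricted to $E^\vee$. *)

theory Defs
  imports "HOL-Complex_Analysis.Complex_Analysis"
begin

section \<open>Holomorphic functions on submanifolds\<close>

definition upper_half_plane :: "complex set" where
  "upper_half_plane = {\<tau>. Im \<tau> > 0}"

text \<open>Slice charts of the ambient one-dimensional manifold: near each of its points the
  submanifold is \<open>\<complex>\<close> or \<open>{0}\<close> inside \<open>\<complex>\<close> in a holomorphic coordinate \<open>\<phi>\<close>
  (an injective holomorphic map on an open set is biholomorphic onto its image).
  Components of both dimensions are allowed; closedness is not required.\<close>

definition holomorphic_submanifold :: "complex set \<Rightarrow> bool" where
  "holomorphic_submanifold U \<longleftrightarrow> U \<subseteq> upper_half_plane \<and>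
     (\<forall>p\<in>U. \<exists>V \<phi>. open V \<and> p \<in> V \<and> V \<subseteq> upper_half_plane \<and> \<phi> holomorphic_on V \<and> inj_on \<phi> V \<and>
        (\<phi> ` (U \<inter> V) = \<phi> ` V \<or> \<phi> ` (U \<inter> V) = \<phi> ` V \<inter> {0}))"

text \<open>A function on a relatively open subset \<open>S\<close> of a submanifold is holomorphic if it is locally
  the restriction of a holomorphic function on the ambient space; for ambient dimension two,
  holomorphic means complex Frechet differentiable on an open set.\<close>

definition holo_sub :: "complex set \<Rightarrow> (complex \<Rightarrow> complex) \<Rightarrow> bool" where
  "holo_sub S f \<longleftrightarrow>
     (\<forall>p\<in>S. \<exists>N F. open N \<and> p \<in> N \<and> F holomorphic_on N \<and> (\<forall>x\<in>N \<inter> S. f x = F x))"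

definition holo2_on :: "(complex \<times> complex \<Rightarrow> complex) \<Rightarrow> (complex \<times> complex) set \<Rightarrow> bool" where
  "holo2_on F N \<longleftrightarrow>
     (\<forall>p\<in>N. \<exists>a b. (F has_derivative (\<lambda>v. a * fst v + b * snd v)) (at p))"

definition holo2_sub :: "(complex \<times> complex) set \<Rightarrow> (complex \<times> complex \<Rightarrow> complex) \<Rightarrow> bool" where
  "holo2_sub S f \<longleftrightarrow>
     (\<forall>p\<in>S. \<exists>N F. open N \<and> p \<in> N \<and> holo2_on F N \<and> (\<forall>x\<in>N \<inter> S. f x = F x))"


section \<open>The dual family of elliptic curves\<close>

text \<open>The base point of the curve is the second coordinate: a point of \<open>\<complex> \<times> \<H>\<close> is \<open>(z, \<tau>)\<close>.\<close>

definition dual_act :: "int \<Rightarrow> int \<Rightarrow> complex \<times> complex \<Rightarrow> complex \<times> complex" where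
  "dual_act n m = (\<lambda>(z, \<tau>). (z + of_int n - \<tau> * of_int m, \<tau>))"

type_synonym point = "(complex \<times> complex) set"

definition orbit :: "complex \<times> complex \<Rightarrow> point" where
  "orbit p = {dual_act n m p | n m. True}"

definition dual_family :: "complex set \<Rightarrow> point set" where
  "dual_family U = orbit ` (UNIV \<times> U)"

definition base_point :: "point \<Rightarrow> complex" where
  "base_point x = the_elem (snd ` x)"

definition zero_section :: "complex \<Rightarrow> point" where
  "zero_section \<tau> = orbit (0, \<tau>)"

definition lift_set :: "complex set \<Rightarrow> point set \<Rightarrow> (complex \<times> complex) set" where
  "lift_set U W = {p \<in> UNIV \<times> U. orbit p \<in> W}"

text \<open>The complex structure on the quotient is the one for which \<open>\<complex> \<times> U \<rightarrow> E\<^sup>\<or>\<close> is a holomorphic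
  covering.\<close>

definition open_dual :: "complex set \<Rightarrow> point set \<Rightarrow> bool" where
  "open_dual U W \<longleftrightarrow> W \<subseteq> dual_family U \<and> openin (top_of_set (UNIV \<times> U)) (lift_set U W)"

definition holo_dual :: "complex set \<Rightarrow> point set \<Rightarrow> (point \<Rightarrow> complex) \<Rightarrow> bool" where
  "holo_dual U W f \<longleftrightarrow> holo2_sub (lift_set U W) (\<lambda>p. f (orbit p))"


section \<open>Holomorphic line bundles on the dual family\<close>

text \<open>A local trivialization over \<open>W\<close> is given by its fibre coordinate, a function on the total
  space which is only meaningful on the part lying over \<open>W\<close>. The linear structure of the fibres
  and the complex structure of the total space are those transported along the atlas.\<close>

type_synonym 'l chart = "point set \<times> ('l \<Rightarrow> complex)"

record 'l lbundle =
  tot :: "'l set"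
  proj :: "'l \<Rightarrow> point"
  atlas :: "'l chart set"

definition fibre :: "'l lbundle \<Rightarrow> point \<Rightarrow> 'l set" where
  "fibre L x = {v \<in> tot L. proj L v = x}"

definition line_bundle :: "complex set \<Rightarrow> 'l lbundle \<Rightarrow> bool" where
  "line_bundle U L \<longleftrightarrow>
     proj L \<in> tot L \<rightarrow> dual_family U \<and>
     (\<Union>(W, \<phi>)\<in>atlas L. W) = dual_family U \<and>
     (\<forall>(W, \<phi>)\<in>atlas L. open_dual U W \<and>
        bij_betw (\<lambda>v. (proj L v, \<phi> v)) {v \<in> tot L. proj L v \<in> W} (W \<times> UNIV)) \<and>
     (\<forall>(W, \<phi>)\<in>atlas L. \<forall>(W', \<phi>')\<in>atlas L. \<exists>g. holo_dual U (W \<inter> W') g \<and>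
        (\<forall>x\<in>W \<inter> W'. g x \<noteq> 0) \<and>
        (\<forall>v\<in>tot L. proj L v \<in> W \<inter> W' \<longrightarrow> \<phi>' v = g (proj L v) * \<phi> v))"

text \<open>Morphisms are extensional on the total space, so that uniqueness of a morphism is equality of
  functions.\<close>

definition bundle_hom :: "complex set \<Rightarrow> 'l lbundle \<Rightarrow> 'm lbundle \<Rightarrow> ('l \<Rightarrow> 'm) \<Rightarrow> bool" where
  "bundle_hom U L M f \<longleftrightarrow>
     f \<in> tot L \<rightarrow>\<^sub>E tot M \<and>
     (\<forall>v\<in>tot L. proj M (f v) = proj L v) \<and>
     (\<forall>(W, \<phi>)\<in>atlas L. \<forall>(W', \<psi>)\<in>atlas M. \<exists>g. holo_dual U (W \<inter> W') g \<and>
        (\<forall>v\<in>tot L. proj L v \<in> W \<inter> W' \<longrightarrow> \<psi> (f v) = g (proj L v) * \<phi> v))"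

definition bundle_iso :: "complex set \<Rightarrow> 'l lbundle \<Rightarrow> 'm lbundle \<Rightarrow> ('l \<Rightarrow> 'm) \<Rightarrow> bool" where
  "bundle_iso U L M f \<longleftrightarrow>
     bundle_hom U L M f \<and>
     (\<exists>g. bundle_hom U M L g \<and> (\<forall>v\<in>tot L. g (f v) = v) \<and> (\<forall>w\<in>tot M. f (g w) = w))"

definition holo_section :: "complex set \<Rightarrow> 'l lbundle \<Rightarrow> (point \<Rightarrow> 'l) \<Rightarrow> bool" where
  "holo_section U L s \<longleftrightarrow>
     s \<in> dual_family U \<rightarrow>\<^sub>E tot L \<and>
     (\<forall>x\<in>dual_family U. proj L (s x) = x) \<and>
     (\<forall>(W, \<phi>)\<in>atlas L. holo_dual U W (\<lambda>x. \<phi> (s x)))"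

text \<open>The vector over \<open>x\<close> whose coordinate in the given chart is \<open>1\<close>.\<close>

definition frame :: "'l lbundle \<Rightarrow> 'l chart \<Rightarrow> point \<Rightarrow> 'l" where
  "frame L A x = the_inv_into (fibre L x) (snd A) 1"

definition transition :: "'l lbundle \<Rightarrow> 'l chart \<Rightarrow> 'l chart \<Rightarrow> point \<Rightarrow> complex" where
  "transition L A A' x = snd A' (frame L A x)"


subsection \<open>Duals and tensor products\<close>

definition fibre_functionals :: "'l lbundle \<Rightarrow> point \<Rightarrow> ('l \<Rightarrow> complex) set" where
  "fibre_functionals L x = {l \<in> extensional (fibre L x).
     \<forall>(W, \<phi>)\<in>atlas L. x \<in> W \<longrightarrow> (\<exists>k. \<forall>v\<in>fibre L x. l v = k * \<phi> v)}"

definition dual_chart :: "'l lbundle \<Rightarrow> 'l chart \<Rightarrow> (point \<times> ('l \<Rightarrow> complex)) chart" where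
  "dual_chart L A = (fst A, \<lambda>(x, l). l (frame L A x))"

definition dual_bundle :: "'l lbundle \<Rightarrow> (point \<times> ('l \<Rightarrow> complex)) lbundle" where
  "dual_bundle L =
     \<lparr>tot = Sigma (\<Union>(W, \<phi>)\<in>atlas L. W) (fibre_functionals L),
      proj = fst,
      atlas = dual_chart L ` atlas L\<rparr>"

text \<open>Every element of a tensor product of two lines is a pure tensor, and two pure tensors agree
  iff the products of the coordinates of their factors agree; so a tensor is represented by the
  class of all pairs \<open>(a, b)\<close> that represent it.\<close>

definition tensor_pairs :: "'l lbundle \<Rightarrow> 'm lbundle \<Rightarrow> ('l \<times> 'm) set" where
  "tensor_pairs L M = {(a, b). a \<in> tot L \<and> b \<in> tot M \<and> proj L a = proj M b}"

definition tensor_rel :: "'l lbundle \<Rightarrow> 'm lbundle \<Rightarrow> (('l \<times> 'm) \<times> ('l \<times> 'm)) set" where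
  "tensor_rel L M = {((a, b), (a', b')).
     (a, b) \<in> tensor_pairs L M \<and> (a', b') \<in> tensor_pairs L M \<and> proj L a = proj L a' \<and>
     (\<forall>(W, \<phi>)\<in>atlas L. \<forall>(W', \<psi>)\<in>atlas M. proj L a \<in> W \<inter> W' \<longrightarrow> \<phi> a * \<psi> b = \<phi> a' * \<psi> b')}"

definition tensor :: "'l lbundle \<Rightarrow> 'm lbundle \<Rightarrow> 'l \<Rightarrow> 'm \<Rightarrow> ('l \<times> 'm) set" where
  "tensor L M a b = tensor_rel L M `` {(a, b)}"

definition tensor_chart :: "'l chart \<Rightarrow> 'm chart \<Rightarrow> ('l \<times> 'm) set chart" where
  "tensor_chart A B =
     (fst A \<inter> fst B, \<lambda>\<xi>. the_elem ((\<lambda>(a, b). snd A a * snd B b) ` \<xi>))"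

definition tensor_bundle :: "'l lbundle \<Rightarrow> 'm lbundle \<Rightarrow> ('l \<times> 'm) set lbundle" where
  "tensor_bundle L M =
     \<lparr>tot = tensor_pairs L M // tensor_rel L M,
      proj = (\<lambda>\<xi>. the_elem ((\<lambda>(a, b). proj L a) ` \<xi>)),
      atlas = {tensor_chart A B | A B. A \<in> atlas L \<and> B \<in> atlas M}\<rparr>"

text \<open>The map \<open>f \<otimes> id\<close> into \<open>L' \<otimes> M\<close>.\<close>

definition tensor_map :: "'k lbundle \<Rightarrow> 'm lbundle \<Rightarrow> ('l \<Rightarrow> 'k) \<Rightarrow> ('l \<times> 'm) set \<Rightarrow> ('k \<times> 'm) set" where
  "tensor_map L' M f \<xi> = the_elem ((\<lambda>(a, b). tensor L' M (f a) b) ` \<xi>)"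


section \<open>The line bundle of holomorphic 1-forms along the elliptic curves\<close>

text \<open>The form \<open>h dz\<close> on \<open>E\<^sub>\<tau> = \<complex> / (\<int> + \<tau> \<int>)\<close> is represented by the periodic entire function \<open>h\<close>.\<close>

definition elliptic_forms :: "complex \<Rightarrow> (complex \<Rightarrow> complex) set" where
  "elliptic_forms \<tau> = {h. h holomorphic_on UNIV \<and>
     (\<forall>z (n::int) (m::int). h (z + \<tau> * of_int n + of_int m) = h z)}"

text \<open>Such an \<open>h\<close> is constant, so evaluation at \<open>0\<close> is the coefficient with respect to \<open>dz\<close>.\<close>

definition dz_chart :: "complex set \<Rightarrow> (point \<times> (complex \<Rightarrow> complex)) chart" where
  "dz_chart U = (dual_family U, \<lambda>(x, h). h 0)"

text \<open>This is the pullback of the bundle on \<open>U\<close> along \<open>E\<^sup>\<or> \<rightarrow> U\<close>.\<close>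

definition omega :: "complex set \<Rightarrow> (point \<times> (complex \<Rightarrow> complex)) lbundle" where
  "omega U =
     \<lparr>tot = Sigma (dual_family U) (\<lambda>x. elliptic_forms (base_point x)),
      proj = fst,
      atlas = {dz_chart U}\<rparr>"

type_synonym omega_inv_elt = "point \<times> (point \<times> (complex \<Rightarrow> complex) \<Rightarrow> complex)"

abbreviation omega_inv :: "complex set \<Rightarrow> omega_inv_elt lbundle" where
  "omega_inv U \<equiv> dual_bundle (omega U)"

text \<open>The trivializing section of \<open>\<omega>\<^sup>-\<^sup>1\<close> in cohomological degree 2, dual to \<open>dz\<close>, and the chart of
  \<open>\<omega>\<^sup>-\<^sup>1\<close> giving the coefficient with respect to it.\<close>

definition beta_inv :: "complex set \<Rightarrow> point \<Rightarrow> omega_inv_elt" where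
  "beta_inv U x = (x, restrict (\<lambda>(y, h). h 0) (fibre (omega U) x))"

definition beta_inv_chart :: "complex set \<Rightarrow> omega_inv_elt chart" where
  "beta_inv_chart U = dual_chart (omega U) (dz_chart U)"


section \<open>Complex orientations and twisted equivariant refinements\<close>

text \<open>A complex orientation is given by its coordinate \<open>c\<close>; the class in degree 2 is \<open>\<beta>\<^sup>-\<^sup>1 c\<close>.
  The power series over the ring of holomorphic functions on \<open>U\<close> is encoded as a family over \<open>U\<close>
  of complex power series with holomorphic coefficients.\<close>

definition complex_orientation :: "complex set \<Rightarrow> (complex \<Rightarrow> complex fps) \<Rightarrow> bool" where
  "complex_orientation U c \<longleftrightarrow>
     (\<forall>k. holo_sub U (\<lambda>\<tau>. fps_nth (c \<tau>) k)) \<and>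
     (\<forall>\<tau>\<in>U. fps_nth (c \<tau>) 0 = 0 \<and> fps_nth (c \<tau>) 1 = 1)"

definition expansion_at_zero :: "(point \<Rightarrow> complex) \<Rightarrow> complex \<Rightarrow> complex fps" where
  "expansion_at_zero f \<tau> = fps_expansion (\<lambda>z. f (orbit (z, \<tau>))) 0"

text \<open>A trivialization of \<open>L\<close> on the formal neighbourhood of the zero section is expressed in a
  chart \<open>A\<close> of \<open>L\<close> by an invertible power series \<open>t A\<close>: a local section with coordinate \<open>f\<close> in that
  chart corresponds to the power series \<open>t A\<close> times the expansion of \<open>f\<close>.\<close>

definition formal_trivialization ::
    "complex set \<Rightarrow> 'l lbundle \<Rightarrow> ('l chart \<Rightarrow> complex \<Rightarrow> complex fps) \<Rightarrow> bool" where
  "formal_trivialization U L t \<longleftrightarrow>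
     (\<forall>A\<in>atlas L. \<forall>k. holo_sub {\<tau>\<in>U. zero_section \<tau> \<in> fst A} (\<lambda>\<tau>. fps_nth (t A \<tau>) k)) \<and>
     (\<forall>A\<in>atlas L. \<forall>\<tau>\<in>U. zero_section \<tau> \<in> fst A \<longrightarrow> fps_nth (t A \<tau>) 0 \<noteq> 0) \<and>
     (\<forall>A\<in>atlas L. \<forall>A'\<in>atlas L. \<forall>\<tau>\<in>U. zero_section \<tau> \<in> fst A \<inter> fst A' \<longrightarrow>
        t A \<tau> = t A' \<tau> * expansion_at_zero (transition L A A') \<tau>)"

definition nonvanishing_off_zero :: "complex set \<Rightarrow> 'l lbundle \<Rightarrow> (point \<Rightarrow> 'l) \<Rightarrow> bool" where
  "nonvanishing_off_zero U L s \<longleftrightarrow>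
     (\<forall>(W, \<phi>)\<in>atlas L. \<forall>x\<in>W - zero_section ` U. \<phi> (s x) \<noteq> 0)"

definition first_order_at_zero :: "complex set \<Rightarrow> 'l lbundle \<Rightarrow> (point \<Rightarrow> 'l) \<Rightarrow> bool" where
  "first_order_at_zero U L s \<longleftrightarrow>
     (\<forall>(W, \<phi>)\<in>atlas L. \<forall>\<tau>\<in>U. zero_section \<tau> \<in> W \<longrightarrow>
        (\<exists>N G. open N \<and> (0, \<tau>) \<in> N \<and> holo2_sub (N \<inter> UNIV \<times> U) G \<and>
           (\<forall>p\<in>N \<inter> UNIV \<times> U. orbit p \<in> W \<and> G p \<noteq> 0 \<and> \<phi> (s (orbit p)) = fst p * G p)))"

definition twisted_refinement ::
    "complex set \<Rightarrow> (complex \<Rightarrow> complex fps) \<Rightarrow> 'l lbundle \<Rightarrow> (point \<Rightarrow> ('l \<times> omega_inv_elt) set) \<Rightarrow>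
     ('l chart \<Rightarrow> complex \<Rightarrow> complex fps) \<Rightarrow> bool" where
  "twisted_refinement U c L s t \<longleftrightarrow>
     line_bundle U L \<and>
     holo_section U (tensor_bundle L (omega_inv U)) s \<and>
     nonvanishing_off_zero U (tensor_bundle L (omega_inv U)) s \<and>
     first_order_at_zero U (tensor_bundle L (omega_inv U)) s \<and>
     formal_trivialization U L t \<and>
     (\<forall>A\<in>atlas L. \<forall>\<tau>\<in>U. zero_section \<tau> \<in> fst A \<longrightarrow>
        t A \<tau> * expansion_at_zero (\<lambda>x. snd (tensor_chart A (beta_inv_chart U)) (s x)) \<tau> = c \<tau>)"

definition refinement_iso ::
    "complex set \<Rightarrow> 'l lbundle \<Rightarrow> (point \<Rightarrow> ('l \<times> omega_inv_elt) set) \<Rightarrow>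
     'k lbundle \<Rightarrow> (point \<Rightarrow> ('k \<times> omega_inv_elt) set) \<Rightarrow> ('l \<Rightarrow> 'k) \<Rightarrow> bool" where
  "refinement_iso U L s L' s' f \<longleftrightarrow>
     bundle_iso U L L' f \<and>
     (\<forall>x\<in>dual_family U. tensor_map L' (omega_inv U) f (s x) = s' x)"


section \<open>The line bundle determined by \<open>\<upsilon>\<close>\<close>

definition upsilon :: "complex \<Rightarrow> complex \<Rightarrow> complex" where
  "upsilon \<tau> z =
     (let q = exp (2 * of_real pi * \<i> * \<tau>); y = exp (2 * of_real pi * \<i> * z)
      in (1 - y) * (\<Prod>m. (1 - q ^ Suc m * y) * (1 - q ^ Suc m * inverse y) / (1 - q ^ Suc m)\<^sup>2))"

text \<open>The transformation cocycle of a function \<open>u\<close> is the quotient of \<open>u \<circ> dual_act n m\<close> by \<open>u\<close>,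
  extended continuously across the zeros of \<open>u\<close>.\<close>

definition transformation_cocycle ::
    "(complex \<Rightarrow> complex \<Rightarrow> complex) \<Rightarrow> int \<Rightarrow> int \<Rightarrow> complex \<times> complex \<Rightarrow> complex" where
  "transformation_cocycle u n m =
     (\<lambda>(z, \<tau>). Lim (at z) (\<lambda>w. u \<tau> (fst (dual_act n m (w, \<tau>))) / u \<tau> w))"

text \<open>Quotient of the trivial bundle on \<open>\<complex> \<times> U\<close> by \<open>(n, m) \<cdot> (p, w) = ((n, m) \<cdot> p, j n m p w)\<close>. The
  charts come from the open sets on which the quotient map to the base is injective.\<close>

definition descent_class ::
    "(int \<Rightarrow> int \<Rightarrow> complex \<times> complex \<Rightarrow> complex) \<Rightarrow> (complex \<times> complex) \<times> complex \<Rightarrow>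
     ((complex \<times> complex) \<times> complex) set" where
  "descent_class j = (\<lambda>(p, w). {(dual_act n m p, j n m p * w) | n m. True})"

definition descent_chart ::
    "(complex \<times> complex) set \<Rightarrow> ((complex \<times> complex) \<times> complex) set chart" where
  "descent_chart V = (orbit ` V, \<lambda>\<xi>. the_elem (snd ` (\<xi> \<inter> V \<times> UNIV)))"

definition descent_bundle ::
    "complex set \<Rightarrow> (int \<Rightarrow> int \<Rightarrow> complex \<times> complex \<Rightarrow> complex) \<Rightarrow>
     ((complex \<times> complex) \<times> complex) set lbundle" where
  "descent_bundle U j =
     \<lparr>tot = descent_class j ` ((UNIV \<times> U) \<times> UNIV),
      proj = (\<lambda>\<xi>. fst ` \<xi>),
      atlas = {descent_chart V | V. openin (top_of_set (UNIV \<times> U)) V \<and> inj_on orbit V}\<rparr>"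

definition upsilon_bundle :: "complex set \<Rightarrow> ((complex \<times> complex) \<times> complex) set lbundle" where
  "upsilon_bundle U = descent_bundle U (transformation_cocycle upsilon)"

text \<open>The section \<open>\<beta>\<^sup>-\<^sup>1 \<upsilon>\<close>: as \<open>\<upsilon>\<close> is equivariant for its own cocycle, its value at an orbit \<open>x\<close> is the
  class of \<open>(p, \<upsilon> p)\<close>, where \<open>p\<close> is any point of \<open>x\<close>.\<close>

definition upsilon_section ::
    "complex set \<Rightarrow> point \<Rightarrow> (((complex \<times> complex) \<times> complex) set \<times> omega_inv_elt) set" where
  "upsilon_section U = (\<lambda>x\<in>dual_family U.
     tensor (upsilon_bundle U) (omega_inv U)
       (the_elem ((\<lambda>(z, \<tau>). descent_class (transformation_cocycle upsilon) ((z, \<tau>), upsilon \<tau> z)) ` x))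
       (beta_inv U x))"

end

theory Submission
  imports Defs
begin

text \<open>
  The idea is that a refinement is a line bundle with a section whose divisor is exactly the zero
  section, and that two such pairs differ by the quotient of their sections, which is a nowhere
  vanishing holomorphic function in local coordinates.

  As \<open>\<omega>\<^sup>-\<^sup>1\<close> is trivialized by \<open>\<beta>\<^sup>-\<^sup>1\<close>, every element of \<open>L \<otimes> \<omega>\<^sup>-\<^sup>1\<close> is \<open>a \<otimes> \<beta>\<^sup>-\<^sup>1\<close> for a
  unique \<open>a\<close>, so a section of \<open>L \<otimes> \<omega>\<^sup>-\<^sup>1\<close> amounts to a section \<open>\<sigma>\<close> of \<open>L\<close>
  (\<open>tensor_beta_section_iff\<close>). Given \<open>(L, \<sigma>)\<close> and \<open>(L', \<sigma>')\<close>, an isomorphism carrying \<open>\<sigma>\<close> to \<open>\<sigma>'\<close> has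
  to be multiplication by \<open>\<sigma>' / \<sigma>\<close> off the zero section, and by continuity this determines it
  everywhere. It exists because both sections are \<open>z\<close> times a unit near the zero section, so
  that the quotient extends (\<open>ratio_of_sections\<close>). This is \<open>unique_iso_of_sections\<close>.

  Every such pair refines every orientation \<open>c\<close>: the expansion \<open>e\<close> of \<open>\<sigma>\<close> at the
  zero section has order one, as has \<open>c\<close>, so \<open>c / e\<close> is an invertible power series and serves as
  the trivialization (\<open>refinement_of_section\<close>). Its coefficients are holomorphic in \<open>\<tau>\<close> since Taylor
  coefficients of a holomorphic function of two variables are (\<open>holo2_germ_coefficient\<close>).

  It remains to see that \<open>\<upsilon>\<close> defines such a pair. A nowhere vanishing holomorphic cocycle for
  \<open>\<int>\<^sup>2\<close> defines a line bundle on the quotient (\<open>line_bundle_descent\<close>), and an equivariant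
  function defines a section of it (\<open>descent_section_cuts_out\<close>). The product for \<open>\<upsilon>\<close> converges
  locally uniformly, it vanishes on the lattice only, to first order at \<open>0\<close>, and replacing \<open>y\<close> by
  \<open>y / q\<close> shifts its factors by one, which gives the cocycle
  \<open>exp (\<pi> \<i> (m + 2 m z - m (m + 1) \<tau>))\<close> (\<open>upsilon_transform\<close>). Holomorphy of \<open>\<upsilon>\<close> in both
  variables jointly is Osgood's lemma (\<open>osgood\<close>).
\<close>

section \<open>Holomorphic functions of two variables\<close>

lemma holo2_on_imp_continuous_on: "holo2_on F N \<Longrightarrow> continuous_on N F"
  unfolding holo2_on_def continuous_on_eq_continuous_within
  by (meson continuous_at_imp_continuous_within has_derivative_continuous)

lemma holo2_on_subset: "holo2_on F N \<Longrightarrow> M \<subseteq> N \<Longrightarrow> holo2_on F M"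
  unfolding holo2_on_def by blast

lemma holo2_on_slice1:
  assumes "holo2_on F N"
  shows "(\<lambda>z. F (z, \<tau>)) holomorphic_on {z. (z, \<tau>) \<in> N}"
  unfolding holomorphic_on_def
proof
  fix z assume "z \<in> {z. (z, \<tau>) \<in> N}"
  then obtain a b where *: "(F has_derivative (\<lambda>v. a * fst v + b * snd v)) (at (z, \<tau>))"
    using assms unfolding holo2_on_def by blast
  have "((\<lambda>z. (z, \<tau>)) has_derivative (\<lambda>h. (h, 0))) (at z)"
    by (auto intro!: derivative_eq_intros)
  from diff_chain_at[OF this *]
  have "((\<lambda>z. F (z, \<tau>)) has_derivative (\<lambda>h. a * h)) (at z)"
    by (simp add: o_def)
  then have "((\<lambda>z. F (z, \<tau>)) has_field_derivative a) (at z)"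
    by (simp add: has_field_derivative_def)
  then show "(\<lambda>z. F (z, \<tau>)) field_differentiable at z within {z. (z, \<tau>) \<in> N}"
    using field_differentiable_at_within field_differentiable_def by blast
qed

lemma holo2_on_slice2:
  assumes "holo2_on F N"
  shows "(\<lambda>\<tau>. F (z, \<tau>)) holomorphic_on {\<tau>. (z, \<tau>) \<in> N}"
  unfolding holomorphic_on_def
proof
  fix \<tau> assume "\<tau> \<in> {\<tau>. (z, \<tau>) \<in> N}"
  then obtain a b where *: "(F has_derivative (\<lambda>v. a * fst v + b * snd v)) (at (z, \<tau>))"
    using assms unfolding holo2_on_def by blast
  have "((\<lambda>\<tau>. (z, \<tau>)) has_derivative (\<lambda>h. (0, h))) (at \<tau>)"
    by (auto intro!: derivative_eq_intros)
  from diff_chain_at[OF this *]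
  have "((\<lambda>\<tau>. F (z, \<tau>)) has_derivative (\<lambda>h. b * h)) (at \<tau>)"
    by (simp add: o_def)
  then have "((\<lambda>\<tau>. F (z, \<tau>)) has_field_derivative b) (at \<tau>)"
    by (simp add: has_field_derivative_def)
  then show "(\<lambda>\<tau>. F (z, \<tau>)) field_differentiable at \<tau> within {\<tau>. (z, \<tau>) \<in> N}"
    using field_differentiable_at_within field_differentiable_def by blast
qed

lemma open_contains_cball_Times:
  fixes N :: "('a::metric_space \<times> 'b::metric_space) set"
  assumes "open N" "(z0, \<tau>0) \<in> N"
  obtains r where "r > 0" "cball z0 r \<times> cball \<tau>0 r \<subseteq> N"
proof -
  obtain A B where AB: "open A" "open B" "(z0, \<tau>0) \<in> A \<times> B" "A \<times> B \<subseteq> N"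
    using assms open_prod_elim by blast
  then obtain r1 r2 where "r1 > 0" "cball z0 r1 \<subseteq> A" "r2 > 0" "cball \<tau>0 r2 \<subseteq> B"
    by (meson mem_Sigma_iff open_contains_cball)
  then have "cball z0 (min r1 r2) \<times> cball \<tau>0 (min r1 r2) \<subseteq> N"
    using AB(4) by fastforce
  with \<open>r1 > 0\<close> \<open>r2 > 0\<close> that[of "min r1 r2"] show ?thesis by simp
qed

text \<open>By the Cauchy estimate, \<open>\<partial>F/\<partial>z\<close> at \<open>\<tau>\<close> and at \<open>\<tau>\<^sub>0\<close> differ by at most a constant times the
  distance of the two slices of \<open>F\<close> in the supremum norm, which is small by compactness.\<close>

lemma continuous_on_partial_deriv:
  fixes F :: "complex \<times> complex \<Rightarrow> complex"
  assumes "open N" and F: "continuous_on N F"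
    and hol: "\<And>\<tau>. (\<lambda>z. F (z, \<tau>)) holomorphic_on {z. (z, \<tau>) \<in> N}"
  shows "continuous_on N (\<lambda>(z, \<tau>). deriv (\<lambda>w. F (w, \<tau>)) z)"
proof -
  have "isCont (\<lambda>(z, \<tau>). deriv (\<lambda>w. F (w, \<tau>)) z) (z0, \<tau>0)" if p: "(z0, \<tau>0) \<in> N" for z0 \<tau>0
  proof -
    obtain r where r: "r > 0" "cball z0 r \<times> cball \<tau>0 r \<subseteq> N"
      using open_contains_cball_Times[OF assms(1) p] .
    have hol': "(\<lambda>z. F (z, \<tau>)) holomorphic_on ball z0 r" "continuous_on (cball z0 r) (\<lambda>z. F (z, \<tau>))"
      if "\<tau> \<in> cball \<tau>0 r" for \<tau>
    proof -
      have "cball z0 r \<subseteq> {z. (z, \<tau>) \<in> N}" using r that by auto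
      then show "(\<lambda>z. F (z, \<tau>)) holomorphic_on ball z0 r"
         "continuous_on (cball z0 r) (\<lambda>z. F (z, \<tau>))"
        using hol[of \<tau>] holomorphic_on_subset ball_subset_cball
        by (blast, meson hol holomorphic_on_imp_continuous_on holomorphic_on_subset)
    qed
    have d0: "isCont (deriv (\<lambda>w. F (w, \<tau>0))) z0"
    proof -
      have "deriv (\<lambda>w. F (w, \<tau>0)) holomorphic_on ball z0 r"
        using hol'(1)[of \<tau>0] r(1) by (simp add: holomorphic_deriv)
      then show ?thesis
        using r(1) continuous_on_eq_continuous_at[OF open_ball] holomorphic_on_imp_continuous_on centre_in_ball
        by blast
    qed
    have "\<exists>d>0. \<forall>p. dist p (z0, \<tau>0) < d \<longrightarrow>
       dist (case p of (z, \<tau>) \<Rightarrow> deriv (\<lambda>w. F (w, \<tau>)) z) (deriv (\<lambda>w. F (w, \<tau>0)) z0) < e" if "e > 0" for e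
    proof -
      obtain d1 where d1: "d1 > 0"
        "\<And>z. dist z z0 < d1 \<Longrightarrow> dist (deriv (\<lambda>w. F (w, \<tau>0)) z) (deriv (\<lambda>w. F (w, \<tau>0)) z0) < e/2"
        using d0 \<open>e > 0\<close> unfolding continuous_at_eps_delta by (meson half_gt_zero)
      have c: "continuous_on (cball \<tau>0 r \<times> cball z0 r) (\<lambda>(\<tau>, z). F (z, \<tau>))"
        using continuous_on_subset[OF F r(2)]
        by (auto simp: case_prod_unfold intro!: continuous_on_compose2[OF continuous_on_subset[OF F r(2)]] continuous_intros)
      have e': "e/2 * (r/2)/2 > 0" using r \<open>e > 0\<close> by simp
      obtain X0 where X0: "\<tau>0 \<in> X0" "open X0"
        "\<forall>\<tau>\<in>X0 \<inter> cball \<tau>0 r. \<forall>z\<in>cball z0 r. dist (F (z, \<tau>)) (F (z, \<tau>0)) \<le> e/2 * (r/2)/2"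
        using continuous_on_prod_compactE[OF c compact_cball _ e', of \<tau>0] r(1)
        by (auto simp: )
      obtain d2 where d2: "d2 > 0" "ball \<tau>0 d2 \<subseteq> X0"
        using X0 open_contains_ball by metis
      define d where "d = Min {d1, d2, r/2}"
      have d: "d > 0" "d \<le> d1" "d \<le> d2" "d \<le> r/2" using d1 d2 r by (auto simp: d_def)
      have "dist (deriv (\<lambda>w. F (w, \<tau>)) z) (deriv (\<lambda>w. F (w, \<tau>0)) z0) < e"
        if "dist (z, \<tau>) (z0, \<tau>0) < d" for z \<tau>
      proof -
        have zt: "dist z z0 < d" "dist \<tau> \<tau>0 < d"
          using that dist_fst_le[of "(z, \<tau>)" "(z0, \<tau>0)"] dist_snd_le[of "(z, \<tau>)" "(z0, \<tau>0)"]
          by simp_all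
        have t: "\<tau> \<in> X0 \<inter> cball \<tau>0 r"
          using zt d d2 r by (auto simp: dist_commute subset_iff)
        have sub: "cball z (r/2) \<subseteq> cball z0 r" "ball z (r/2) \<subseteq> ball z0 r"
          using zt d by (auto simp: subset_iff) (metric)+
        define G where "G = (\<lambda>w. F (w, \<tau>) - F (w, \<tau>0))"
        have G: "G holomorphic_on ball z (r/2)" "continuous_on (cball z (r/2)) G"
          unfolding G_def using hol'[of \<tau>] hol'[of \<tau>0] t r sub
          by (auto intro!: holomorphic_intros continuous_intros intro: holomorphic_on_subset continuous_on_subset)
        have "norm ((deriv ^^ 1) G z) \<le> fact 1 * (e/2 * (r/2)/2) / (r/2)^1"
        proof (rule Cauchy_inequality[OF G])
          fix x assume "norm (z - x) = r/2"
          then have "x \<in> cball z0 r" using sub by (auto simp: dist_norm subset_iff)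
          then show "norm (G x) \<le> e/2 * (r/2)/2" using X0(3) t by (auto simp: G_def dist_norm)
        qed (use r in auto)
        also have "\<dots> < e/2" using r \<open>e > 0\<close> by (simp add: field_simps)
        finally have "norm (deriv G z) < e/2" by simp
        moreover have "deriv G z = deriv (\<lambda>w. F (w, \<tau>)) z - deriv (\<lambda>w. F (w, \<tau>0)) z"
          unfolding G_def
        proof (rule deriv_diff)
          have "z \<in> ball z0 r" using zt d r by (auto simp: dist_commute)
          then show "(\<lambda>w. F (w, \<tau>)) field_differentiable at z" "(\<lambda>w. F (w, \<tau>0)) field_differentiable at z"
            using hol'(1)[of \<tau>] hol'(1)[of \<tau>0] t r holomorphic_on_imp_differentiable_at[OF _ open_ball]
            by auto
        qed
        moreover have "dist (deriv (\<lambda>w. F (w, \<tau>0)) z) (deriv (\<lambda>w. F (w, \<tau>0)) z0) < e/2"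
          using d1 zt d by auto
        ultimately show ?thesis
          by (smt (verit) dist_norm dist_triangle field_sum_of_halves)
      qed
      then show ?thesis using d(1) by (intro exI[of _ d]) auto
    qed
    then show ?thesis unfolding continuous_at_eps_delta by auto
  qed
  then show ?thesis
    by (intro continuous_at_imp_continuous_on ballI) (metis surj_pair)
qed

lemma continuous_on_partial_deriv2:
  fixes F :: "complex \<times> complex \<Rightarrow> complex"
  assumes "open N" and F: "continuous_on N F"
    and hol: "\<And>z. (\<lambda>\<tau>. F (z, \<tau>)) holomorphic_on {\<tau>. (z, \<tau>) \<in> N}"
  shows "continuous_on N (\<lambda>(z, \<tau>). deriv (\<lambda>w. F (z, w)) \<tau>)"
proof -
  define S where "S = (\<lambda>p. (snd p, fst p)) -` N"
  have "open S" unfolding S_def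
    by (intro continuous_open_vimage continuous_intros assms)
  moreover have "continuous_on S (\<lambda>p. F (snd p, fst p))" unfolding S_def
    by (intro continuous_on_compose2[OF F] continuous_intros) auto
  ultimately have *: "continuous_on S (\<lambda>(z, \<tau>). deriv (\<lambda>w. F (\<tau>, w)) z)"
    using continuous_on_partial_deriv[of S "\<lambda>p. F (snd p, fst p)"] hol by (simp add: S_def)
  have "continuous_on N (\<lambda>p. case (snd p, fst p) of (z, \<tau>) \<Rightarrow> deriv (\<lambda>w. F (\<tau>, w)) z)"
    by (rule continuous_on_compose2[OF *]) (auto simp: S_def intro!: continuous_intros)
  then show ?thesis by (simp add: case_prod_unfold)
qed

text \<open>Both partial derivatives exist by assumption, and for the Frechet derivative to exist it is
  enough that one of them is continuous, which is the preceding lemma.\<close>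

theorem osgood:
  assumes "open N" and F: "continuous_on N F"
    and hol1: "\<And>\<tau>. (\<lambda>z. F (z, \<tau>)) holomorphic_on {z. (z, \<tau>) \<in> N}"
    and hol2: "\<And>z. (\<lambda>\<tau>. F (z, \<tau>)) holomorphic_on {\<tau>. (z, \<tau>) \<in> N}"
  shows "holo2_on F N"
  unfolding holo2_on_def
proof
  fix p assume "p \<in> N"
  obtain z0 \<tau>0 where p: "p = (z0, \<tau>0)" by force
  obtain r where r: "r > 0" "cball z0 r \<times> cball \<tau>0 r \<subseteq> N"
    using open_contains_cball_Times[OF assms(1)] \<open>p \<in> N\<close> p by metis
  have sub: "ball z0 r \<subseteq> {z. (z, \<tau>0) \<in> N}" using r by auto
  have d1: "((\<lambda>z. F (z, \<tau>0)) has_field_derivative deriv (\<lambda>z. F (z, \<tau>0)) z0) (at z0)"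
    using holomorphic_on_subset[OF hol1 sub] r(1)
    by (simp add: holomorphic_derivI)
  have d2: "((\<lambda>\<tau>. F (z, \<tau>)) has_field_derivative deriv (\<lambda>\<tau>. F (z, \<tau>)) \<tau>) (at \<tau>)"
    if "z \<in> ball z0 r" "\<tau> \<in> ball \<tau>0 r" for z \<tau>
  proof -
    have "ball \<tau>0 r \<subseteq> {\<tau>. (z, \<tau>) \<in> N}" using r that by auto
    from holomorphic_on_subset[OF hol2 this] that show ?thesis
      by (simp add: holomorphic_derivI)
  qed
  define D where "D = (\<lambda>z \<tau>. blinfun_mult_right (deriv (\<lambda>\<tau>. F (z, \<tau>)) \<tau>))"
  have D: "continuous (at (z0, \<tau>0) within ball z0 r \<times> ball \<tau>0 r) (\<lambda>(z, \<tau>). D z \<tau>)"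
  proof -
    have "continuous_on N (\<lambda>(z, \<tau>). deriv (\<lambda>w. F (z, w)) \<tau>)"
      by (rule continuous_on_partial_deriv2[OF assms(1,2) hol2])
    then have "continuous_on N (\<lambda>p. blinfun_mult_right (case p of (z, \<tau>) \<Rightarrow> deriv (\<lambda>w. F (z, w)) \<tau>))"
      by (intro continuous_intros)
    then have "continuous_on N (\<lambda>(z, \<tau>). D z \<tau>)"
      by (simp add: D_def case_prod_unfold)
    then show ?thesis
      using \<open>p \<in> N\<close> p assms(1) by (simp add: continuous_at_imp_continuous_at_within continuous_on_eq_continuous_at)
  qed
  have "((\<lambda>(z, \<tau>). F (z, \<tau>)) has_derivative (\<lambda>(tx, ty). deriv (\<lambda>z. F (z, \<tau>0)) z0 * tx + D z0 \<tau>0 ty))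
     (at (z0, \<tau>0) within ball z0 r \<times> ball \<tau>0 r)"
  proof (rule has_derivative_partialsI[OF _ _ D])
    show "((\<lambda>x. F (x, \<tau>0)) has_derivative (*) (deriv (\<lambda>z. F (z, \<tau>0)) z0)) (at z0 within ball z0 r)"
      using d1 has_derivative_at_withinI has_field_derivative_def by blast
    show "((\<lambda>y. F (x, y)) has_derivative blinfun_apply (D x y)) (at y within ball \<tau>0 r)"
      if "x \<in> ball z0 r" "y \<in> ball \<tau>0 r" for x y
      using d2[OF that] unfolding D_def
      by (auto simp: has_field_derivative_def blinfun_mult_right.rep_eq intro: has_derivative_at_withinI)
  qed (use r in auto)
  then have "(F has_derivative (\<lambda>(tx, ty). deriv (\<lambda>z. F (z, \<tau>0)) z0 * tx + D z0 \<tau>0 ty)) (at (z0, \<tau>0))"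
    using r(1) by (subst (asm) at_within_open) (auto intro: open_Times)
  then show "\<exists>a b. (F has_derivative (\<lambda>v. a * fst v + b * snd v)) (at p)"
    unfolding p by (auto simp: D_def case_prod_unfold blinfun_mult_right.rep_eq)
qed

lemma holo2_on_const [simp]: "holo2_on (\<lambda>_. c) N"
  unfolding holo2_on_def by (intro ballI exI[of _ 0]) simp

lemma holo2_on_fst: "holo2_on fst N"
  unfolding holo2_on_def
  by (intro ballI exI[of _ 1] exI[of _ 0]) (simp add: bounded_linear_fst bounded_linear_imp_has_derivative)

lemma holo2_on_mult:
  assumes "holo2_on F N" "holo2_on G N"
  shows "holo2_on (\<lambda>p. F p * G p) N"
  unfolding holo2_on_def
proof
  fix p assume "p \<in> N"
  then obtain a b c d where "(F has_derivative (\<lambda>v. a * fst v + b * snd v)) (at p)"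
    "(G has_derivative (\<lambda>v. c * fst v + d * snd v)) (at p)"
    using assms unfolding holo2_on_def by meson
  from has_derivative_mult[OF this]
  show "\<exists>a b. ((\<lambda>p. F p * G p) has_derivative (\<lambda>v. a * fst v + b * snd v)) (at p)"
    by (intro exI[of _ "F p * c + a * G p"] exI[of _ "F p * d + b * G p"]) (simp add: algebra_simps)
qed

lemma holo2_on_compose_holomorphic:
  assumes "holo2_on F N" "g holomorphic_on S" "open S" "\<And>p. p \<in> N \<Longrightarrow> F p \<in> S"
  shows "holo2_on (\<lambda>p. g (F p)) N"
  unfolding holo2_on_def
proof
  fix p assume p: "p \<in> N"
  then obtain a b where F: "(F has_derivative (\<lambda>v. a * fst v + b * snd v)) (at p)"
    using assms unfolding holo2_on_def by meson
  have "(g has_field_derivative deriv g (F p)) (at (F p))"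
    using assms p holomorphic_derivI by blast
  from diff_chain_at[OF F this[unfolded has_field_derivative_def]]
  show "\<exists>a b. ((\<lambda>p. g (F p)) has_derivative (\<lambda>v. a * fst v + b * snd v)) (at p)"
    by (intro exI[of _ "deriv g (F p) * a"] exI[of _ "deriv g (F p) * b"]) (simp add: algebra_simps o_def)
qed

lemma holo2_on_divide:
  assumes "holo2_on F N" "holo2_on G N" "\<And>p. p \<in> N \<Longrightarrow> G p \<noteq> 0"
  shows "holo2_on (\<lambda>p. F p / G p) N"
proof -
  have "holo2_on (\<lambda>p. inverse (G p)) N"
    using assms by (intro holo2_on_compose_holomorphic[of G N inverse "-{0}"] holomorphic_intros) auto
  from holo2_on_mult[OF assms(1) this] show ?thesis by (simp add: divide_inverse)
qed

text \<open>The coefficient is a Cauchy integral in \<open>z\<close>, which depends holomorphically on the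
  parameter \<open>\<tau>\<close> because \<open>\<partial>F/\<partial>\<tau>\<close> is continuous.\<close>

lemma holomorphic_on_higher_deriv_slice:
  assumes "open N" and F: "holo2_on F N" and r: "r > 0" "cball 0 r \<times> ball \<tau>0 r \<subseteq> N"
  shows "(\<lambda>\<tau>. (deriv ^^ k) (\<lambda>z. F (z, \<tau>)) 0) holomorphic_on ball \<tau>0 r"
proof -
  note cont = holo2_on_imp_continuous_on[OF F]
  define c where "c = (\<lambda>t. circlepath 0 r t :: complex)"
  define c' where "c' = (\<lambda>t. vector_derivative (circlepath 0 r) (at t))"
  have c: "continuous_on A c" for A
    unfolding c_def circlepath by (intro continuous_intros)
  have cr: "norm (c t) = r" "c t \<noteq> 0" "c t \<in> cball 0 r" for t
    using r(1) by (auto simp: c_def circlepath norm_mult)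
  have c'_eq: "c' t = 2 * pi * \<i> * r * exp (2 * of_real pi * \<i> * t)" for t
    unfolding c'_def by (rule vector_derivative_circlepath)
  define h where "h = (\<lambda>\<tau> t. F (c t, \<tau>) / c t ^ Suc k * c' t)"
  have hint: "(\<lambda>\<tau>. integral (cbox 0 1) (h \<tau>)) holomorphic_on ball \<tau>0 r"
  proof (rule leibniz_rule_holomorphic[where fx = "\<lambda>\<tau> t. deriv (\<lambda>\<tau>. F (c t, \<tau>)) \<tau> / c t ^ Suc k * c' t"])
    fix \<tau> :: complex and t :: real assume *: "\<tau> \<in> ball \<tau>0 r" "t \<in> cbox 0 1"
    have "ball \<tau>0 r \<subseteq> {\<tau>. (c t, \<tau>) \<in> N}" using r cr by auto
    from holomorphic_on_subset[OF holo2_on_slice2[OF F] this]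
    have "((\<lambda>\<tau>. F (c t, \<tau>)) has_field_derivative deriv (\<lambda>\<tau>. F (c t, \<tau>)) \<tau>) (at \<tau> within ball \<tau>0 r)"
      using * by (meson holomorphic_derivI open_ball)
    then show "((\<lambda>\<tau>. h \<tau> t) has_field_derivative
         (deriv (\<lambda>\<tau>. F (c t, \<tau>)) \<tau> / c t ^ Suc k * c' t)) (at \<tau> within ball \<tau>0 r)"
      unfolding h_def by (intro DERIV_cmult_right DERIV_cdivide)
  next
    fix \<tau> assume *: "\<tau> \<in> ball \<tau>0 r"
    have "continuous_on {0..1} (\<lambda>t. F (c t, \<tau>) / c t ^ Suc k * (2 * pi * \<i> * r * exp (2 * of_real pi * \<i> * t)))"
      using * r cr by (intro continuous_intros continuous_on_compose2[OF cont] c) auto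
    then have "continuous_on {0..1} (h \<tau>)"
      by (rule continuous_on_eq) (simp add: h_def c'_eq)
    then show "h \<tau> integrable_on cbox 0 1" by (simp add: integrable_continuous_real)
  next
    have D: "continuous_on N (\<lambda>(z, \<tau>). deriv (\<lambda>w. F (z, w)) \<tau>)"
      by (rule continuous_on_partial_deriv2[OF assms(1) cont holo2_on_slice2[OF F]])
    have cs: "continuous_on A (\<lambda>x. c (snd x))" for A :: "(complex \<times> real) set"
      by (rule continuous_on_compose2[OF c[of UNIV]]) (auto intro: continuous_intros)
    have "continuous_on (ball \<tau>0 r \<times> {0..1}) (\<lambda>x. (c (snd x), fst x))"
      by (rule continuous_on_Pair[OF cs continuous_on_fst[OF continuous_on_id]])
    then have "continuous_on (ball \<tau>0 r \<times> {0..1}) (\<lambda>x. case (c (snd x), fst x) of (z, \<tau>) \<Rightarrow> deriv (\<lambda>w. F (z, w)) \<tau>)"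
    proof (rule continuous_on_compose2[OF D])
      show "(\<lambda>x. (c (snd x), fst x)) ` (ball \<tau>0 r \<times> {0..1}) \<subseteq> N"
      proof (rule image_subsetI)
        fix x assume "x \<in> ball \<tau>0 r \<times> {0..1::real}"
        then have "(c (snd x), fst x) \<in> cball 0 r \<times> ball \<tau>0 r"
          using cr(3) by (simp add: mem_Times_iff)
        then show "(c (snd x), fst x) \<in> N"
          using r(2) by (rule subsetD[rotated])
      qed
    qed
    then have d: "continuous_on (ball \<tau>0 r \<times> {0..1}) (\<lambda>x. deriv (\<lambda>w. F (c (snd x), w)) (fst x))"
      by simp
    have e: "continuous_on (ball \<tau>0 r \<times> {0..1})
          (\<lambda>x::complex \<times> real. 2 * pi * \<i> * r * exp (2 * of_real pi * \<i> * of_real (snd x)))"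
      by (intro continuous_intros)
    have "\<forall>x\<in>ball \<tau>0 r \<times> {0..1}. c (snd x) ^ Suc k \<noteq> 0"
      using cr(2) by simp
    from continuous_on_mult[OF continuous_on_divide[OF d continuous_on_power[OF cs] this] e]
    show "continuous_on (ball \<tau>0 r \<times> cbox 0 1) (\<lambda>(\<tau>, t). deriv (\<lambda>\<tau>. F (c t, \<tau>)) \<tau> / c t ^ Suc k * c' t)"
      unfolding box_real by (rule continuous_on_eq) (auto simp: c'_eq simp del: power_Suc)
  qed auto
  have eq: "(deriv ^^ k) (\<lambda>z. F (z, \<tau>)) 0 = fact k / (2 * pi * \<i>) * integral (cbox 0 1) (h \<tau>)"
    if "\<tau> \<in> ball \<tau>0 r" for \<tau>
  proof -
    have sub: "cball 0 r \<subseteq> {z. (z, \<tau>) \<in> N}" using r that by auto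
    note hol = holomorphic_on_subset[OF holo2_on_slice1[OF F] this]
    have "(deriv ^^ k) (\<lambda>z. F (z, \<tau>)) 0 = fact k / (2 * pi * \<i>) *
        contour_integral (circlepath 0 r) (\<lambda>u. F (u, \<tau>) / (u - 0) ^ Suc k)"
      by (rule Cauchy_higher_derivative_integral_circlepath)
         (use hol r(1) in \<open>auto intro: holomorphic_on_imp_continuous_on holomorphic_on_subset\<close>)
    then show ?thesis
      by (simp add: contour_integral_integral h_def c_def c'_def)
  qed
  have "(\<lambda>\<tau>. fact k / (2 * pi * \<i>) * integral (cbox 0 1) (h \<tau>)) holomorphic_on ball \<tau>0 r"
    by (intro holomorphic_intros hint)
  then show ?thesis
    by (rule holomorphic_transform) (rule eq[symmetric])
qed


subsection \<open>Germs along a submanifold\<close>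

text \<open>The translation \<open>(z, \<tau>) \<mapsto> (z + n - \<tau> m, \<tau>)\<close> is affine in \<open>z\<close> and \<open>\<tau>\<close> together, so its
  derivative is complex linear.\<close>

lemma holo2_on_compose_dual_act:
  assumes "holo2_on F N"
  shows "holo2_on (\<lambda>p. F (dual_act n m p)) (dual_act n m -` N)"
  unfolding holo2_on_def
proof
  fix p assume "p \<in> dual_act n m -` N"
  then obtain a b where *: "(F has_derivative (\<lambda>v. a * fst v + b * snd v)) (at (dual_act n m p))"
    using assms unfolding holo2_on_def by blast
  have "dual_act n m = (\<lambda>p. (fst p + of_int n - snd p * of_int m, snd p))"
    by (auto simp: dual_act_def)
  then have "(dual_act n m has_derivative (\<lambda>v. (fst v - snd v * of_int m, snd v))) (at p)"
    by (auto intro!: derivative_eq_intros)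
  from diff_chain_at[OF this *]
  show "\<exists>a b. ((\<lambda>p. F (dual_act n m p)) has_derivative (\<lambda>v. a * fst v + b * snd v)) (at p)"
    by (intro exI[of _ a] exI[of _ "b - a * of_int m"]) (simp add: algebra_simps o_def)
qed

lemma continuous_on_dual_act: "continuous_on A (dual_act n m)"
proof -
  have "dual_act n m = (\<lambda>p. (fst p + of_int n - snd p * of_int m, snd p))"
    by (auto simp: dual_act_def)
  then show ?thesis by (auto intro!: continuous_intros)
qed

lemma snd_dual_act [simp]: "snd (dual_act n m p) = snd p"
  by (simp add: dual_act_def case_prod_unfold)

text \<open>Holomorphy of a function on \<open>\<complex> \<times> U\<close> at a single point. Only the values over \<open>U\<close> matter,
  so the notion is stable under the changes of ambient extension that occur in quotients and
  compositions.\<close>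

definition holo2_germ :: "complex set \<Rightarrow> (complex \<times> complex \<Rightarrow> complex) \<Rightarrow> complex \<times> complex \<Rightarrow> bool" where
  "holo2_germ U f p \<longleftrightarrow>
     (\<exists>N F. open N \<and> p \<in> N \<and> holo2_on F N \<and> (\<forall>x\<in>N. snd x \<in> U \<longrightarrow> f x = F x))"

lemma holo2_sub_iff_germ:
  assumes "openin (top_of_set (UNIV \<times> U)) S"
  shows "holo2_sub S f \<longleftrightarrow> (\<forall>p\<in>S. holo2_germ U f p)"
proof
  obtain T where T: "open T" "S = UNIV \<times> U \<inter> T" using assms openin_open by blast
  assume *: "holo2_sub S f"
  show "\<forall>p\<in>S. holo2_germ U f p"
  proof
    fix p assume p: "p \<in> S"
    with * obtain N F where N: "open N" "p \<in> N" "holo2_on F N" "\<forall>x\<in>N \<inter> S. f x = F x"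
      unfolding holo2_sub_def by blast
    then show "holo2_germ U f p"
      unfolding holo2_germ_def using T p holo2_on_subset[OF N(3), of "N \<inter> T"]
      by (intro exI[of _ "N \<inter> T"] exI[of _ F]) (auto simp: mem_Times_iff)
  qed
next
  assume germs: "\<forall>p\<in>S. holo2_germ U f p"
  have S: "S \<subseteq> UNIV \<times> U" using openin_imp_subset[OF assms] .
  have "\<exists>N F. open N \<and> p \<in> N \<and> holo2_on F N \<and> (\<forall>x\<in>N \<inter> S. f x = F x)" if "p \<in> S" for p
  proof -
    have "holo2_germ U f p" using germs that ..
    then obtain N F where N: "open N" "p \<in> N" "holo2_on F N" "\<forall>x\<in>N. snd x \<in> U \<longrightarrow> f x = F x"
      unfolding holo2_germ_def by (elim exE conjE)
    have "\<forall>x\<in>N \<inter> S. f x = F x" using N(4) S by (auto simp: mem_Times_iff)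
    then show ?thesis using N(1-3) by (intro exI conjI)
  qed
  then show "holo2_sub S f"
    unfolding holo2_sub_def by blast
qed

lemma holo2_germ_const: "holo2_germ U (\<lambda>_. c) p"
  unfolding holo2_germ_def by (intro exI[of _ UNIV] exI[of _ "\<lambda>_. c"]) auto

lemma holo2_on_imp_germ: "holo2_on F N \<Longrightarrow> open N \<Longrightarrow> p \<in> N \<Longrightarrow> holo2_germ U F p"
  unfolding holo2_germ_def by blast

lemma holo2_germ_cong:
  assumes "holo2_germ U f p" "open N" "p \<in> N" "\<And>x. x \<in> N \<Longrightarrow> snd x \<in> U \<Longrightarrow> g x = f x"
  shows "holo2_germ U g p"
proof -
  obtain M F where M: "open M" "p \<in> M" "holo2_on F M" "\<forall>x\<in>M. snd x \<in> U \<longrightarrow> f x = F x"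
    using assms(1) unfolding holo2_germ_def by blast
  have "holo2_on F (M \<inter> N)" using M(3) by (rule holo2_on_subset) simp
  then show ?thesis unfolding holo2_germ_def
    using M assms(2-4) by (intro exI[of _ "M \<inter> N"] exI[of _ F]) auto
qed

lemma holo2_germ_mult:
  assumes "holo2_germ U f p" "holo2_germ U g p"
  shows "holo2_germ U (\<lambda>x. f x * g x) p"
proof -
  obtain M F where M: "open M" "p \<in> M" "holo2_on F M" "\<forall>x\<in>M. snd x \<in> U \<longrightarrow> f x = F x"
    using assms(1) unfolding holo2_germ_def by blast
  obtain N G where N: "open N" "p \<in> N" "holo2_on G N" "\<forall>x\<in>N. snd x \<in> U \<longrightarrow> g x = G x"
    using assms(2) unfolding holo2_germ_def by blast
  have "holo2_on (\<lambda>x. F x * G x) (M \<inter> N)"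
    using holo2_on_subset[OF M(3)] holo2_on_subset[OF N(3)] by (intro holo2_on_mult) simp_all
  then show ?thesis unfolding holo2_germ_def
    using M N by (intro exI[of _ "M \<inter> N"] exI[of _ "\<lambda>x. F x * G x"]) auto
qed

lemma holo2_germ_nonzero:
  assumes "holo2_germ U f p" "snd p \<in> U" "f p \<noteq> 0"
  obtains N where "open N" "p \<in> N" "\<And>x. x \<in> N \<Longrightarrow> snd x \<in> U \<Longrightarrow> f x \<noteq> 0"
proof -
  obtain M F where M: "open M" "p \<in> M" "holo2_on F M" "\<forall>x\<in>M. snd x \<in> U \<longrightarrow> f x = F x"
    using assms(1) unfolding holo2_germ_def by blast
  have "open (F -` (-{0}) \<inter> M)"
    using continuous_open_preimage[OF holo2_on_imp_continuous_on[OF M(3)] M(1), of "-{0}"]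
    by (simp add: Int_commute open_Compl)
  then show ?thesis
    by (rule that) (use assms M in \<open>auto simp: mem_Times_iff\<close>)
qed

lemma holo2_germ_inverse:
  assumes "holo2_germ U g p" "snd p \<in> U" "g p \<noteq> 0"
  shows "holo2_germ U (\<lambda>x. 1 / g x) p"
proof -
  obtain M G where M: "open M" "p \<in> M" "holo2_on G M" "\<forall>x\<in>M. snd x \<in> U \<longrightarrow> g x = G x"
    using assms(1) unfolding holo2_germ_def by blast
  have "open (G -` (-{0}) \<inter> M)"
    using continuous_open_preimage[OF holo2_on_imp_continuous_on[OF M(3)] M(1), of "-{0}"]
    by (simp add: Int_commute open_Compl)
  moreover have "holo2_on (\<lambda>x. 1 / G x) (G -` (-{0}) \<inter> M)"
    using holo2_on_subset[OF M(3)] by (intro holo2_on_divide) auto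
  ultimately show ?thesis unfolding holo2_germ_def
    using M assms by (intro exI[of _ "G -` (-{0}) \<inter> M"] exI[of _ "\<lambda>x. 1 / G x"]) (auto simp: mem_Times_iff)
qed

lemma holo2_germ_divide:
  assumes "holo2_germ U f p" "holo2_germ U g p" "snd p \<in> U" "g p \<noteq> 0"
  shows "holo2_germ U (\<lambda>x. f x / g x) p"
  using holo2_germ_mult[OF assms(1) holo2_germ_inverse[OF assms(2-4)]] by simp

lemma holo2_germ_dual_act:
  assumes "holo2_germ U f (dual_act n m p)"
  shows "holo2_germ U (\<lambda>x. f (dual_act n m x)) p"
proof -
  obtain N F where N: "open N" "dual_act n m p \<in> N" "holo2_on F N" "\<forall>x\<in>N. snd x \<in> U \<longrightarrow> f x = F x"
    using assms unfolding holo2_germ_def by blast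
  have "open (dual_act n m -` N)"
    using continuous_open_vimage[OF N(1)] continuous_on_dual_act
    by (metis N(1) continuous_on_open_vimage open_UNIV Int_UNIV_right)
  then show ?thesis unfolding holo2_germ_def
    using N holo2_on_compose_dual_act[OF N(3)]
    by (intro exI[of _ "dual_act n m -` N"] exI[of _ "\<lambda>p. F (dual_act n m p)"])
       (auto simp: mem_Times_iff)
qed

lemma holo2_germ_slice_analytic:
  assumes "holo2_germ U f (z, \<tau>)" "\<tau> \<in> U"
  shows "(\<lambda>w. f (w, \<tau>)) analytic_on {z}"
proof -
  obtain N F where N: "open N" "(z, \<tau>) \<in> N" "holo2_on F N" "\<forall>x\<in>N. snd x \<in> U \<longrightarrow> f x = F x"
    using assms unfolding holo2_germ_def by blast
  obtain r where r: "r > 0" "cball z r \<times> cball \<tau> r \<subseteq> N"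
    using open_contains_cball_Times[OF N(1,2)] .
  have "ball z r \<subseteq> {z. (z, \<tau>) \<in> N}" using r by auto
  from holomorphic_on_subset[OF holo2_on_slice1[OF N(3)] this]
  have "(\<lambda>w. f (w, \<tau>)) holomorphic_on ball z r"
  proof (rule holomorphic_transform)
    fix x assume "x \<in> ball z r"
    then have "(x, \<tau>) \<in> N" using r by (intro subsetD[OF r(2)]) auto
    then show "F (x, \<tau>) = f (x, \<tau>)" using N(4) assms(2) by simp
  qed
  then show ?thesis using r(1) analytic_at_ball by blast
qed

text \<open>The coefficient is that of the ambient extension, which has the same slices over all nearby
  points of \<open>U\<close>.\<close>

lemma holo2_germ_coefficient:
  assumes "holo2_germ U f (0, \<tau>0)" "\<tau>0 \<in> U"
  obtains N F where "open N" "\<tau>0 \<in> N" "F holomorphic_on N"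
    "\<And>\<tau>. \<tau> \<in> N \<Longrightarrow> \<tau> \<in> U \<Longrightarrow> fps_nth (fps_expansion (\<lambda>z. f (z, \<tau>)) 0) k = F \<tau>"
proof -
  obtain N F where N: "open N" "(0, \<tau>0) \<in> N" "holo2_on F N" "\<forall>x\<in>N. snd x \<in> U \<longrightarrow> f x = F x"
    using assms unfolding holo2_germ_def by blast
  obtain r where r: "r > 0" "cball 0 r \<times> cball \<tau>0 r \<subseteq> N"
    using open_contains_cball_Times[OF N(1,2)] .
  have "(\<lambda>\<tau>. (deriv ^^ k) (\<lambda>z. F (z, \<tau>)) 0) holomorphic_on ball \<tau>0 r"
    using r by (intro holomorphic_on_higher_deriv_slice[OF N(1,3)]) auto
  then have "(\<lambda>\<tau>. fps_nth (fps_expansion (\<lambda>z. F (z, \<tau>)) 0) k) holomorphic_on ball \<tau>0 r"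
    unfolding fps_expansion_def by (auto intro!: holomorphic_intros)
  then show ?thesis
  proof (rule that[rotated 2])
    fix \<tau> assume *: "\<tau> \<in> ball \<tau>0 r" "\<tau> \<in> U"
    have "\<forall>\<^sub>F z in nhds 0. z \<in> ball 0 r" using r(1) by (intro eventually_nhds_in_open) auto
    then have "\<forall>\<^sub>F z in nhds 0. f (z, \<tau>) = F (z, \<tau>)"
    proof eventually_elim
      case (elim z)
      then have "(z, \<tau>) \<in> N" using * by (intro subsetD[OF r(2)]) auto
      then show ?case using N(4) *(2) by simp
    qed
    then show "fps_nth (fps_expansion (\<lambda>z. f (z, \<tau>)) 0) k = fps_nth (fps_expansion (\<lambda>z. F (z, \<tau>)) 0) k"
      using fps_expansion_cong by metis
  qed (use r in auto)
qed

section \<open>The function \<open>\<upsilon>\<close>\<close>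

definition expi :: "complex \<Rightarrow> complex" where
  "expi z = exp (2 * of_real pi * \<i> * z)"

lemma expi_nonzero [simp]: "expi z \<noteq> 0"
  by (simp add: expi_def)

lemma expi_add: "expi (a + b) = expi a * expi b"
  by (simp add: expi_def exp_add distrib_left)

lemma expi_diff: "expi (a - b) = expi a / expi b"
  by (simp add: expi_def exp_diff right_diff_distrib)

lemma expi_of_nat_mult: "expi (of_nat k * a) = expi a ^ k"
  by (simp add: expi_def exp_of_nat_mult[symmetric] ac_simps)

lemma expi_of_int [simp]: "expi (of_int n) = 1"
  by (auto simp: expi_def exp_eq_1 intro!: exI[of _ n])

lemma expi_eq_1_imp_int:
  assumes "expi z = 1"
  obtains n :: int where "z = of_int n"
proof -
  from assms obtain n :: int where "Re (2 * of_real pi * \<i> * z) = 0" "Im (2 * of_real pi * \<i> * z) = of_int (2 * n) * pi"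
    unfolding expi_def exp_eq_1 by blast
  then have "z = of_int n" by (auto simp: complex_eq_iff)
  then show ?thesis by (rule that)
qed

lemma norm_expi_less_1: "Im \<tau> > 0 \<Longrightarrow> norm (expi \<tau>) < 1"
  by (simp add: expi_def)

lemma expi_power_neq_1: "Im \<tau> > 0 \<Longrightarrow> expi \<tau> ^ Suc m \<noteq> 1"
  using norm_expi_less_1[of \<tau>] power_Suc_less_one[of "norm (expi \<tau>)" m]
  by (metis norm_ge_zero norm_one norm_power order_less_irrefl power_less_one_iff zero_less_Suc)

definition upsilon_factor :: "complex \<Rightarrow> complex \<Rightarrow> nat \<Rightarrow> complex" where
  "upsilon_factor q y m = (1 - q ^ Suc m * y) * (1 - q ^ Suc m * inverse y) / (1 - q ^ Suc m)\<^sup>2"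

definition upsilon_prod :: "complex \<times> complex \<Rightarrow> complex" where
  "upsilon_prod p = (\<Prod>m. upsilon_factor (expi (snd p)) (expi (fst p)) m)"

lemma upsilon_eq: "upsilon \<tau> z = (1 - expi z) * upsilon_prod (z, \<tau>)"
  by (simp add: upsilon_def upsilon_prod_def upsilon_factor_def expi_def Let_def)

lemma upsilon_factor_eq:
  assumes "q ^ Suc m \<noteq> 1" "y \<noteq> 0"
  shows "upsilon_factor q y m = 1 + q ^ Suc m * (2 - y - inverse y) / (1 - q ^ Suc m)\<^sup>2"
proof -
  define k where "k = q ^ Suc m"
  have "(1 - k)\<^sup>2 \<noteq> 0" using assms by (simp add: k_def)
  then show ?thesis
    unfolding upsilon_factor_def k_def[symmetric] using assms(2)
    by (simp add: divide_simps) (simp add: field_simps power2_eq_square)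
qed

lemma open_UNIV_times_upper_half_plane: "open (UNIV \<times> upper_half_plane)"
  unfolding upper_half_plane_def by (intro open_Times open_halfspace_Im_gt) auto

text \<open>The product converges uniformly on compact sets because its \<open>m\<close>-th factor differs from \<open>1\<close>
  by \<open>q\<^sup>m (2 - y - y\<^sup>-\<^sup>1) / (1 - q\<^sup>m)\<^sup>2\<close>.\<close>

lemma uniform_limit_upsilon_prod:
  assumes A: "compact A" "A \<subseteq> UNIV \<times> upper_half_plane"
  shows "uniform_limit A (\<lambda>N p. \<Prod>m<N. upsilon_factor (expi (snd p)) (expi (fst p)) m) upsilon_prod sequentially"
    and "p \<in> A \<Longrightarrow> convergent_prod (upsilon_factor (expi (snd p)) (expi (fst p)))"
proof -
  define g where "g = (\<lambda>m p. expi (snd p) ^ Suc m * (2 - expi (fst p) - inverse (expi (fst p)))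
      / (1 - expi (snd p) ^ Suc m)\<^sup>2)"
  have nz: "expi (snd p) ^ Suc m \<noteq> 1" if "p \<in> A" for p m
    using A(2) that by (intro expi_power_neq_1) (auto simp: upper_half_plane_def)
  have fac: "upsilon_factor (expi (snd p)) (expi (fst p)) m = 1 + g m p" if "p \<in> A" for p m
    unfolding g_def using nz[OF that] by (rule upsilon_factor_eq) simp
  \<comment> \<open>by compactness \<open>|q|\<close> stays away from \<open>1\<close>, which bounds the factors by a geometric series\<close>
  have "\<exists>\<rho> C. 0 \<le> \<rho> \<and> \<rho> < 1 \<and> 0 \<le> C \<and> (\<forall>p\<in>A. norm (expi (snd p)) \<le> \<rho> \<and>
           norm (2 - expi (fst p) - inverse (expi (fst p))) \<le> C)"
  proof (cases "A = {}")
    case False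
    have "continuous_on A (\<lambda>p. norm (expi (snd p)))"
      unfolding expi_def by (intro continuous_intros)
    from continuous_attains_sup[OF A(1) False this] obtain a where a: "a \<in> A"
      "\<forall>p\<in>A. norm (expi (snd p)) \<le> norm (expi (snd a))" by blast
    have "continuous_on A (\<lambda>p. norm (2 - expi (fst p) - inverse (expi (fst p))))"
      unfolding expi_def by (intro continuous_intros) auto
    from continuous_attains_sup[OF A(1) False this] obtain b where b: "b \<in> A"
      "\<forall>p\<in>A. norm (2 - expi (fst p) - inverse (expi (fst p)))
        \<le> norm (2 - expi (fst b) - inverse (expi (fst b)))" by blast
    have "Im (snd a) > 0" using a A(2) by (auto simp: upper_half_plane_def)
    from norm_expi_less_1[OF this] show ?thesis
      using a(2) b(2) by (intro exI[of _ "norm (expi (snd a))"]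
        exI[of _ "norm (2 - expi (fst b) - inverse (expi (fst b)))"]) auto
  qed (auto intro: exI[of _ 0])
  then obtain \<rho> C where \<rho>: "0 \<le> \<rho>" "\<rho> < 1" "0 \<le> C"
    and bd: "\<And>p. p \<in> A \<Longrightarrow> norm (expi (snd p)) \<le> \<rho>"
      "\<And>p. p \<in> A \<Longrightarrow> norm (2 - expi (fst p) - inverse (expi (fst p))) \<le> C" by blast
  have g: "norm (g m p) \<le> C / (1 - \<rho>)\<^sup>2 * \<rho> ^ Suc m" if "p \<in> A" for m p
  proof -
    have pw: "norm (expi (snd p) ^ Suc m) \<le> \<rho> ^ Suc m"
      unfolding norm_power using bd(1)[OF that] by (intro power_mono) auto
    have "\<rho> ^ Suc m \<le> \<rho>" using mult_left_le[of "\<rho> ^ m" \<rho>] power_le_one[of \<rho> m] \<rho> by simp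
    then have "norm (expi (snd p) ^ Suc m) \<le> \<rho>" using pw by linarith
    then have "1 - \<rho> \<le> norm (1 - expi (snd p) ^ Suc m)"
      using norm_triangle_ineq2[of 1 "expi (snd p) ^ Suc m"] by simp
    then have "(1 - \<rho>)\<^sup>2 \<le> norm ((1 - expi (snd p) ^ Suc m)\<^sup>2)"
      using \<rho> unfolding norm_power by (intro power_mono) auto
    moreover have "(1 - \<rho>)\<^sup>2 > 0" using \<rho> by simp
    ultimately have "norm (g m p) \<le> (\<rho> ^ Suc m * C) / (1 - \<rho>)\<^sup>2"
      unfolding g_def norm_divide norm_mult using pw bd(2)[OF that] \<rho>
      by (intro frac_le mult_mono) (auto simp del: power_Suc)
    then show ?thesis by (simp add: ac_simps)
  qed
  have sm: "summable (\<lambda>m. C / (1 - \<rho>)\<^sup>2 * \<rho> ^ Suc m)"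
    using \<rho> by (intro summable_mult) (auto simp del: power_Suc simp: summable_Suc_iff[of "\<lambda>m. \<rho> ^ m"] summable_geometric)
  have conv: "convergent_prod (upsilon_factor (expi (snd p)) (expi (fst p)))" if "p \<in> A" for p
  proof -
    have "summable (\<lambda>m. norm (upsilon_factor (expi (snd p)) (expi (fst p)) m - 1))"
      by (rule summable_comparison_test'[OF sm]) (use g[OF that] fac[OF that] in auto)
    then show ?thesis
      by (intro abs_convergent_prod_imp_convergent_prod summable_imp_abs_convergent_prod)
  qed
  then show "p \<in> A \<Longrightarrow> convergent_prod (upsilon_factor (expi (snd p)) (expi (fst p)))" .
  have "uniformly_convergent_on A (\<lambda>N p. \<Prod>m<N. 1 + g m p)"
  proof (rule uniformly_convergent_on_prod[OF _ A(1)])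
    show "continuous_on A (g m)" for m
      unfolding g_def using nz by (auto intro!: continuous_intros simp: expi_def simp del: power_Suc)
    show "uniformly_convergent_on A (\<lambda>N p. \<Sum>n<N. norm (g n p))"
      by (rule Weierstrass_m_test'[OF _ sm]) (use g in auto)
  qed
  then obtain l where "uniform_limit A (\<lambda>N p. \<Prod>m<N. 1 + g m p) l sequentially"
    unfolding uniformly_convergent_on_def by blast
  then have l: "uniform_limit A (\<lambda>N p. \<Prod>m<N. upsilon_factor (expi (snd p)) (expi (fst p)) m) l sequentially"
    by (rule uniform_limit_cong'[THEN iffD1, rotated 2]) (simp_all add: fac)
  have lp: "l p = upsilon_prod p" if "p \<in> A" for p
  proof -
    have "(\<lambda>N. \<Prod>m<N. upsilon_factor (expi (snd p)) (expi (fst p)) m) \<longlonglongrightarrow> l p"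
      using tendsto_uniform_limitI[OF l that] .
    moreover have "(\<lambda>N. \<Prod>m<N. upsilon_factor (expi (snd p)) (expi (fst p)) m) \<longlonglongrightarrow> upsilon_prod p"
      unfolding upsilon_prod_def LIMSEQ_lessThan_iff_atMost
      by (rule convergent_prod_LIMSEQ[OF conv[OF that]])
    ultimately show ?thesis by (rule LIMSEQ_unique)
  qed
  show "uniform_limit A (\<lambda>N p. \<Prod>m<N. upsilon_factor (expi (snd p)) (expi (fst p)) m) upsilon_prod sequentially"
    by (rule uniform_limit_cong'[THEN iffD1, OF _ _ l]) (simp_all add: lp)
qed

lemma convergent_upsilon_prod:
  assumes "Im \<tau> > 0"
  shows "convergent_prod (upsilon_factor (expi \<tau>) (expi z))"
  using uniform_limit_upsilon_prod(2)[of "{(z, \<tau>)}" "(z, \<tau>)"] assms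
  by (auto simp: upper_half_plane_def)

lemma upsilon_LIMSEQ:
  assumes "Im \<tau> > 0"
  shows "(\<lambda>N. (1 - expi z) * (\<Prod>m<N. upsilon_factor (expi \<tau>) (expi z) m)) \<longlonglongrightarrow> upsilon \<tau> z"
  unfolding upsilon_eq upsilon_prod_def fst_conv snd_conv LIMSEQ_lessThan_iff_atMost
  using convergent_prod_LIMSEQ[OF convergent_upsilon_prod[OF assms, of z]]
    tendsto_mult_left LIMSEQ_lessThan_iff_atMost by blast

lemma holo2_on_upsilon_prod: "holo2_on upsilon_prod (UNIV \<times> upper_half_plane)"
proof (rule osgood[OF open_UNIV_times_upper_half_plane])
  let ?N = "UNIV \<times> upper_half_plane :: (complex \<times> complex) set"
  let ?P = "\<lambda>N p. \<Prod>m<N. upsilon_factor (expi (snd p)) (expi (fst p)) m"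
  have nz: "(1 - expi \<tau> ^ Suc m)\<^sup>2 \<noteq> 0" if "\<tau> \<in> upper_half_plane" for \<tau> m
    using expi_power_neq_1[of \<tau> m] that by (simp add: upper_half_plane_def)
  have P: "continuous_on ?N (?P N)" for N
    unfolding upsilon_factor_def expi_def
    by (intro continuous_intros ballI) (use nz in \<open>auto simp: expi_def\<close>)
  have "isCont upsilon_prod p" if pN: "p \<in> ?N" for p
  proof -
    obtain z0 \<tau>0 where p: "p = (z0, \<tau>0)" by force
    obtain r where r: "r > 0" "cball z0 r \<times> cball \<tau>0 r \<subseteq> ?N"
      using open_contains_cball_Times[OF open_UNIV_times_upper_half_plane pN[unfolded p]] .
    have "continuous_on (cball z0 r \<times> cball \<tau>0 r) upsilon_prod"
    proof (rule uniform_limit_theorem)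
      show "\<forall>\<^sub>F N in sequentially. continuous_on (cball z0 r \<times> cball \<tau>0 r) (?P N)"
        using continuous_on_subset[OF P r(2)] by simp
      show "uniform_limit (cball z0 r \<times> cball \<tau>0 r) ?P upsilon_prod sequentially"
        using r(2) by (intro uniform_limit_upsilon_prod(1) compact_Times) auto
    qed simp
    then have "continuous_on (ball z0 r \<times> ball \<tau>0 r) upsilon_prod"
      by (rule continuous_on_subset) (intro Sigma_mono ball_subset_cball)
    then show ?thesis
      using r(1) p continuous_on_eq_continuous_at[OF open_Times[OF open_ball open_ball], of z0 r \<tau>0 r upsilon_prod]
      by (simp del: ball_simps)
  qed
  then show "continuous_on ?N upsilon_prod"
    by (intro continuous_at_imp_continuous_on ballI)
  show "(\<lambda>z. upsilon_prod (z, \<tau>)) holomorphic_on {z. (z, \<tau>) \<in> ?N}" for \<tau>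
  proof (cases "\<tau> \<in> upper_half_plane")
    case True
    have "(\<lambda>z. upsilon_prod (z, \<tau>)) holomorphic_on UNIV"
    proof (rule holomorphic_uniform_sequence)
      show "(\<lambda>z. ?P N (z, \<tau>)) holomorphic_on UNIV" for N
        unfolding upsilon_factor_def expi_def fst_conv snd_conv
        by (intro holomorphic_intros) (use nz[OF True] in \<open>auto simp: expi_def\<close>)
      show "\<exists>d>0. cball z d \<subseteq> UNIV \<and> uniform_limit (cball z d) (\<lambda>N z. ?P N (z, \<tau>)) (\<lambda>z. upsilon_prod (z, \<tau>)) sequentially" for z
      proof -
        have "uniform_limit (cball z 1 \<times> {\<tau>}) ?P upsilon_prod sequentially"
          using True by (intro uniform_limit_upsilon_prod(1) compact_Times) auto
        then have "uniform_limit (cball z 1) (\<lambda>N z. ?P N (z, \<tau>)) (\<lambda>z. upsilon_prod (z, \<tau>)) sequentially"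
          unfolding uniform_limit_iff by simp
        then show ?thesis by (intro exI[of _ 1]) auto
      qed
    qed auto
    then show ?thesis using True by simp
  qed (simp add: holomorphic_on_def)
  show "(\<lambda>\<tau>. upsilon_prod (z, \<tau>)) holomorphic_on {\<tau>. (z, \<tau>) \<in> ?N}" for z
  proof -
    have "(\<lambda>\<tau>. upsilon_prod (z, \<tau>)) holomorphic_on upper_half_plane"
    proof (rule holomorphic_uniform_sequence)
      show op: "open upper_half_plane"
        unfolding upper_half_plane_def by (intro open_halfspace_Im_gt)
      show "(\<lambda>\<tau>. ?P N (z, \<tau>)) holomorphic_on upper_half_plane" for N
        unfolding upsilon_factor_def expi_def fst_conv snd_conv
        by (intro holomorphic_intros) (use nz in \<open>auto simp: expi_def\<close>)
      show "\<exists>d>0. cball \<tau> d \<subseteq> upper_half_plane \<and> uniform_limit (cball \<tau> d) (\<lambda>N \<tau>. ?P N (z, \<tau>)) (\<lambda>\<tau>. upsilon_prod (z, \<tau>)) sequentially"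
        if "\<tau> \<in> upper_half_plane" for \<tau>
      proof -
        have "\<exists>d>0. cball \<tau> d \<subseteq> upper_half_plane"
          using op that unfolding open_contains_cball by (rule bspec)
        then obtain d where d: "d > 0" "cball \<tau> d \<subseteq> upper_half_plane" by (elim exE conjE)
        have "uniform_limit ({z} \<times> cball \<tau> d) ?P upsilon_prod sequentially"
          using d by (intro uniform_limit_upsilon_prod(1) compact_Times) auto
        then have "uniform_limit (cball \<tau> d) (\<lambda>N \<tau>. ?P N (z, \<tau>)) (\<lambda>\<tau>. upsilon_prod (z, \<tau>)) sequentially"
          unfolding uniform_limit_iff by simp
        then show ?thesis using d by (intro exI[of _ d]) auto
      qed
    qed
    then show ?thesis by simp
  qed
qed

text \<open>At \<open>y = 1\<close> every factor is \<open>(1 - q\<^sup>m)\<^sup>2 / (1 - q\<^sup>m)\<^sup>2\<close>, so the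
  denominators normalize the product to \<open>1\<close> on the zero section.\<close>

lemma upsilon_prod_0 [simp]: "Im \<tau> > 0 \<Longrightarrow> upsilon_prod (0, \<tau>) = 1"
proof -
  assume "Im \<tau> > 0"
  then have "upsilon_factor (expi \<tau>) (expi 0) = (\<lambda>_. 1)"
    using expi_power_neq_1[of \<tau>] by (auto simp: upsilon_factor_def expi_def power2_eq_square fun_eq_iff)
  then show ?thesis by (simp add: upsilon_prod_def)
qed

text \<open>The quotient \<open>\<upsilon> / z\<close>, continued to \<open>z = 0\<close>. The singularity is that of \<open>(1 - y) / z\<close>, a function of
  \<open>z\<close> alone, so it can be removed in one variable.\<close>

definition upsilon_cofactor :: "complex \<times> complex \<Rightarrow> complex" where
  "upsilon_cofactor p = (if fst p = 0 then deriv expi 0 else (expi (fst p) - expi 0) / (fst p - 0)) * - upsilon_prod p"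

lemma upsilon_eq_cofactor: "upsilon \<tau> z = z * upsilon_cofactor (z, \<tau>)"
  by (auto simp: upsilon_eq upsilon_cofactor_def) (auto simp: expi_def algebra_simps)

lemma upsilon_cofactor_0: "Im \<tau> > 0 \<Longrightarrow> upsilon_cofactor (0, \<tau>) \<noteq> 0"
proof -
  have "(expi has_field_derivative 2 * of_real pi * \<i>) (at 0)"
    unfolding expi_def by (auto intro!: derivative_eq_intros)
  then have "deriv expi 0 = 2 * of_real pi * \<i>" by (rule DERIV_imp_deriv)
  then show "Im \<tau> > 0 \<Longrightarrow> upsilon_cofactor (0, \<tau>) \<noteq> 0"
    by (simp add: upsilon_cofactor_def)
qed

lemma holo2_on_upsilon_cofactor: "holo2_on upsilon_cofactor (UNIV \<times> upper_half_plane)"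
proof -
  have "expi holomorphic_on UNIV" unfolding expi_def by (intro holomorphic_intros)
  then have "(\<lambda>z. if z = 0 then deriv expi 0 else (expi z - expi 0) / (z - 0)) holomorphic_on UNIV"
    by (rule pole_lemma) simp
  from holo2_on_compose_holomorphic[OF holo2_on_fst this]
  have "holo2_on (\<lambda>p. if fst p = 0 then deriv expi 0 else (expi (fst p) - expi 0) / (fst p - 0)) (UNIV \<times> upper_half_plane)"
    by simp
  moreover have "holo2_on (\<lambda>p. - upsilon_prod p) (UNIV \<times> upper_half_plane)"
    by (rule holo2_on_compose_holomorphic[OF holo2_on_upsilon_prod, of uminus UNIV]) (auto intro: holomorphic_intros)
  ultimately show ?thesis
    unfolding upsilon_cofactor_def[abs_def] by (rule holo2_on_mult)
qed

lemma holo2_on_upsilon: "holo2_on (\<lambda>p. upsilon (snd p) (fst p)) (UNIV \<times> upper_half_plane)"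
  using holo2_on_mult[OF holo2_on_fst holo2_on_upsilon_cofactor] by (simp add: upsilon_eq_cofactor)

text \<open>A convergent product vanishes only if one of its factors does, and
  \<open>q\<^sup>m y = 1\<close> or \<open>q\<^sup>m = y\<close> puts \<open>z\<close> into the lattice.\<close>

lemma upsilon_eq_0_imp_lattice:
  assumes "Im \<tau> > 0" "upsilon \<tau> z = 0"
  obtains n m :: int where "z = of_int n - \<tau> * of_int m"
proof -
  let ?q = "expi \<tau>" and ?y = "expi z"
  have "?y = 1 \<or> upsilon_prod (z, \<tau>) = 0" using assms by (auto simp: upsilon_eq)
  then consider "?y = 1" | m where "?q ^ Suc m * ?y = 1" | m where "?q ^ Suc m = ?y"
  proof
    assume "upsilon_prod (z, \<tau>) = 0"
    then have "0 \<in> range (upsilon_factor ?q ?y)"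
      using has_prod_eq_0_iff[OF convergent_prod_has_prod[OF convergent_upsilon_prod[OF assms(1)]], of z]
      by (simp add: upsilon_prod_def)
    then obtain m where "upsilon_factor ?q ?y m = 0" by force
    then have "1 - ?q ^ Suc m * ?y = 0 \<or> 1 - ?q ^ Suc m * inverse ?y = 0"
      using expi_power_neq_1[OF assms(1), of m] by (simp add: upsilon_factor_def del: power_Suc)
    then have "?q ^ Suc m * ?y = 1 \<or> ?q ^ Suc m = ?y"
      by (auto simp: divide_inverse[symmetric] simp del: power_Suc)
    then show ?thesis using that by blast
  qed
  then show ?thesis
  proof cases
    case 1
    then obtain n where "z = of_int n" by (rule expi_eq_1_imp_int)
    then show ?thesis using that[of n 0] by simp
  next
    case (2 m)
    then have "expi (of_nat (Suc m) * \<tau> + z) = 1" by (simp only: expi_add expi_of_nat_mult)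
    then obtain n where "of_nat (Suc m) * \<tau> + z = of_int n" by (rule expi_eq_1_imp_int)
    then show ?thesis using that[of n "int (Suc m)"] by (simp add: algebra_simps)
  next
    case (3 m)
    then have "expi (of_nat (Suc m) * \<tau> - z) = 1" by (simp only: expi_diff expi_of_nat_mult) simp
    then obtain n where "of_nat (Suc m) * \<tau> - z = of_int n" by (rule expi_eq_1_imp_int)
    then show ?thesis using that[of "-n" "- int (Suc m)"] by (simp add: algebra_simps)
  qed
qed

text \<open>The imaginary part of \<open>n - \<tau> m\<close> is a multiple of \<open>Im \<tau>\<close>, which bounds \<open>m\<close> first and then \<open>n\<close>.\<close>

lemma lattice_discrete:
  assumes "Im \<tau> > 0" "norm (of_int n - \<tau> * of_int m) < Im \<tau>" "norm (of_int n - \<tau> * of_int m) < 1"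
  shows "n = 0 \<and> m = 0"
proof -
  have "\<bar>Im \<tau> * of_int m\<bar> < Im \<tau>"
    using abs_Im_le_cmod[of "of_int n - \<tau> * of_int m"] assms(2) by simp
  then have "\<bar>of_int m :: real\<bar> < 1"
    using assms(1) by (simp add: abs_mult)
  then have m: "m = 0" by linarith
  then have "\<bar>of_int n :: real\<bar> < 1" using assms(3) by simp
  then show ?thesis using m by linarith
qed

text \<open>Passing from \<open>y\<close> to \<open>y / q\<close> shifts the factors \<open>1 - q\<^sup>m y\<close> down and the factors
  \<open>1 - q\<^sup>m / y\<close> up, so only boundary factors change. They are multiplied out instead of divided by because they
  may vanish.\<close>

lemma upsilon_partial_product_shift:
  assumes "q \<noteq> 0" "y \<noteq> 0"
  shows "(1 - y / q) * (\<Prod>m<N. upsilon_factor q (y / q) m) * (1 - q ^ N * y) * (1 - q / y)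
       = (1 - y / q) * (1 - q ^ Suc N / y) * ((1 - y) * (\<Prod>m<N. upsilon_factor q y m))"
proof (induction N)
  case (Suc N)
  define A B where "A = (\<Prod>m<N. upsilon_factor q (y / q) m)" and "B = (\<Prod>m<N. upsilon_factor q y m)"
  have 1: "upsilon_factor q (y / q) N = (1 - q ^ N * y) * (1 - q ^ Suc (Suc N) / y) / (1 - q ^ Suc N)\<^sup>2"
    using assms by (simp add: upsilon_factor_def field_simps)
  have 2: "upsilon_factor q y N = (1 - q ^ Suc N * y) * (1 - q ^ Suc N / y) / (1 - q ^ Suc N)\<^sup>2"
    by (simp add: upsilon_factor_def field_simps)
  have "(1 - y / q) * (\<Prod>m<Suc N. upsilon_factor q (y / q) m) * (1 - q ^ Suc N * y) * (1 - q / y)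
     = ((1 - y / q) * A * (1 - q ^ N * y) * (1 - q / y)) * ((1 - q ^ Suc (Suc N) / y) * (1 - q ^ Suc N * y) / (1 - q ^ Suc N)\<^sup>2)"
    unfolding prod.lessThan_Suc 1 A_def[symmetric] by (simp add: ac_simps)
  also have "\<dots> = ((1 - y / q) * (1 - q ^ Suc N / y) * ((1 - y) * B)) * ((1 - q ^ Suc (Suc N) / y) * (1 - q ^ Suc N * y) / (1 - q ^ Suc N)\<^sup>2)"
    using Suc unfolding A_def B_def by simp
  also have "\<dots> = (1 - y / q) * (1 - q ^ Suc (Suc N) / y) * ((1 - y) * (\<Prod>m<Suc N. upsilon_factor q y m))"
    unfolding prod.lessThan_Suc 2 B_def[symmetric] by (simp add: ac_simps)
  finally show ?case .
qed simp

text \<open>In the limit the shift identity reads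
  \<open>\<upsilon>(z - \<tau>) (1 - q / y) = - (y / q) (1 - q / y) \<upsilon>(z)\<close>. The common factor can be cancelled unless
  \<open>y = q\<close>, and then both values of \<open>\<upsilon>\<close> are zero.\<close>

lemma upsilon_minus_period:
  assumes "Im \<tau> > 0"
  shows "upsilon \<tau> (z - \<tau>) = - (expi z / expi \<tau>) * upsilon \<tau> z"
proof -
  let ?q = "expi \<tau>" and ?y = "expi z"
  have q0: "(\<lambda>N. ?q ^ N) \<longlonglongrightarrow> 0"
    using norm_expi_less_1[OF assms] by (rule LIMSEQ_power_zero)
  have "(\<lambda>N. ((1 - ?y / ?q) * (\<Prod>m<N. upsilon_factor ?q (?y / ?q) m)) * (1 - ?q ^ N * ?y) * (1 - ?q / ?y))
      \<longlonglongrightarrow> upsilon \<tau> (z - \<tau>) * (1 - 0 * ?y) * (1 - ?q / ?y)"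
    using upsilon_LIMSEQ[OF assms, of "z - \<tau>"] by (intro tendsto_intros q0) (simp add: expi_diff)
  moreover have "(\<lambda>N. (1 - ?y / ?q) * (1 - ?q ^ Suc N / ?y) * ((1 - ?y) * (\<Prod>m<N. upsilon_factor ?q ?y m)))
      \<longlonglongrightarrow> (1 - ?y / ?q) * (1 - 0 / ?y) * upsilon \<tau> z"
    by (intro tendsto_intros upsilon_LIMSEQ[OF assms] LIMSEQ_Suc[OF q0]) simp
  ultimately have "upsilon \<tau> (z - \<tau>) * (1 - ?q / ?y) = (1 - ?y / ?q) * upsilon \<tau> z"
    using LIMSEQ_unique by (simp add: upsilon_partial_product_shift del: power_Suc)
  also have "1 - ?y / ?q = - (?y / ?q) * (1 - ?q / ?y)" by (simp add: field_simps)
  finally have eq: "upsilon \<tau> (z - \<tau>) * (1 - ?q / ?y) = - (?y / ?q) * (1 - ?q / ?y) * upsilon \<tau> z" .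
  have "(a + c * d) * b = 0" if "a * b = - c * b * d" for a b c d :: complex
    using that by algebra
  from this[OF eq] have *: "(upsilon \<tau> (z - \<tau>) + (?y / ?q) * upsilon \<tau> z) * (1 - ?q / ?y) = 0" .
  show ?thesis
  proof (cases "?y = ?q")
    case True
    have "upsilon_factor ?q ?y 0 = 0" using True by (simp add: upsilon_factor_def)
    then have "upsilon_prod (z, \<tau>) = 0"
      using has_prod_eq_0_iff[OF convergent_prod_has_prod[OF convergent_upsilon_prod[OF assms]], of z]
      by (simp add: upsilon_prod_def)
    moreover have "expi (z - \<tau>) = 1" using True by (simp add: expi_diff)
    ultimately show ?thesis by (simp add: upsilon_eq)
  next
    case False
    then have "1 - ?q / ?y \<noteq> 0" by (simp add: field_simps)
    with * show ?thesis by (simp add: add_eq_0_iff)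
  qed
qed

text \<open>The product of the factors \<open>- y\<^sub>k / q\<close> picked up by \<open>m\<close> steps \<open>z \<mapsto> z - \<tau>\<close>, where
  \<open>y\<^sub>k = y q\<^sup>-\<^sup>k\<close>; that is \<open>(-1)\<^sup>m y\<^sup>m q\<^bsup>- m (m + 1) / 2\<^esup>\<close>, written as one exponential so that it makes
  sense for negative \<open>m\<close> and is visibly nonzero.\<close>

definition upsilon_automorphy :: "int \<Rightarrow> int \<Rightarrow> complex \<times> complex \<Rightarrow> complex" where
  "upsilon_automorphy n m p =
     exp (of_real pi * \<i> * (of_int m + 2 * of_int m * fst p - of_int (m * (m + 1)) * snd p))"

lemma upsilon_automorphy_nonzero [simp]: "upsilon_automorphy n m p \<noteq> 0"
  by (simp add: upsilon_automorphy_def)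

lemma upsilon_automorphy_0 [simp]: "upsilon_automorphy 0 0 p = 1"
  by (simp add: upsilon_automorphy_def)

text \<open>The exponents of the two sides differ by \<open>2 \<pi> \<i> m' n\<close>.\<close>

lemma upsilon_automorphy_cocycle:
  "upsilon_automorphy (n + n') (m + m') p = upsilon_automorphy n' m' (dual_act n m p) * upsilon_automorphy n m p"
proof -
  obtain z \<tau> where p: "p = (z, \<tau>)" by force
  have "upsilon_automorphy n' m' (dual_act n m p) * upsilon_automorphy n m p =
     upsilon_automorphy (n + n') (m + m') p * expi (of_int (m' * n))"
    unfolding upsilon_automorphy_def expi_def exp_add[symmetric] p dual_act_def
    by (rule arg_cong[of _ _ exp]) (simp add: algebra_simps)
  then show ?thesis using expi_of_int[of "m' * n"] by simp
qed

lemma holo2_on_upsilon_automorphy: "holo2_on (upsilon_automorphy n m) UNIV"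
  by (rule osgood) (auto simp: upsilon_automorphy_def intro!: continuous_intros holomorphic_intros)

lemma upsilon_automorphy_step:
  "upsilon_automorphy n (m + 1) (z, \<tau>) = - (expi (z - \<tau> * of_int m) / expi \<tau>) * upsilon_automorphy n m (z, \<tau>)"
proof -
  have "upsilon_automorphy n (m + 1) (z, \<tau>)
      = exp (of_real pi * \<i>) * expi (z - \<tau> * of_int m - \<tau>) * upsilon_automorphy n m (z, \<tau>)"
    unfolding upsilon_automorphy_def expi_def exp_add[symmetric]
    by (rule arg_cong[of _ _ exp]) (simp add: algebra_simps)
  then show ?thesis by (simp add: expi_diff)
qed

lemma upsilon_add_int: "upsilon \<tau> (z + of_int n) = upsilon \<tau> z"
  by (simp add: upsilon_eq upsilon_prod_def expi_add)

lemma upsilon_transform: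
  assumes "Im \<tau> > 0"
  shows "upsilon \<tau> (fst (dual_act n m (z, \<tau>))) = upsilon_automorphy n m (z, \<tau>) * upsilon \<tau> z"
proof -
  have "upsilon \<tau> (z - \<tau> * of_int m) = upsilon_automorphy n m (z, \<tau>) * upsilon \<tau> z"
  proof (induction m rule: int_induct[where k = 0])
    case base
    show ?case by (simp add: upsilon_automorphy_def)
  next
    case (step1 i)
    have "upsilon \<tau> (z - \<tau> * of_int (i + 1)) = upsilon \<tau> ((z - \<tau> * of_int i) - \<tau>)"
      by (simp add: algebra_simps)
    then show ?case
      using step1 upsilon_automorphy_step[of n i z \<tau>] by (simp add: upsilon_minus_period[OF assms])
  next
    case (step2 i)
    have "- (expi (z - \<tau> * of_int (i - 1)) / expi \<tau>) * upsilon \<tau> (z - \<tau> * of_int (i - 1)) = upsilon \<tau> ((z - \<tau> * of_int (i - 1)) - \<tau>)"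
      by (simp only: upsilon_minus_period[OF assms])
    also have "\<dots> = upsilon \<tau> (z - \<tau> * of_int i)" by (simp add: algebra_simps)
    also have "\<dots> = upsilon_automorphy n (i - 1 + 1) (z, \<tau>) * upsilon \<tau> z" using step2 by simp
    also have "\<dots> = - (expi (z - \<tau> * of_int (i - 1)) / expi \<tau>) * (upsilon_automorphy n (i - 1) (z, \<tau>) * upsilon \<tau> z)"
      by (simp only: upsilon_automorphy_step) simp
    finally show ?case by (simp del: of_int_diff)
  qed
  then show ?thesis
    using upsilon_add_int[of \<tau> "z - \<tau> * of_int m" n] by (simp add: dual_act_def algebra_simps)
qed

lemma eventually_upsilon_nonzero:
  assumes "Im \<tau> > 0"
  shows "\<forall>\<^sub>F w in at z. upsilon \<tau> w \<noteq> 0"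
proof (cases "\<exists>n m. z = of_int n - \<tau> * of_int m")
  case False
  have "continuous_on UNIV (upsilon \<tau>)"
    using holo2_on_slice1[OF holo2_on_upsilon, of \<tau>] assms
    by (simp add: upper_half_plane_def holomorphic_on_imp_continuous_on)
  moreover have "upsilon \<tau> z \<noteq> 0" using False upsilon_eq_0_imp_lattice[OF assms] by metis
  ultimately show ?thesis
    by (intro tendsto_imp_eventually_ne[of _ "upsilon \<tau> z"])
       (simp_all add: continuous_on_eq_continuous_at isCont_def)
next
  case True
  then obtain n m where z: "z = of_int n - \<tau> * of_int m" by blast
  have "upsilon \<tau> w \<noteq> 0" if "w \<in> ball z (min 1 (Im \<tau>))" "w \<noteq> z" for w
  proof
    assume "upsilon \<tau> w = 0"
    then obtain n' m' where w: "w = of_int n' - \<tau> * of_int m'" using upsilon_eq_0_imp_lattice[OF assms] by metis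
    have "norm (of_int (n - n') - \<tau> * of_int (m - m')) = dist z w"
      unfolding dist_norm z w by (rule arg_cong[of _ _ norm]) (simp add: algebra_simps)
    then have "n - n' = 0 \<and> m - m' = 0" using that(1) by (intro lattice_discrete[OF assms]) auto
    then show False using that(2) z w by simp
  qed
  moreover have "\<forall>\<^sub>F w in at z. w \<in> ball z (min 1 (Im \<tau>)) \<and> w \<noteq> z"
    using assms eventually_at_in_open[of "ball z (min 1 (Im \<tau>))" z] by simp
  ultimately show ?thesis by (auto elim: eventually_mono)
qed

text \<open>Off the isolated zeros of \<open>\<upsilon>\<close> the quotient is the automorphy factor, which is continuous.\<close>

lemma transformation_cocycle_upsilon:
  assumes "Im (snd p) > 0"
  shows "transformation_cocycle upsilon n m p = upsilon_automorphy n m p"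
proof -
  obtain z \<tau> where p: "p = (z, \<tau>)" by force
  with assms have \<tau>: "Im \<tau> > 0" by simp
  have "(\<lambda>w. upsilon_automorphy n m (w, \<tau>)) \<midarrow>z\<rightarrow> upsilon_automorphy n m (z, \<tau>)"
    unfolding upsilon_automorphy_def by (auto intro!: tendsto_intros)
  moreover have "\<forall>\<^sub>F w in at z. upsilon_automorphy n m (w, \<tau>) = upsilon \<tau> (fst (dual_act n m (w, \<tau>))) / upsilon \<tau> w"
    using eventually_upsilon_nonzero[OF \<tau>] by eventually_elim (simp add: upsilon_transform[OF \<tau>])
  ultimately have "(\<lambda>w. upsilon \<tau> (fst (dual_act n m (w, \<tau>))) / upsilon \<tau> w) \<midarrow>z\<rightarrow> upsilon_automorphy n m (z, \<tau>)"
    by (rule Lim_transform_eventually)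
  then show ?thesis
    unfolding p transformation_cocycle_def by (simp add: tendsto_Lim)
qed

section \<open>The quotient \<open>\<complex> \<times> U \<rightarrow> E\<^sup>\<or>\<close>\<close>

lemma dual_act_0 [simp]: "dual_act 0 0 p = p"
  by (simp add: dual_act_def case_prod_unfold)

lemma dual_act_dual_act: "dual_act n' m' (dual_act n m p) = dual_act (n + n') (m + m') p"
  by (simp add: dual_act_def case_prod_unfold algebra_simps)

lemma mem_orbit_self: "p \<in> orbit p"
  unfolding orbit_def using dual_act_0[of p] by (metis (mono_tags, lifting) mem_Collect_eq)

lemma orbit_dual_act [simp]: "orbit (dual_act n m p) = orbit p"
proof -
  have "\<exists>a b. dual_act k l p = dual_act a b (dual_act n m p)" for k l
    by (intro exI[of _ "k - n"] exI[of _ "l - m"]) (simp add: dual_act_dual_act)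
  moreover have "\<exists>a b. dual_act k l (dual_act n m p) = dual_act a b p" for k l
    using dual_act_dual_act by blast
  ultimately show ?thesis unfolding orbit_def by auto
qed

lemma orbit_eqE:
  assumes "orbit p = orbit p'"
  obtains n m where "p' = dual_act n m p"
proof -
  have "p' \<in> orbit p" using mem_orbit_self[of p'] assms by simp
  then show ?thesis using that unfolding orbit_def by blast
qed

lemma mem_orbitE:
  assumes "q \<in> orbit p"
  obtains n m where "q = dual_act n m p"
  using assms unfolding orbit_def by blast

lemma base_point_orbit [simp]: "base_point (orbit p) = snd p"
proof -
  have "snd ` orbit p = {snd p}" by (auto elim!: mem_orbitE intro: rev_image_eqI[OF mem_orbit_self])
  then show ?thesis by (simp add: base_point_def)
qed

lemma orbit_mem_dual_family [simp]: "orbit p \<in> dual_family U \<longleftrightarrow> snd p \<in> U"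
proof
  assume "orbit p \<in> dual_family U"
  then obtain z \<tau> where "\<tau> \<in> U" "orbit p = orbit (z, \<tau>)" unfolding dual_family_def by auto
  then show "snd p \<in> U" using base_point_orbit by (metis snd_conv)
next
  assume "snd p \<in> U"
  then show "orbit p \<in> dual_family U"
    unfolding dual_family_def by (intro imageI) (simp add: mem_Times_iff)
qed

lemma dual_familyE:
  assumes "x \<in> dual_family U"
  obtains p where "x = orbit p" "snd p \<in> U"
  using assms unfolding dual_family_def by auto

lemma mem_lift_set [simp]: "p \<in> lift_set U W \<longleftrightarrow> snd p \<in> U \<and> orbit p \<in> W"
  by (simp add: lift_set_def mem_Times_iff)

lemma dual_act_free:
  assumes "dual_act n m p = p" "Im (snd p) > 0"
  shows "n = 0 \<and> m = 0"
proof -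
  have "of_int n - snd p * of_int m = 0"
    using assms(1) by (simp add: dual_act_def case_prod_unfold prod_eq_iff)
  then show ?thesis using lattice_discrete[OF assms(2), of n m] assms(2) by simp
qed

lemma orbit_eq_zero_section_imp_lattice:
  assumes "orbit (z, \<tau>) = zero_section \<tau>'"
  obtains n m :: int where "z = of_int n - \<tau> * of_int m" "\<tau>' = \<tau>"
proof -
  from assms obtain n m where "(z, \<tau>) = dual_act n m (0, \<tau>')"
    unfolding zero_section_def by (metis orbit_eqE)
  then have "\<tau>' = \<tau>" "z = of_int n - \<tau>' * of_int m" by (auto simp: dual_act_def)
  then show ?thesis by (intro that[of n m]) simp_all
qed

subsection \<open>Open sets and holomorphic functions on the quotient\<close>

lemma open_dual_subset: "open_dual U W \<Longrightarrow> W \<subseteq> dual_family U"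
  by (simp add: open_dual_def)

lemma open_dual_Int:
  assumes "open_dual U W" "open_dual U W'"
  shows "open_dual U (W \<inter> W')"
proof -
  have "lift_set U (W \<inter> W') = lift_set U W \<inter> lift_set U W'" by (auto simp: lift_set_def)
  then show ?thesis using assms unfolding open_dual_def by (auto intro: openin_Int)
qed

lemma open_dual_nbhd:
  assumes "open_dual U W" "snd p \<in> U" "orbit p \<in> W"
  obtains N where "open N" "p \<in> N" "\<And>x. x \<in> N \<Longrightarrow> snd x \<in> U \<Longrightarrow> orbit x \<in> W"
proof -
  obtain T where T: "open T" "lift_set U W = UNIV \<times> U \<inter> T"
    using assms(1) unfolding open_dual_def openin_open by auto
  have *: "x \<in> T \<longleftrightarrow> orbit x \<in> W" if "snd x \<in> U" for x
    using arg_cong[OF T(2), of "\<lambda>S. x \<in> S"] that by (simp add: mem_Times_iff)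
  show ?thesis by (rule that[OF T(1)]) (use * assms in auto)
qed

lemma holo_dual_iff_germ:
  assumes "open_dual U W"
  shows "holo_dual U W f \<longleftrightarrow> (\<forall>p. snd p \<in> U \<longrightarrow> orbit p \<in> W \<longrightarrow> holo2_germ U (\<lambda>q. f (orbit q)) p)"
  using holo2_sub_iff_germ[of U "lift_set U W"] assms
  by (auto simp: holo_dual_def open_dual_def)

lemma holo_dualD:
  assumes "holo_dual U W f" "open_dual U W" "snd p \<in> U" "orbit p \<in> W"
  shows "holo2_germ U (\<lambda>q. f (orbit q)) p"
  using assms holo_dual_iff_germ by blast

text \<open>The lifts of a point are permuted by the holomorphic maps \<open>dual_act n m\<close>, so one lift of each
  point is enough. In a chart this allows the choice of the most convenient lift.\<close>

lemma holo_dualI: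
  assumes "open_dual U W"
    and "\<And>p. snd p \<in> U \<Longrightarrow> orbit p \<in> W \<Longrightarrow> \<exists>q. orbit q = orbit p \<and> holo2_germ U (\<lambda>q. f (orbit q)) q"
  shows "holo_dual U W f"
  unfolding holo_dual_iff_germ[OF assms(1)]
proof (intro allI impI)
  fix p assume "snd p \<in> U" "orbit p \<in> W"
  then obtain q where q: "orbit q = orbit p" "holo2_germ U (\<lambda>q. f (orbit q)) q" using assms(2) by blast
  from q(1)[symmetric] obtain n m where "q = dual_act n m p" by (rule orbit_eqE)
  with q(2) show "holo2_germ U (\<lambda>q. f (orbit q)) p"
    using holo2_germ_dual_act[of U "\<lambda>q. f (orbit q)" n m p] by simp
qed

lemma holo_dual_cong:
  assumes "holo_dual U W f" "open_dual U W" "\<And>x. x \<in> W \<Longrightarrow> g x = f x"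
  shows "holo_dual U W g"
proof (rule holo_dualI[OF assms(2)])
  fix p assume p: "snd p \<in> U" "orbit p \<in> W"
  obtain N where N: "open N" "p \<in> N" "\<And>x. x \<in> N \<Longrightarrow> snd x \<in> U \<Longrightarrow> orbit x \<in> W"
    using open_dual_nbhd[OF assms(2) p] by metis
  have "holo2_germ U (\<lambda>q. g (orbit q)) p"
    by (rule holo2_germ_cong[OF holo_dualD[OF assms(1,2) p] N(1,2)]) (use N(3) assms(3) in auto)
  then show "\<exists>q. orbit q = orbit p \<and> holo2_germ U (\<lambda>q. g (orbit q)) q" by blast
qed

lemma holo_dual_subset:
  assumes "holo_dual U W f" "open_dual U W" "open_dual U W'" "W' \<subseteq> W"
  shows "holo_dual U W' f"
  by (rule holo_dualI[OF assms(3)]) (use holo_dualD[OF assms(1,2)] assms(4) in blast)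

lemma holo_dual_mult:
  assumes "holo_dual U W f" "holo_dual U W g" "open_dual U W"
  shows "holo_dual U W (\<lambda>x. f x * g x)"
  by (rule holo_dualI[OF assms(3)])
    (use holo2_germ_mult[OF holo_dualD[OF assms(1,3)] holo_dualD[OF assms(2,3)]] in blast)

lemma holo_dual_const: "open_dual U W \<Longrightarrow> holo_dual U W (\<lambda>_. c)"
  by (auto simp: holo_dual_iff_germ intro: holo2_germ_const)

text \<open>In each curve the zero section is an isolated point, so off the zero section is dense enough
  to determine a holomorphic function.\<close>

lemma holo_dual_eqI:
  assumes U: "U \<subseteq> upper_half_plane" and W: "open_dual U W"
    and f: "holo_dual U W f" and g: "holo_dual U W g"
    and eq: "\<And>x. x \<in> W - zero_section ` U \<Longrightarrow> f x = g x" and x: "x \<in> W"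
  shows "f x = g x"
proof (cases "x \<in> zero_section ` U")
  case True
  then obtain \<tau> where \<tau>: "\<tau> \<in> U" "x = orbit (0, \<tau>)" by (auto simp: zero_section_def)
  then have "Im \<tau> > 0" using U by (auto simp: upper_half_plane_def)
  obtain N where N: "open N" "(0, \<tau>) \<in> N" "\<And>x. x \<in> N \<Longrightarrow> snd x \<in> U \<Longrightarrow> orbit x \<in> W"
    using open_dual_nbhd[OF W, of "(0, \<tau>)"] \<tau> x by auto
  obtain r where r: "r > 0" "cball 0 r \<times> cball \<tau> r \<subseteq> N"
    using open_contains_cball_Times[OF N(1,2)] .
  have "\<forall>\<^sub>F z in at 0. z \<in> ball 0 (min r (min 1 (Im \<tau>))) \<and> z \<noteq> 0"
    using r(1) \<open>Im \<tau> > 0\<close> eventually_at_in_open[of "ball 0 (min r (min 1 (Im \<tau>)))" 0] by simp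
  then have ev: "\<forall>\<^sub>F z in at 0. f (orbit (z, \<tau>)) = g (orbit (z, \<tau>))"
  proof eventually_elim
    case (elim z)
    then have "(z, \<tau>) \<in> N" using r(1) by (intro subsetD[OF r(2)]) auto
    then have "orbit (z, \<tau>) \<in> W" using N(3) \<tau> by auto
    moreover have "orbit (z, \<tau>) \<notin> zero_section ` U"
    proof
      assume "orbit (z, \<tau>) \<in> zero_section ` U"
      then obtain n m where z: "z = of_int n - \<tau> * of_int m"
        using orbit_eq_zero_section_imp_lattice by (metis imageE)
      then have "n = 0 \<and> m = 0" using elim by (intro lattice_discrete[OF \<open>Im \<tau> > 0\<close>]) auto
      then show False using z elim by simp
    qed
    ultimately show ?case using eq by blast
  qed
  have c: "((\<lambda>z. h (orbit (z, \<tau>))) \<longlongrightarrow> h x) (at 0)" if h: "holo_dual U W h" for h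
  proof -
    have "holo2_germ U (\<lambda>q. h (orbit q)) (0, \<tau>)" using h W \<tau> x by (intro holo_dualD[of U W]) auto
    then have "(\<lambda>z. h (orbit (z, \<tau>))) analytic_on {0}"
      using holo2_germ_slice_analytic \<tau>(1) by blast
    then show ?thesis
      using analytic_at_imp_isCont \<tau>(2) unfolding isCont_def by blast
  qed
  show ?thesis
    using tendsto_unique[OF _ Lim_transform_eventually[OF c[OF f] ev] c[OF g]] by simp
qed (use eq x in blast)

section \<open>Line bundles in coordinates\<close>

lemma line_bundle_chart_open: "line_bundle U L \<Longrightarrow> A \<in> atlas L \<Longrightarrow> open_dual U (fst A)"
  unfolding line_bundle_def by (auto simp: case_prod_unfold)

lemma line_bundle_proj: "line_bundle U L \<Longrightarrow> v \<in> tot L \<Longrightarrow> proj L v \<in> dual_family U"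
  unfolding line_bundle_def by auto

lemma line_bundle_chart_at:
  assumes "line_bundle U L" "x \<in> dual_family U"
  obtains A where "A \<in> atlas L" "x \<in> fst A"
proof -
  have "(\<Union>(W, \<phi>)\<in>atlas L. W) = dual_family U" using assms(1) unfolding line_bundle_def by blast
  then show ?thesis using assms(2) that by fastforce
qed

lemma line_bundle_chart_bij:
  assumes "line_bundle U L" "A \<in> atlas L"
  shows "bij_betw (\<lambda>v. (proj L v, snd A v)) {v \<in> tot L. proj L v \<in> fst A} (fst A \<times> UNIV)"
  using assms unfolding line_bundle_def by (auto simp: case_prod_unfold)

lemma line_bundle_eqI:
  assumes "line_bundle U L" "A \<in> atlas L" "v \<in> tot L" "w \<in> tot L" "proj L v \<in> fst A"
    "proj L v = proj L w" "snd A v = snd A w"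
  shows "v = w"
  using inj_onD[OF bij_betw_imp_inj_on[OF line_bundle_chart_bij[OF assms(1,2)]], of v w] assms by auto

lemma line_bundle_fibre_bij:
  assumes "line_bundle U L" "A \<in> atlas L" "x \<in> fst A"
  shows "bij_betw (snd A) (fibre L x) UNIV"
proof -
  have "inj_on (snd A) (fibre L x)"
    by (rule inj_onI) (use assms in \<open>auto simp: fibre_def intro: line_bundle_eqI\<close>)
  moreover have "\<exists>v\<in>fibre L x. snd A v = k" for k
  proof -
    have "(x, k) \<in> (\<lambda>v. (proj L v, snd A v)) ` {v \<in> tot L. proj L v \<in> fst A}"
      using bij_betw_imp_surj_on[OF line_bundle_chart_bij[OF assms(1,2)]] assms(3) by simp
    then show ?thesis by (auto simp: fibre_def)
  qed
  then have "snd A ` fibre L x = UNIV" by (metis UNIV_eq_I imageI)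
  ultimately show ?thesis unfolding bij_betw_def by blast
qed

definition fibre_vector :: "'l lbundle \<Rightarrow> 'l chart \<Rightarrow> point \<Rightarrow> complex \<Rightarrow> 'l" where
  "fibre_vector L A x = the_inv_into (fibre L x) (snd A)"

lemma fibre_vector:
  assumes "line_bundle U L" "A \<in> atlas L" "x \<in> fst A"
  shows "fibre_vector L A x k \<in> tot L" "proj L (fibre_vector L A x k) = x" "snd A (fibre_vector L A x k) = k"
proof -
  note b = line_bundle_fibre_bij[OF assms]
  have "fibre_vector L A x k \<in> fibre L x"
    unfolding fibre_vector_def
    using the_inv_into_into[OF bij_betw_imp_inj_on[OF b], of k "fibre L x"] bij_betw_imp_surj_on[OF b] by simp
  then show "fibre_vector L A x k \<in> tot L" "proj L (fibre_vector L A x k) = x" by (auto simp: fibre_def)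
  show "snd A (fibre_vector L A x k) = k"
    unfolding fibre_vector_def using f_the_inv_into_f_bij_betw[OF b, of k] by simp
qed

lemma frame_eq: "frame L A x = fibre_vector L A x 1"
  by (simp add: frame_def fibre_vector_def)

lemma line_bundle_transition:
  assumes "line_bundle U L" "A \<in> atlas L" "A' \<in> atlas L"
  shows "holo_dual U (fst A \<inter> fst A') (transition L A A')"
    and "x \<in> fst A \<inter> fst A' \<Longrightarrow> transition L A A' x \<noteq> 0"
    and "v \<in> tot L \<Longrightarrow> proj L v \<in> fst A \<inter> fst A' \<Longrightarrow> snd A' v = transition L A A' (proj L v) * snd A v"
proof -
  have "\<forall>(W, \<phi>)\<in>atlas L. \<forall>(W', \<phi>')\<in>atlas L. \<exists>g. holo_dual U (W \<inter> W') g \<and>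
        (\<forall>x\<in>W \<inter> W'. g x \<noteq> 0) \<and> (\<forall>v\<in>tot L. proj L v \<in> W \<inter> W' \<longrightarrow> \<phi>' v = g (proj L v) * \<phi> v)"
    using assms(1)[unfolded line_bundle_def] by (elim conjE)
  from bspec[OF bspec[OF this assms(2), unfolded case_prod_unfold] assms(3)]
  obtain g where g: "holo_dual U (fst A \<inter> fst A') g" "\<forall>x\<in>fst A \<inter> fst A'. g x \<noteq> 0"
    "\<forall>v\<in>tot L. proj L v \<in> fst A \<inter> fst A' \<longrightarrow> snd A' v = g (proj L v) * snd A v"
    unfolding case_prod_unfold by blast
  have eq: "transition L A A' x = g x" if x: "x \<in> fst A \<inter> fst A'" for x
    unfolding transition_def frame_eq using g(3) fibre_vector[OF assms(1,2), of x 1] x by simp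
  have "open_dual U (fst A \<inter> fst A')" using assms line_bundle_chart_open open_dual_Int by blast
  from holo_dual_cong[OF g(1) this] show "holo_dual U (fst A \<inter> fst A') (transition L A A')" using eq by blast
  show "x \<in> fst A \<inter> fst A' \<Longrightarrow> transition L A A' x \<noteq> 0" using g(2) eq by simp
  show "v \<in> tot L \<Longrightarrow> proj L v \<in> fst A \<inter> fst A' \<Longrightarrow> snd A' v = transition L A A' (proj L v) * snd A v"
    using g(3) eq by simp
qed

lemma bundle_homD:
  assumes "bundle_hom U L L' f"
  shows "v \<in> tot L \<Longrightarrow> f v \<in> tot L'" "v \<in> tot L \<Longrightarrow> proj L' (f v) = proj L v"
    and "A \<in> atlas L \<Longrightarrow> B \<in> atlas L' \<Longrightarrow> \<exists>g. holo_dual U (fst A \<inter> fst B) g \<and>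
        (\<forall>v\<in>tot L. proj L v \<in> fst A \<inter> fst B \<longrightarrow> snd B (f v) = g (proj L v) * snd A v)"
  using assms unfolding bundle_hom_def by (auto simp: case_prod_unfold)

section \<open>Tensoring with \<open>\<omega>\<^sup>-\<^sup>1\<close>\<close>

text \<open>A doubly periodic entire function takes all its values on a compact parallelogram, so
  it is constant by Liouville's theorem.\<close>

lemma elliptic_form_constant:
  assumes "Im \<tau> > 0" "h \<in> elliptic_forms \<tau>"
  shows "h z = h 0"
proof -
  have hol: "h holomorphic_on UNIV" and per: "\<And>z n m. h (z + \<tau> * of_int n + of_int m) = h z"
    using assms(2) unfolding elliptic_forms_def by auto
  define K where "K = (\<lambda>(a, b). of_real a + \<tau> * of_real b) ` ({0..1::real} \<times> {0..1::real})"
  have "compact K" unfolding K_def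
    by (intro compact_continuous_image compact_Times) (auto simp: case_prod_unfold intro!: continuous_intros)
  then have "bounded (h ` K)"
    using hol by (intro compact_imp_bounded compact_continuous_image)
      (auto intro: holomorphic_on_imp_continuous_on holomorphic_on_subset)
  moreover have "range h \<subseteq> h ` K"
  proof (rule image_subsetI)
    fix z
    \<comment> \<open>the coordinates of \<open>z\<close> with respect to the periods \<open>1\<close> and \<open>\<tau>\<close>\<close>
    define b where "b = Im z / Im \<tau>"
    define a where "a = Re z - b * Re \<tau>"
    have z: "z = of_real a + \<tau> * of_real b"
      using assms(1) by (simp add: complex_eq_iff a_def b_def)
    have "h z = h (z + \<tau> * of_int (- \<lfloor>b\<rfloor>) + of_int (- \<lfloor>a\<rfloor>))" by (simp only: per)
    also have "z + \<tau> * of_int (- \<lfloor>b\<rfloor>) + of_int (- \<lfloor>a\<rfloor>) = of_real (frac a) + \<tau> * of_real (frac b)"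
      by (simp add: z frac_def algebra_simps)
    finally show "h z \<in> h ` K"
      unfolding K_def by (intro rev_image_eqI[of "of_real (frac a) + \<tau> * of_real (frac b)"] rev_image_eqI[of "(frac a, frac b)"])
         (auto simp: frac_ge_0 less_imp_le[OF frac_lt_1])
  qed
  ultimately have "bounded (range h)" by (rule bounded_subset)
  from Liouville_theorem[OF hol this] show ?thesis unfolding constant_on_def by auto
qed

lemma fibre_omega: "x \<in> dual_family U \<Longrightarrow> fibre (omega U) x = {x} \<times> elliptic_forms (base_point x)"
  by (auto simp: fibre_def omega_def)

text \<open>The coefficient of a form with respect to \<open>dz\<close> is its value at \<open>0\<close>, which determines the form
  because it is constant.\<close>

lemma frame_omega:
  assumes "U \<subseteq> upper_half_plane" "x \<in> dual_family U"
  shows "frame (omega U) (dz_chart U) x = (x, \<lambda>_. 1)"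
proof -
  obtain p where p: "x = orbit p" "snd p \<in> U" using assms(2) by (rule dual_familyE)
  then have im: "Im (base_point x) > 0" using assms(1) by (auto simp: upper_half_plane_def)
  have inj: "inj_on (\<lambda>(y, h). h 0) (fibre (omega U) x)"
  proof (rule inj_onI)
    fix v w assume v: "v \<in> fibre (omega U) x" "w \<in> fibre (omega U) x"
      and eq: "(case v of (y, h) \<Rightarrow> h 0) = (case w of (y, h) \<Rightarrow> h 0)"
    have "snd v z = snd w z" for z
      using elliptic_form_constant[OF im, of "snd v" z] elliptic_form_constant[OF im, of "snd w" z] v eq
      by (auto simp: fibre_omega[OF assms(2)])
    then show "v = w" using v by (auto simp: fibre_omega[OF assms(2)] prod_eq_iff)
  qed
  have "(x, \<lambda>_. 1) \<in> fibre (omega U) x"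
    by (simp add: fibre_omega[OF assms(2)] elliptic_forms_def)
  from the_inv_into_f_f[OF inj this] show ?thesis
    unfolding frame_def by (simp add: dz_chart_def)
qed

lemma atlas_omega_inv [simp]: "atlas (omega_inv U) = {beta_inv_chart U}"
  by (simp add: dual_bundle_def omega_def beta_inv_chart_def)

lemma fst_beta_inv_chart [simp]: "fst (beta_inv_chart U) = dual_family U"
  by (simp add: beta_inv_chart_def dual_chart_def dz_chart_def)

lemma proj_omega_inv [simp]: "proj (omega_inv U) = fst"
  by (simp add: dual_bundle_def)

lemma tot_omega_inv_fst: "b \<in> tot (omega_inv U) \<Longrightarrow> fst b \<in> dual_family U"
  by (auto simp: dual_bundle_def omega_def dz_chart_def)

lemma fst_beta_inv [simp]: "fst (beta_inv U x) = x"
  by (simp add: beta_inv_def)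

lemma beta_inv_coordinate:
  assumes "U \<subseteq> upper_half_plane" "x \<in> dual_family U"
  shows "snd (beta_inv_chart U) (beta_inv U x) = 1"
  using frame_omega[OF assms] assms(2)
  by (simp add: beta_inv_chart_def dual_chart_def beta_inv_def fibre_omega elliptic_forms_def)

lemma beta_inv_in_tot: "x \<in> dual_family U \<Longrightarrow> beta_inv U x \<in> tot (omega_inv U)"
  by (auto simp: dual_bundle_def omega_def dz_chart_def beta_inv_def fibre_functionals_def intro!: exI[of _ 1])

text \<open>As \<open>\<omega>\<^sup>-\<^sup>1\<close> is trivialized by \<open>\<beta>\<^sup>-\<^sup>1\<close>, every element of \<open>L \<otimes> \<omega>\<^sup>-\<^sup>1\<close> is \<open>a \<otimes> \<beta>\<^sup>-\<^sup>1\<close> for exactly one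
  \<open>a\<close>. This reduces everything below to sections and morphisms of \<open>L\<close> itself.\<close>

definition tensor_beta :: "complex set \<Rightarrow> 'l lbundle \<Rightarrow> 'l \<Rightarrow> ('l \<times> omega_inv_elt) set" where
  "tensor_beta U L a = tensor L (omega_inv U) a (beta_inv U (proj L a))"

lemma tensor_rel_iff:
  assumes "line_bundle U L"
  shows "((a, b), (a', b')) \<in> tensor_rel L (omega_inv U) \<longleftrightarrow>
    a \<in> tot L \<and> a' \<in> tot L \<and> b \<in> tot (omega_inv U) \<and> b' \<in> tot (omega_inv U) \<and>
    proj L a = fst b \<and> proj L a' = fst b' \<and> proj L a = proj L a' \<and>
    (\<forall>A\<in>atlas L. proj L a \<in> fst A \<longrightarrow>
       snd A a * snd (beta_inv_chart U) b = snd A a' * snd (beta_inv_chart U) b')"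
  using tot_omega_inv_fst[of b U]
  by (auto simp: tensor_rel_def tensor_pairs_def case_prod_unfold)

lemma equiv_tensor_rel:
  assumes "line_bundle U L"
  shows "equiv (tensor_pairs L (omega_inv U)) (tensor_rel L (omega_inv U))"
proof (rule equivI)
  show "tensor_rel L (omega_inv U) \<subseteq> tensor_pairs L (omega_inv U) \<times> tensor_pairs L (omega_inv U)"
    by (auto simp: tensor_rel_def)
  show "refl_on (tensor_pairs L (omega_inv U)) (tensor_rel L (omega_inv U))"
    by (auto simp: refl_on_def tensor_rel_def)
  show "sym_on UNIV (tensor_rel L (omega_inv U))"
    by (rule symI) (auto simp: tensor_rel_iff[OF assms])
  show "trans_on UNIV (tensor_rel L (omega_inv U))"
  proof (rule transI)
    fix p q r
    assume pq: "(p, q) \<in> tensor_rel L (omega_inv U)" and qr: "(q, r) \<in> tensor_rel L (omega_inv U)"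
    obtain a b a' b' a'' b'' where eq: "p = (a, b)" "q = (a', b')" "r = (a'', b'')"
      by (metis surj_pair)
    note 1 = pq[unfolded eq tensor_rel_iff[OF assms]] and 2 = qr[unfolded eq tensor_rel_iff[OF assms]]
    show "(p, r) \<in> tensor_rel L (omega_inv U)"
      unfolding eq tensor_rel_iff[OF assms]
      using 1 2 by (elim conjE, intro conjI ballI impI) (assumption | metis)+
  qed
qed

text \<open>The representatives of \<open>a \<otimes> \<beta>\<^sup>-\<^sup>1\<close> are the pairs whose product of coordinates is that of \<open>a\<close>, as
  \<open>\<beta>\<^sup>-\<^sup>1\<close> has coordinate \<open>1\<close>.\<close>

lemma tensor_beta_mem_iff:
  assumes "U \<subseteq> upper_half_plane" "line_bundle U L" "a \<in> tot L"
  shows "(a', b) \<in> tensor_beta U L a \<longleftrightarrow>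
    a' \<in> tot L \<and> b \<in> tot (omega_inv U) \<and> proj L a' = fst b \<and> proj L a' = proj L a \<and>
    (\<forall>A\<in>atlas L. proj L a \<in> fst A \<longrightarrow> snd A a' * snd (beta_inv_chart U) b = snd A a)"
  unfolding tensor_beta_def tensor_def Image_singleton_iff tensor_rel_iff[OF assms(2)]
  using assms line_bundle_proj[OF assms(2,3)]
  by (auto simp: beta_inv_coordinate beta_inv_in_tot)

lemma tensor_beta_self:
  assumes "U \<subseteq> upper_half_plane" "line_bundle U L" "a \<in> tot L"
  shows "(a, beta_inv U (proj L a)) \<in> tensor_beta U L a"
  using assms line_bundle_proj[OF assms(2,3)]
  by (simp add: tensor_beta_mem_iff beta_inv_coordinate beta_inv_in_tot)

lemma tensor_beta_in_tot:
  assumes "line_bundle U L" "a \<in> tot L"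
  shows "tensor_beta U L a \<in> tot (tensor_bundle L (omega_inv U))"
  using assms line_bundle_proj[OF assms] beta_inv_in_tot
  by (auto simp: tensor_beta_def tensor_def tensor_bundle_def tensor_pairs_def intro: quotientI)

lemma image_eq_singletonI:
  assumes "c \<in> S" "\<And>y. y \<in> S \<Longrightarrow> f y = k"
  shows "f ` S = {k}"
proof -
  have "f ` S = (\<lambda>_. k) ` S" using assms(2) by (rule image_cong[OF refl])
  then show ?thesis using assms(1) by (simp add: image_constant)
qed

lemma proj_tensor_beta:
  assumes "U \<subseteq> upper_half_plane" "line_bundle U L" "a \<in> tot L"
  shows "proj (tensor_bundle L (omega_inv U)) (tensor_beta U L a) = proj L a"
proof -
  have "(\<lambda>(a, b). proj L a) ` tensor_beta U L a = {proj L a}"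
    by (rule image_eq_singletonI[OF tensor_beta_self[OF assms]]) (auto simp: tensor_beta_mem_iff[OF assms])
  then show ?thesis by (simp add: tensor_bundle_def)
qed

lemma tensor_chart_tensor_beta:
  assumes "U \<subseteq> upper_half_plane" "line_bundle U L" "a \<in> tot L" "A \<in> atlas L" "proj L a \<in> fst A"
  shows "snd (tensor_chart A (beta_inv_chart U)) (tensor_beta U L a) = snd A a"
proof -
  have "(\<lambda>(a, b). snd A a * snd (beta_inv_chart U) b) ` tensor_beta U L a = {snd A a}"
    by (rule image_eq_singletonI[OF tensor_beta_self[OF assms(1-3)]])
       (use assms(4,5) in \<open>auto simp: tensor_beta_mem_iff[OF assms(1-3)]\<close>)
  then show ?thesis by (simp add: tensor_chart_def)
qed

lemma fst_tensor_chart: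
  assumes "line_bundle U L" "A \<in> atlas L"
  shows "fst (tensor_chart A (beta_inv_chart U)) = fst A"
  using open_dual_subset[OF line_bundle_chart_open[OF assms]] by (auto simp: tensor_chart_def)

lemma tensor_beta_inj:
  assumes "U \<subseteq> upper_half_plane" "line_bundle U L" "a \<in> tot L" "a' \<in> tot L"
    "tensor_beta U L a = tensor_beta U L a'"
  shows "a = a'"
proof -
  have p: "proj L a = proj L a'" using proj_tensor_beta[OF assms(1,2)] assms(3-5) by metis
  obtain A where "A \<in> atlas L" "proj L a \<in> fst A"
    using line_bundle_chart_at[OF assms(2) line_bundle_proj[OF assms(2,3)]] .
  then show ?thesis
    using line_bundle_eqI[OF assms(2) _ assms(3,4)] p tensor_chart_tensor_beta[OF assms(1,2)] assms(3-5) by metis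
qed

text \<open>The scalar by which \<open>b\<close> differs from \<open>\<beta>\<^sup>-\<^sup>1\<close> is moved to the other factor.\<close>

lemma tensor_beta_surj:
  assumes "U \<subseteq> upper_half_plane" "line_bundle U L" "\<xi> \<in> tot (tensor_bundle L (omega_inv U))"
  obtains a where "a \<in> tot L" "\<xi> = tensor_beta U L a"
proof -
  obtain a b where ab: "(a, b) \<in> tensor_pairs L (omega_inv U)" "\<xi> = tensor_rel L (omega_inv U) `` {(a, b)}"
    using assms(3) by (auto simp: tensor_bundle_def elim!: quotientE)
  then have a: "a \<in> tot L" "b \<in> tot (omega_inv U)" "proj L a = fst b" by (auto simp: tensor_pairs_def)
  obtain A where A: "A \<in> atlas L" "proj L a \<in> fst A"
    using line_bundle_chart_at[OF assms(2) line_bundle_proj[OF assms(2) a(1)]] .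
  define a' where "a' = fibre_vector L A (proj L a) (snd A a * snd (beta_inv_chart U) b)"
  note a' = fibre_vector[OF assms(2) A, of "snd A a * snd (beta_inv_chart U) b", folded a'_def]
  have "snd A' a * snd (beta_inv_chart U) b = snd A' a'" if "A' \<in> atlas L" "proj L a \<in> fst A'" for A'
    using line_bundle_transition(3)[OF assms(2) A(1) that(1)] A(2) that(2) a a' by simp
  then have "(a, b) \<in> tensor_beta U L a'"
    using a a' by (subst tensor_beta_mem_iff[OF assms(1,2) a'(1)]) auto
  then have "((a', beta_inv U (proj L a')), (a, b)) \<in> tensor_rel L (omega_inv U)"
    by (simp add: tensor_beta_def tensor_def)
  from equiv_class_eq[OF equiv_tensor_rel[OF assms(2)] this]
  have "\<xi> = tensor_beta U L a'" by (simp add: ab(2) tensor_beta_def tensor_def)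
  then show ?thesis using that a'(1) by blast
qed

lemma tensor_map_tensor_beta:
  assumes "U \<subseteq> upper_half_plane" "line_bundle U L" "line_bundle U L'" "bundle_hom U L L' f" "a \<in> tot L"
  shows "tensor_map L' (omega_inv U) f (tensor_beta U L a) = tensor_beta U L' (f a)"
proof -
  note hom = bundle_homD[OF assms(4)]
  obtain A where A: "A \<in> atlas L" "proj L a \<in> fst A"
    using line_bundle_chart_at[OF assms(2) line_bundle_proj[OF assms(2,5)]] .
  have "tensor L' (omega_inv U) (f a') b = tensor_beta U L' (f a)" if "(a', b) \<in> tensor_beta U L a" for a' b
  proof -
    have a': "a' \<in> tot L" "b \<in> tot (omega_inv U)" "proj L a' = fst b" "proj L a' = proj L a"
      "snd A a' * snd (beta_inv_chart U) b = snd A a"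
      using that A unfolding tensor_beta_mem_iff[OF assms(1,2,5)] by auto
    have "snd B (f a') * snd (beta_inv_chart U) b = snd B (f a)" if B: "B \<in> atlas L'" "proj L a \<in> fst B" for B
      using hom(3)[OF A(1) B(1)] a' A B assms(5) by fastforce
    then have "(f a', b) \<in> tensor_beta U L' (f a)"
      using a' hom(1,2) assms(5) by (subst tensor_beta_mem_iff[OF assms(1,3)]) auto
    then have "((f a, beta_inv U (proj L' (f a))), (f a', b)) \<in> tensor_rel L' (omega_inv U)"
      by (simp add: tensor_beta_def tensor_def)
    from equiv_class_eq[OF equiv_tensor_rel[OF assms(3)] this]
    show ?thesis by (simp add: tensor_beta_def tensor_def)
  qed
  then have "(\<lambda>(a, b). tensor L' (omega_inv U) (f a) b) ` tensor_beta U L a = {tensor_beta U L' (f a)}"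
    by (intro image_eq_singletonI[OF tensor_beta_self[OF assms(1,2,5)]]) auto
  then show ?thesis by (simp add: tensor_map_def)
qed

section \<open>Sections whose divisor is the zero section\<close>

text \<open>The conditions on the section of a refinement, expressed for a section of \<open>L\<close> instead of
  \<open>L \<otimes> \<omega>\<^sup>-\<^sup>1\<close>.\<close>

definition cuts_out_zero_section :: "complex set \<Rightarrow> 'l lbundle \<Rightarrow> (point \<Rightarrow> 'l) \<Rightarrow> bool" where
  "cuts_out_zero_section U L \<sigma> \<longleftrightarrow>
     (\<forall>x\<in>dual_family U. \<sigma> x \<in> tot L \<and> proj L (\<sigma> x) = x) \<and>
     (\<forall>A\<in>atlas L. holo_dual U (fst A) (\<lambda>x. snd A (\<sigma> x))) \<and>
     (\<forall>A\<in>atlas L. \<forall>x\<in>fst A - zero_section ` U. snd A (\<sigma> x) \<noteq> 0) \<and>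
     (\<forall>A\<in>atlas L. \<forall>\<tau>\<in>U. zero_section \<tau> \<in> fst A \<longrightarrow>
        (\<exists>N G. open N \<and> (0, \<tau>) \<in> N \<and> holo2_sub (N \<inter> UNIV \<times> U) G \<and>
           (\<forall>p\<in>N \<inter> UNIV \<times> U. orbit p \<in> fst A \<and> G p \<noteq> 0 \<and> snd A (\<sigma> (orbit p)) = fst p * G p)))"

lemma cuts_outD:
  assumes "cuts_out_zero_section U L \<sigma>"
  shows "x \<in> dual_family U \<Longrightarrow> \<sigma> x \<in> tot L" "x \<in> dual_family U \<Longrightarrow> proj L (\<sigma> x) = x"
    "A \<in> atlas L \<Longrightarrow> holo_dual U (fst A) (\<lambda>x. snd A (\<sigma> x))"
    "A \<in> atlas L \<Longrightarrow> x \<in> fst A \<Longrightarrow> x \<notin> zero_section ` U \<Longrightarrow> snd A (\<sigma> x) \<noteq> 0"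
proof -
  note parts = assms[unfolded cuts_out_zero_section_def]
  show "x \<in> dual_family U \<Longrightarrow> \<sigma> x \<in> tot L" "x \<in> dual_family U \<Longrightarrow> proj L (\<sigma> x) = x"
    using parts[THEN conjunct1] by simp_all
  show "A \<in> atlas L \<Longrightarrow> holo_dual U (fst A) (\<lambda>x. snd A (\<sigma> x))"
    using parts[THEN conjunct2, THEN conjunct1] by simp
  show "A \<in> atlas L \<Longrightarrow> x \<in> fst A \<Longrightarrow> x \<notin> zero_section ` U \<Longrightarrow> snd A (\<sigma> x) \<noteq> 0"
    using parts[THEN conjunct2, THEN conjunct2, THEN conjunct1] by simp
qed

lemma cuts_out_local_form:
  assumes "cuts_out_zero_section U L \<sigma>" "A \<in> atlas L" "\<tau> \<in> U" "zero_section \<tau> \<in> fst A"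
  obtains N G where "open N" "(0, \<tau>) \<in> N" "\<And>p. p \<in> N \<Longrightarrow> snd p \<in> U \<Longrightarrow> holo2_germ U G p"
    "\<And>p. p \<in> N \<Longrightarrow> snd p \<in> U \<Longrightarrow> G p \<noteq> 0"
    "\<And>p. p \<in> N \<Longrightarrow> snd p \<in> U \<Longrightarrow> snd A (\<sigma> (orbit p)) = fst p * G p"
proof -
  obtain N G where N: "open N" "(0, \<tau>) \<in> N" "holo2_sub (N \<inter> UNIV \<times> U) G"
    "\<forall>p\<in>N \<inter> UNIV \<times> U. orbit p \<in> fst A \<and> G p \<noteq> 0 \<and> snd A (\<sigma> (orbit p)) = fst p * G p"
    using assms(1)[unfolded cuts_out_zero_section_def, THEN conjunct2, THEN conjunct2, THEN conjunct2]
      assms(2-4) by metis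
  have "openin (top_of_set (UNIV \<times> U)) (N \<inter> UNIV \<times> U)"
    using openin_open_Int[OF N(1), of "UNIV \<times> U"] by (simp add: Int_commute)
  from N(3)[unfolded holo2_sub_iff_germ[OF this]] N(4) show ?thesis
    by (intro that[OF N(1,2), of G]) (auto simp: mem_Times_iff)
qed

lemma cuts_out_zero:
  assumes "cuts_out_zero_section U L \<sigma>" "A \<in> atlas L" "\<tau> \<in> U" "zero_section \<tau> \<in> fst A"
  shows "snd A (\<sigma> (zero_section \<tau>)) = 0"
proof -
  obtain N G where "open N" "(0, \<tau>) \<in> N" and *: "\<And>p. p \<in> N \<Longrightarrow> snd p \<in> U \<Longrightarrow> snd A (\<sigma> (orbit p)) = fst p * G p"
    using cuts_out_local_form[OF assms] by metis
  then show ?thesis using *[of "(0, \<tau>)"] assms(3) by (simp add: zero_section_def)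
qed

lemma atlas_tensor_omega_inv:
  "atlas (tensor_bundle L (omega_inv U)) = (\<lambda>A. tensor_chart A (beta_inv_chart U)) ` atlas L"
  unfolding tensor_bundle_def lbundle.simps image_def atlas_omega_inv by (rule Collect_cong) blast

text \<open>Tensoring with \<open>\<beta>\<^sup>-\<^sup>1\<close> does not change coordinates, so each of the three conditions on \<open>s\<close>
  is literally the condition on \<open>\<sigma>\<close>.\<close>

lemma tensor_beta_section_iff:
  assumes U: "U \<subseteq> upper_half_plane" and L: "line_bundle U L"
    and \<sigma>: "\<And>x. x \<in> dual_family U \<Longrightarrow> \<sigma> x \<in> tot L" "\<And>x. x \<in> dual_family U \<Longrightarrow> proj L (\<sigma> x) = x"
    and s: "s \<in> extensional (dual_family U)" "\<And>x. x \<in> dual_family U \<Longrightarrow> s x = tensor_beta U L (\<sigma> x)"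
  shows "holo_section U (tensor_bundle L (omega_inv U)) s \<and>
      nonvanishing_off_zero U (tensor_bundle L (omega_inv U)) s \<and>
      first_order_at_zero U (tensor_bundle L (omega_inv U)) s \<longleftrightarrow> cuts_out_zero_section U L \<sigma>"
proof -
  let ?C = "\<lambda>A. tensor_chart A (beta_inv_chart U)"
  have sub: "fst A \<subseteq> dual_family U" if "A \<in> atlas L" for A
    by (rule open_dual_subset[OF line_bundle_chart_open[OF L that]])
  have coord: "snd (?C A) (s x) = snd A (\<sigma> x)" if "A \<in> atlas L" "x \<in> fst A" for A x
  proof -
    have "x \<in> dual_family U" using sub that by blast
    then show ?thesis using tensor_chart_tensor_beta[OF U L \<sigma>(1) that(1)] that(2) s(2) \<sigma>(2) by simp
  qed
  have W: "fst (?C A) = fst A" if "A \<in> atlas L" for A by (rule fst_tensor_chart[OF L that])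
  have 1: "s \<in> dual_family U \<rightarrow>\<^sub>E tot (tensor_bundle L (omega_inv U))"
    using s tensor_beta_in_tot[OF L \<sigma>(1)] by (auto simp: PiE_def)
  have 2: "proj (tensor_bundle L (omega_inv U)) (s x) = x" if "x \<in> dual_family U" for x
    using proj_tensor_beta[OF U L \<sigma>(1)[OF that]] \<sigma>(2)[OF that] s(2)[OF that] by simp
  have 3: "holo_dual U (fst (?C A)) (\<lambda>x. snd (?C A) (s x)) \<longleftrightarrow> holo_dual U (fst A) (\<lambda>x. snd A (\<sigma> x))"
    if A: "A \<in> atlas L" for A
  proof -
    note cong = holo_dual_cong[OF _ line_bundle_chart_open[OF L A]]
    show ?thesis
      unfolding W[OF A]
      by (rule iffI; erule cong) (simp_all add: coord[OF A])
  qed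
  have 4: "(\<forall>x\<in>fst (?C A) - zero_section ` U. snd (?C A) (s x) \<noteq> 0) \<longleftrightarrow>
      (\<forall>x\<in>fst A - zero_section ` U. snd A (\<sigma> x) \<noteq> 0)" if A: "A \<in> atlas L" for A
    unfolding W[OF A] using coord[OF A] by simp
  have 5: "orbit p \<in> fst A \<and> G p \<noteq> 0 \<and> snd (?C A) (s (orbit p)) = fst p * G p \<longleftrightarrow>
      orbit p \<in> fst A \<and> G p \<noteq> 0 \<and> snd A (\<sigma> (orbit p)) = fst p * G p" if A: "A \<in> atlas L" for A p and G :: "complex \<times> complex \<Rightarrow> complex"
    using coord[OF A] by auto
  have "holo_section U (tensor_bundle L (omega_inv U)) s \<longleftrightarrow>
      (\<forall>A\<in>atlas L. holo_dual U (fst A) (\<lambda>x. snd A (\<sigma> x)))"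
    using 1 2 3 by (simp add: holo_section_def atlas_tensor_omega_inv case_prod_unfold)
  moreover have "nonvanishing_off_zero U (tensor_bundle L (omega_inv U)) s \<longleftrightarrow>
      (\<forall>A\<in>atlas L. \<forall>x\<in>fst A - zero_section ` U. snd A (\<sigma> x) \<noteq> 0)"
    unfolding nonvanishing_off_zero_def atlas_tensor_omega_inv case_prod_unfold ball_simps using 4 by simp
  moreover have "first_order_at_zero U (tensor_bundle L (omega_inv U)) s \<longleftrightarrow>
     (\<forall>A\<in>atlas L. \<forall>\<tau>\<in>U. zero_section \<tau> \<in> fst A \<longrightarrow>
        (\<exists>N G. open N \<and> (0, \<tau>) \<in> N \<and> holo2_sub (N \<inter> UNIV \<times> U) G \<and>
           (\<forall>p\<in>N \<inter> UNIV \<times> U. orbit p \<in> fst A \<and> G p \<noteq> 0 \<and> snd A (\<sigma> (orbit p)) = fst p * G p)))"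
    unfolding first_order_at_zero_def atlas_tensor_omega_inv case_prod_unfold ball_simps
    by (intro ball_cong refl) (simp only: 5 W)
  ultimately show ?thesis
    unfolding cuts_out_zero_section_def using \<sigma> by blast
qed

lemma twisted_refinement_section:
  assumes U: "U \<subseteq> upper_half_plane" and R: "twisted_refinement U c L s t"
  obtains \<sigma> where "cuts_out_zero_section U L \<sigma>" "\<And>x. x \<in> dual_family U \<Longrightarrow> s x = tensor_beta U L (\<sigma> x)"
proof -
  have L: "line_bundle U L" and s: "holo_section U (tensor_bundle L (omega_inv U)) s"
    and s': "nonvanishing_off_zero U (tensor_bundle L (omega_inv U)) s"
      "first_order_at_zero U (tensor_bundle L (omega_inv U)) s"
    using R by (auto simp: twisted_refinement_def)
  have "\<exists>a. a \<in> tot L \<and> s x = tensor_beta U L a" if "x \<in> dual_family U" for x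
  proof -
    have "s x \<in> tot (tensor_bundle L (omega_inv U))" using s that by (auto simp: holo_section_def)
    then show ?thesis using tensor_beta_surj[OF U L] by metis
  qed
  then obtain \<sigma> where \<sigma>: "\<And>x. x \<in> dual_family U \<Longrightarrow> \<sigma> x \<in> tot L \<and> s x = tensor_beta U L (\<sigma> x)" by metis
  moreover have "proj L (\<sigma> x) = x" if "x \<in> dual_family U" for x
  proof -
    have "proj (tensor_bundle L (omega_inv U)) (s x) = x" using s that unfolding holo_section_def by blast
    then show ?thesis using \<sigma>[OF that] proj_tensor_beta[OF U L, of "\<sigma> x"] by simp
  qed
  moreover have "s \<in> extensional (dual_family U)" using s by (auto simp: holo_section_def PiE_def)
  ultimately have "cuts_out_zero_section U L \<sigma>"
    using tensor_beta_section_iff[OF U L, of \<sigma> s] s s' by blast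
  then show ?thesis using that \<sigma> by blast
qed

section \<open>The unique isomorphism\<close>

text \<open>Near the zero section both coordinates are \<open>z\<close> times a nowhere vanishing function, so their
  quotient extends across the zero section. The value there is the limit along the curve; it
  depends on \<open>\<tau>\<close> only and not on the chosen factorization, which makes the extension holomorphic.\<close>

lemma ratio_of_sections:
  assumes U: "U \<subseteq> upper_half_plane" and L: "line_bundle U L" "line_bundle U L'"
    and \<sigma>: "cuts_out_zero_section U L \<sigma>" "cuts_out_zero_section U L' \<sigma>'"
    and A: "A \<in> atlas L" and B: "B \<in> atlas L'"
  shows "\<exists>g. holo_dual U (fst A \<inter> fst B) g \<and>
    (\<forall>x\<in>fst A \<inter> fst B. g x \<noteq> 0 \<and> snd B (\<sigma>' x) = g x * snd A (\<sigma> x))"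
proof -
  define W where "W = fst A \<inter> fst B"
  have W: "open_dual U W" unfolding W_def
    using open_dual_Int line_bundle_chart_open L A B by metis
  define a where "a = (\<lambda>p. snd A (\<sigma> (orbit p)))"
  define b where "b = (\<lambda>p. snd B (\<sigma>' (orbit p)))"
  define g where "g = (\<lambda>x. if x \<in> zero_section ` U
     then Lim (at 0) (\<lambda>z. b (z, base_point x) / a (z, base_point x))
     else snd B (\<sigma>' x) / snd A (\<sigma> x))"
  have local: "\<exists>N H. open N \<and> (0, \<tau>) \<in> N \<and> holo2_germ U H (0, \<tau>) \<and>
      (\<forall>p\<in>N. snd p \<in> U \<longrightarrow> H p \<noteq> 0 \<and> g (orbit p) = H p)"
    if \<tau>: "\<tau> \<in> U" "zero_section \<tau> \<in> W" for \<tau>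
  proof -
    obtain N1 G1 where N1: "open N1" "(0, \<tau>) \<in> N1" "\<And>p. p \<in> N1 \<Longrightarrow> snd p \<in> U \<Longrightarrow> holo2_germ U G1 p"
      "\<And>p. p \<in> N1 \<Longrightarrow> snd p \<in> U \<Longrightarrow> G1 p \<noteq> 0" "\<And>p. p \<in> N1 \<Longrightarrow> snd p \<in> U \<Longrightarrow> a p = fst p * G1 p"
      using cuts_out_local_form[OF \<sigma>(1) A \<tau>(1)] \<tau>(2) unfolding W_def a_def by (metis IntD1)
    obtain N2 G2 where N2: "open N2" "(0, \<tau>) \<in> N2" "\<And>p. p \<in> N2 \<Longrightarrow> snd p \<in> U \<Longrightarrow> holo2_germ U G2 p"
      "\<And>p. p \<in> N2 \<Longrightarrow> snd p \<in> U \<Longrightarrow> G2 p \<noteq> 0" "\<And>p. p \<in> N2 \<Longrightarrow> snd p \<in> U \<Longrightarrow> b p = fst p * G2 p"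
      using cuts_out_local_form[OF \<sigma>(2) B \<tau>(1)] \<tau>(2) unfolding W_def b_def by (metis IntD2)
    obtain r where r: "r > 0" "cball 0 r \<times> cball \<tau> r \<subseteq> N1 \<inter> N2"
      using open_contains_cball_Times[of "N1 \<inter> N2" 0 \<tau>] N1(1,2) N2(1,2) by blast
    \<comment> \<open>a product, so that with a point it contains the point of the zero section on the same curve\<close>
    define N where "N = ball (0::complex) r \<times> ball \<tau> r"
    have NN: "p \<in> N1" "p \<in> N2" if "p \<in> N" for p
    proof -
      have "p \<in> cball 0 r \<times> cball \<tau> r" using that by (auto simp: N_def)
      then show "p \<in> N1" "p \<in> N2" using r(2) by auto
    qed
    define H where "H = (\<lambda>p. G2 p / G1 p)"
    have H: "holo2_germ U H p" "H p \<noteq> 0" if "p \<in> N" "snd p \<in> U" for p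
      unfolding H_def
      using N1(3,4)[OF NN(1)[OF that(1)] that(2)] N2(3,4)[OF NN(2)[OF that(1)] that(2)] that(2)
      by (auto intro: holo2_germ_divide)
    have lim: "Lim (at 0) (\<lambda>z. b (z, \<tau>') / a (z, \<tau>')) = H (0, \<tau>')" if "\<tau>' \<in> ball \<tau> r" "\<tau>' \<in> U" for \<tau>'
    proof -
      have "(0, \<tau>') \<in> N" using that r(1) by (simp add: N_def)
      then have "(\<lambda>z. H (z, \<tau>')) analytic_on {0}"
        using H(1)[of "(0, \<tau>')"] that(2) by (intro holo2_germ_slice_analytic) auto
      then have "(\<lambda>z. H (z, \<tau>')) \<midarrow>0\<rightarrow> H (0, \<tau>')"
        using analytic_at_imp_isCont unfolding isCont_def by blast
      moreover have "\<forall>\<^sub>F z in at 0. H (z, \<tau>') = b (z, \<tau>') / a (z, \<tau>')"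
      proof -
        have "\<forall>\<^sub>F z in at 0. z \<in> ball (0::complex) r \<and> z \<noteq> 0"
          using r(1) eventually_at_in_open[of "ball 0 r" "0::complex"] by simp
        then show ?thesis
        proof eventually_elim
          case (elim z)
          then have "(z, \<tau>') \<in> N" using that by (simp add: N_def)
          then show ?case using NN N1(5) N2(5) elim that(2) by (simp add: H_def)
        qed
      qed
      ultimately have "(\<lambda>z. b (z, \<tau>') / a (z, \<tau>')) \<midarrow>0\<rightarrow> H (0, \<tau>')"
        by (rule Lim_transform_eventually)
      then show ?thesis by (intro tendsto_Lim) simp_all
    qed
    have "g (orbit p) = H p" if p: "p \<in> N" "snd p \<in> U" for p
    proof (cases "orbit p \<in> zero_section ` U")
      case True
      \<comment> \<open>a nonzero lattice point cannot lie in \<open>N\<close>: there \<open>a\<close> would vanish and \<open>fst p * G1 p\<close> not\<close>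
      have "(0, snd p) \<in> N" using p r(1) by (auto simp: N_def)
      then have "a (0, snd p) = 0" using N1(5)[of "(0, snd p)"] NN p(2) by auto
      moreover have "orbit p = orbit (0, snd p)"
      proof -
        obtain \<tau>' where "orbit p = orbit (0, \<tau>')" using True by (auto simp: zero_section_def)
        then show ?thesis using base_point_orbit by (metis snd_conv)
      qed
      ultimately have "a p = 0" by (simp add: a_def)
      then have "fst p = 0" using N1(4,5)[OF NN(1)[OF p(1)] p(2)] by simp
      then have pp: "p = (0, snd p)" by (simp add: prod_eq_iff)
      have "snd p \<in> ball \<tau> r" using p(1) by (auto simp: N_def)
      from lim[OF this p(2)] show ?thesis using True pp by (simp add: g_def)
    next
      case False
      have "fst p \<noteq> 0"
      proof
        assume "fst p = 0"
        then have "orbit p = zero_section (snd p)" unfolding zero_section_def by (metis prod.collapse)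
        then show False using False p(2) by blast
      qed
      then show ?thesis
        using False N1(5)[OF NN(1)[OF p(1)] p(2)] N2(5)[OF NN(2)[OF p(1)] p(2)]
        by (simp add: g_def a_def b_def H_def)
    qed
    moreover have "open N" "(0, \<tau>) \<in> N" using r(1) by (auto simp: N_def intro: open_Times)
    ultimately show ?thesis using H \<tau>(1) by (intro exI[of _ N] exI[of _ H]) auto
  qed
  have "holo_dual U W g"
  proof (rule holo_dualI[OF W])
    fix p assume p: "snd p \<in> U" "orbit p \<in> W"
    show "\<exists>q. orbit q = orbit p \<and> holo2_germ U (\<lambda>q. g (orbit q)) q"
    proof (cases "orbit p \<in> zero_section ` U")
      case True
      then obtain \<tau> where \<tau>: "\<tau> \<in> U" "orbit p = zero_section \<tau>" by blast
      then obtain N H where N: "open N" "(0, \<tau>) \<in> N" "holo2_germ U H (0, \<tau>)"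
        "\<forall>p\<in>N. snd p \<in> U \<longrightarrow> H p \<noteq> 0 \<and> g (orbit p) = H p"
        using local[of \<tau>] p(2) by auto
      have "holo2_germ U (\<lambda>q. g (orbit q)) (0, \<tau>)"
        by (rule holo2_germ_cong[OF N(3,1,2)]) (use N(4) in auto)
      then show ?thesis using \<tau>(2) by (auto simp: zero_section_def)
    next
      case False
      have ga: "holo2_germ U a p" unfolding a_def
        using p by (intro holo_dualD[OF cuts_outD(3)[OF \<sigma>(1) A] line_bundle_chart_open[OF L(1) A]]) (auto simp: W_def)
      have gb: "holo2_germ U b p" unfolding b_def
        using p by (intro holo_dualD[OF cuts_outD(3)[OF \<sigma>(2) B] line_bundle_chart_open[OF L(2) B]]) (auto simp: W_def)
      have ap: "a p \<noteq> 0" unfolding a_def using False p(2) by (intro cuts_outD(4)[OF \<sigma>(1) A]) (auto simp: W_def)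
      obtain N where N: "open N" "p \<in> N" "\<And>x. x \<in> N \<Longrightarrow> snd x \<in> U \<Longrightarrow> a x \<noteq> 0"
        by (rule holo2_germ_nonzero[OF ga p(1) ap]) blast
      obtain M where M: "open M" "p \<in> M" "\<And>x. x \<in> M \<Longrightarrow> snd x \<in> U \<Longrightarrow> orbit x \<in> W"
        by (rule open_dual_nbhd[OF W p]) blast
      have "holo2_germ U (\<lambda>q. g (orbit q)) p"
      proof (rule holo2_germ_cong[OF holo2_germ_divide[OF gb ga p(1) ap], of "M \<inter> N"])
        fix x assume x: "x \<in> M \<inter> N" "snd x \<in> U"
        \<comment> \<open>\<open>a\<close> vanishes on the zero section, so where it does not, \<open>g\<close> is the plain quotient\<close>
        have "orbit x \<notin> zero_section ` U"
        proof
          assume "orbit x \<in> zero_section ` U"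
          then obtain \<tau> where "\<tau> \<in> U" "orbit x = zero_section \<tau>" by blast
          then have "a x = 0" using cuts_out_zero[OF \<sigma>(1) A] M(3)[of x] x by (simp add: a_def W_def)
          then show False using N(3) x by blast
        qed
        then show "g (orbit x) = b x / a x" by (simp add: g_def a_def b_def)
      qed (use M N in auto)
      then show ?thesis by blast
    qed
  qed
  moreover have "g x \<noteq> 0 \<and> snd B (\<sigma>' x) = g x * snd A (\<sigma> x)" if x: "x \<in> W" for x
  proof (cases "x \<in> zero_section ` U")
    case True
    then obtain \<tau> where \<tau>: "\<tau> \<in> U" "x = zero_section \<tau>" by blast
    then obtain N H where N: "(0, \<tau>) \<in> N" "\<forall>p\<in>N. snd p \<in> U \<longrightarrow> H p \<noteq> 0 \<and> g (orbit p) = H p"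
      using local[of \<tau>] x by auto
    then have "g x \<noteq> 0" using \<tau> by (force simp: zero_section_def)
    then show ?thesis
      using cuts_out_zero[OF \<sigma>(1) A \<tau>(1)] cuts_out_zero[OF \<sigma>(2) B \<tau>(1)] \<tau>(2) x by (auto simp: W_def)
  next
    case False
    then show ?thesis
      using cuts_outD(4)[OF \<sigma>(1) A _ False] cuts_outD(4)[OF \<sigma>(2) B _ False] x by (simp add: g_def W_def)
  qed
  ultimately show ?thesis unfolding W_def by blast
qed

text \<open>The local quotients are the coordinates of one fibrewise linear map: two of them differ
  by the transition functions off the zero section, where the sections do not vanish, hence
  everywhere.\<close>

lemma hom_of_sections:
  assumes U: "U \<subseteq> upper_half_plane" and L: "line_bundle U L" "line_bundle U L'"
    and \<sigma>: "cuts_out_zero_section U L \<sigma>" "cuts_out_zero_section U L' \<sigma>'"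
  obtains f where "bundle_hom U L L' f" "\<And>x. x \<in> dual_family U \<Longrightarrow> f (\<sigma> x) = \<sigma>' x"
proof -
  obtain g where g: "\<And>A B. A \<in> atlas L \<Longrightarrow> B \<in> atlas L' \<Longrightarrow> holo_dual U (fst A \<inter> fst B) (g A B)"
    "\<And>A B x. A \<in> atlas L \<Longrightarrow> B \<in> atlas L' \<Longrightarrow> x \<in> fst A \<inter> fst B \<Longrightarrow> snd B (\<sigma>' x) = g A B x * snd A (\<sigma> x)"
    using ratio_of_sections[OF assms] by metis
  have od: "open_dual U (fst A)" if "A \<in> atlas L" for A using line_bundle_chart_open[OF L(1) that] .
  have od': "open_dual U (fst B)" if "B \<in> atlas L'" for B using line_bundle_chart_open[OF L(2) that] .
  \<comment> \<open>off the zero section this says that both sides multiply \<open>\<sigma>\<close> to \<open>\<sigma>'\<close>\<close>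
  have compat: "g A B x = transition L' B0 B x * g A0 B0 x * transition L A A0 x"
    if A: "A \<in> atlas L" "A0 \<in> atlas L" and B: "B \<in> atlas L'" "B0 \<in> atlas L'"
      and x: "x \<in> (fst A \<inter> fst A0) \<inter> (fst B \<inter> fst B0)" for A A0 B B0 x
  proof (rule holo_dual_eqI[OF U _ _ _ _ x])
    let ?W = "(fst A \<inter> fst A0) \<inter> (fst B \<inter> fst B0)"
    show W: "open_dual U ?W" by (intro open_dual_Int od od' A B)
    have sub: "holo_dual U ?W h" if "holo_dual U V h" "open_dual U V" "?W \<subseteq> V" for h V
      using holo_dual_subset[OF that(1,2) W that(3)] .
    show "holo_dual U ?W (g A B)"
      by (rule sub[OF g(1)[OF A(1) B(1)]]) (auto intro!: open_dual_Int od od' A B)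
    show "holo_dual U ?W (\<lambda>x. transition L' B0 B x * g A0 B0 x * transition L A A0 x)"
      by (intro holo_dual_mult W sub[OF g(1)[OF A(2) B(2)]] sub[OF line_bundle_transition(1)[OF L(1) A]]
           sub[OF line_bundle_transition(1)[OF L(2) B(2,1)]])
         (auto intro!: open_dual_Int od od' A B)
    fix y assume y: "y \<in> ?W - zero_section ` U"
    then have yE: "y \<in> dual_family U" using open_dual_subset[OF W] by blast
    note s = cuts_outD(1,2)[OF \<sigma>(1) yE] and s' = cuts_outD(1,2)[OF \<sigma>(2) yE]
    have "g A B y * snd A (\<sigma> y) = snd B (\<sigma>' y)" using g(2)[OF A(1) B(1)] y by simp
    also have "\<dots> = transition L' B0 B y * snd B0 (\<sigma>' y)"
      using line_bundle_transition(3)[OF L(2) B(2,1) s'(1)] s'(2) y by simp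
    also have "\<dots> = transition L' B0 B y * g A0 B0 y * snd A0 (\<sigma> y)" using g(2)[OF A(2) B(2)] y by simp
    also have "\<dots> = (transition L' B0 B y * g A0 B0 y * transition L A A0 y) * snd A (\<sigma> y)"
      using line_bundle_transition(3)[OF L(1) A s(1)] s(2) y by simp
    finally show "g A B y = transition L' B0 B y * g A0 B0 y * transition L A A0 y"
      using cuts_outD(4)[OF \<sigma>(1) A(1)] y by simp
  qed
  define ch where "ch = (\<lambda>x. SOME A. A \<in> atlas L \<and> x \<in> fst A)"
  define ch' where "ch' = (\<lambda>x. SOME B. B \<in> atlas L' \<and> x \<in> fst B)"
  have ch: "ch x \<in> atlas L \<and> x \<in> fst (ch x)" "ch' x \<in> atlas L' \<and> x \<in> fst (ch' x)" if "x \<in> dual_family U" for x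
    unfolding ch_def ch'_def
    by (rule someI_ex, metis line_bundle_chart_at[OF L(1) that],
        rule someI_ex, metis line_bundle_chart_at[OF L(2) that])
  define f where "f = (\<lambda>v\<in>tot L. fibre_vector L' (ch' (proj L v)) (proj L v)
     (g (ch (proj L v)) (ch' (proj L v)) (proj L v) * snd (ch (proj L v)) v))"
  have f: "f v \<in> tot L'" "proj L' (f v) = proj L v"
    "snd (ch' (proj L v)) (f v) = g (ch (proj L v)) (ch' (proj L v)) (proj L v) * snd (ch (proj L v)) v"
    if "v \<in> tot L" for v
    using fibre_vector[OF L(2)] ch(2)[OF line_bundle_proj[OF L(1) that]] that by (simp_all add: f_def)
  have coord: "snd B (f v) = g A B (proj L v) * snd A v"
    if v: "v \<in> tot L" and A: "A \<in> atlas L" and B: "B \<in> atlas L'" and x: "proj L v \<in> fst A \<inter> fst B" for v A B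
  proof -
    define x A0 B0 where "x = proj L v" and "A0 = ch x" and "B0 = ch' x"
    note ch0 = ch[OF line_bundle_proj[OF L(1) v]]
    have 0: "A0 \<in> atlas L" "x \<in> fst A0" "B0 \<in> atlas L'" "x \<in> fst B0"
      using ch0 by (simp_all add: x_def A0_def B0_def)
    have "snd B (f v) = transition L' B0 B x * snd B0 (f v)"
      using line_bundle_transition(3)[OF L(2) 0(3) B f(1)[OF v]] f(2)[OF v] 0 assms x by (simp add: x_def)
    also have "snd B0 (f v) = g A0 B0 x * snd A0 v" using f(3)[OF v] by (simp add: x_def A0_def B0_def)
    also have "snd A0 v = transition L A A0 x * snd A v"
      using line_bundle_transition(3)[OF L(1) A 0(1) v] 0 x by (simp add: x_def)
    finally show ?thesis
      using compat[OF A 0(1) B 0(3), of x] 0 x by (simp add: x_def)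
  qed
  have "bundle_hom U L L' f"
    unfolding bundle_hom_def case_prod_unfold
  proof (intro conjI ballI)
    show "f \<in> tot L \<rightarrow>\<^sub>E tot L'" using f(1) by (auto simp: PiE_def f_def extensional_def)
    fix A B assume "A \<in> atlas L" "B \<in> atlas L'"
    then show "\<exists>g. holo_dual U (fst A \<inter> fst B) g \<and>
       (\<forall>v\<in>tot L. proj L v \<in> fst A \<inter> fst B \<longrightarrow> snd B (f v) = g (proj L v) * snd A v)"
      using g(1) coord by (intro exI[of _ "g A B"]) simp
  qed (rule f(2))
  moreover have "f (\<sigma> x) = \<sigma>' x" if x: "x \<in> dual_family U" for x
  proof -
    note s = cuts_outD(1,2)[OF \<sigma>(1) x] and s' = cuts_outD(1,2)[OF \<sigma>(2) x]
    have "snd (ch' x) (f (\<sigma> x)) = snd (ch' x) (\<sigma>' x)"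
      using coord[OF s(1), of "ch x" "ch' x"] g(2)[of "ch x" "ch' x" x] ch[OF x] s(2) by simp
    then show ?thesis
      using line_bundle_eqI[OF L(2) conjunct1[OF ch(2)[OF x]] f(1)[OF s(1)] s'(1)]
        ch(2)[OF x] f(2)[OF s(1)] s(2) s'(2) by simp
  qed
  ultimately show ?thesis using that by blast
qed

text \<open>On the fibres that \<open>\<sigma>\<close> generates, a linear map is determined by its value on \<open>\<sigma>\<close>; on the zero
  section the coordinates agree by continuity.\<close>

lemma hom_of_sections_unique:
  assumes U: "U \<subseteq> upper_half_plane" and L: "line_bundle U L" "line_bundle U L'"
    and \<sigma>: "cuts_out_zero_section U L \<sigma>"
    and f: "bundle_hom U L L' f" "bundle_hom U L L' f'"
    and eq: "\<And>x. x \<in> dual_family U \<Longrightarrow> f (\<sigma> x) = f' (\<sigma> x)"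
  shows "f = f'"
proof
  fix v
  show "f v = f' v"
  proof (cases "v \<in> tot L")
    case True
    define x where "x = proj L v"
    have x: "x \<in> dual_family U" using line_bundle_proj[OF L(1) True] by (simp add: x_def)
    obtain A where A: "A \<in> atlas L" "x \<in> fst A" using line_bundle_chart_at[OF L(1) x] .
    obtain B where B: "B \<in> atlas L'" "x \<in> fst B" using line_bundle_chart_at[OF L(2) x] .
    obtain g where g: "holo_dual U (fst A \<inter> fst B) g"
      "\<forall>v\<in>tot L. proj L v \<in> fst A \<inter> fst B \<longrightarrow> snd B (f v) = g (proj L v) * snd A v"
      using bundle_homD(3)[OF f(1) A(1) B(1)] by blast
    obtain g' where g': "holo_dual U (fst A \<inter> fst B) g'"
      "\<forall>v\<in>tot L. proj L v \<in> fst A \<inter> fst B \<longrightarrow> snd B (f' v) = g' (proj L v) * snd A v"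
      using bundle_homD(3)[OF f(2) A(1) B(1)] by blast
    have W: "open_dual U (fst A \<inter> fst B)"
      using open_dual_Int line_bundle_chart_open L A B by metis
    have "g x = g' x"
    proof (rule holo_dual_eqI[OF U W g(1) g'(1)])
      fix y assume y: "y \<in> fst A \<inter> fst B - zero_section ` U"
      then have yE: "y \<in> dual_family U" using open_dual_subset[OF W] by blast
      have "g y * snd A (\<sigma> y) = g' y * snd A (\<sigma> y)"
        using g(2) g'(2) cuts_outD(1,2)[OF \<sigma> yE] eq[OF yE] y by (metis DiffD1)
      then show "g y = g' y" using cuts_outD(4)[OF \<sigma> A(1)] y by simp
    qed (use A B in blast)
    then have "snd B (f v) = snd B (f' v)" using g(2) g'(2) True A B by (simp add: x_def)
    then show ?thesis
      using line_bundle_eqI[OF L(2) B(1)] bundle_homD(1,2)[OF f(1)] bundle_homD(1,2)[OF f(2)] True B(2)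
      by (metis x_def)
  next
    case False
    then show ?thesis using f by (auto simp: bundle_hom_def PiE_def extensional_def)
  qed
qed

text \<open>In coordinates the composition is multiplication by \<open>g' g\<close>, which is \<open>1\<close> where \<open>\<sigma>\<close> does not
  vanish and hence everywhere.\<close>

lemma hom_of_sections_inverse:
  assumes U: "U \<subseteq> upper_half_plane" and L: "line_bundle U L" "line_bundle U L'"
    and \<sigma>: "cuts_out_zero_section U L \<sigma>"
    and f: "bundle_hom U L L' f" "bundle_hom U L' L f'"
    and eq: "\<And>x. x \<in> dual_family U \<Longrightarrow> f' (f (\<sigma> x)) = \<sigma> x" and v: "v \<in> tot L"
  shows "f' (f v) = v"
proof -
  define x where "x = proj L v"
  have x: "x \<in> dual_family U" using line_bundle_proj[OF L(1) v] by (simp add: x_def)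
  obtain A where A: "A \<in> atlas L" "x \<in> fst A" using line_bundle_chart_at[OF L(1) x] .
  obtain B where B: "B \<in> atlas L'" "x \<in> fst B" using line_bundle_chart_at[OF L(2) x] .
  obtain g where g: "holo_dual U (fst A \<inter> fst B) g"
    "\<forall>v\<in>tot L. proj L v \<in> fst A \<inter> fst B \<longrightarrow> snd B (f v) = g (proj L v) * snd A v"
    using bundle_homD(3)[OF f(1) A(1) B(1)] by blast
  obtain g' where g': "holo_dual U (fst B \<inter> fst A) g'"
    "\<forall>w\<in>tot L'. proj L' w \<in> fst B \<inter> fst A \<longrightarrow> snd A (f' w) = g' (proj L' w) * snd B w"
    using bundle_homD(3)[OF f(2) B(1) A(1)] by blast
  have W: "open_dual U (fst A \<inter> fst B)"
    using open_dual_Int line_bundle_chart_open L A B by metis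
  have comp: "snd A (f' (f w)) = g' (proj L w) * g (proj L w) * snd A w"
    if "w \<in> tot L" "proj L w \<in> fst A \<inter> fst B" for w
    using g(2) g'(2) bundle_homD(1,2)[OF f(1) that(1)] that by simp
  have "g' x * g x = 1"
  proof (rule holo_dual_eqI[OF U W])
    show "holo_dual U (fst A \<inter> fst B) (\<lambda>x. g' x * g x)"
      using g(1) g'(1) W by (intro holo_dual_mult) (simp_all add: Int_commute)
    show "holo_dual U (fst A \<inter> fst B) (\<lambda>_. 1)" by (rule holo_dual_const[OF W])
    fix y assume y: "y \<in> fst A \<inter> fst B - zero_section ` U"
    then have yE: "y \<in> dual_family U" using open_dual_subset[OF W] by blast
    have "snd A (\<sigma> y) = g' y * g y * snd A (\<sigma> y)"
      using comp[of "\<sigma> y"] cuts_outD(1,2)[OF \<sigma> yE] eq[OF yE] y by simp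
    then show "g' y * g y = 1" using cuts_outD(4)[OF \<sigma> A(1)] y by simp
  qed (use A B in blast)
  then have "snd A (f' (f v)) = snd A v" using comp[OF v] A B by (simp add: x_def)
  then show ?thesis
    using line_bundle_eqI[OF L(1) A(1)] bundle_homD(1,2)[OF f(1)] bundle_homD(1,2)[OF f(2)] v A(2)
    by (metis x_def)
qed

text \<open>The two morphisms obtained by exchanging the roles of the pairs are inverse to each other.\<close>

theorem unique_iso_of_sections:
  assumes U: "U \<subseteq> upper_half_plane" and L: "line_bundle U L" "line_bundle U L'"
    and \<sigma>: "cuts_out_zero_section U L \<sigma>" "cuts_out_zero_section U L' \<sigma>'"
    and s: "\<And>x. x \<in> dual_family U \<Longrightarrow> s x = tensor_beta U L (\<sigma> x)"
      "\<And>x. x \<in> dual_family U \<Longrightarrow> s' x = tensor_beta U L' (\<sigma>' x)"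
  shows "\<exists>!f. refinement_iso U L s L' s' f"
proof -
  have iff: "refinement_iso U L s L' s' f \<longleftrightarrow> bundle_iso U L L' f \<and> (\<forall>x\<in>dual_family U. f (\<sigma> x) = \<sigma>' x)" for f
  proof -
    have "tensor_map L' (omega_inv U) f (s x) = s' x \<longleftrightarrow> f (\<sigma> x) = \<sigma>' x"
      if f: "bundle_hom U L L' f" and x: "x \<in> dual_family U" for x
      using tensor_map_tensor_beta[OF U L f cuts_outD(1)[OF \<sigma>(1) x]] s[OF x]
        tensor_beta_inj[OF U L(2) bundle_homD(1)[OF f cuts_outD(1)[OF \<sigma>(1) x]] cuts_outD(1)[OF \<sigma>(2) x]]
      by auto
    then show ?thesis unfolding refinement_iso_def bundle_iso_def by blast
  qed
  obtain f where f: "bundle_hom U L L' f" "\<And>x. x \<in> dual_family U \<Longrightarrow> f (\<sigma> x) = \<sigma>' x"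
    using hom_of_sections[OF U L \<sigma>] by blast
  obtain f' where f': "bundle_hom U L' L f'" "\<And>x. x \<in> dual_family U \<Longrightarrow> f' (\<sigma>' x) = \<sigma> x"
    using hom_of_sections[OF U L(2,1) \<sigma>(2,1)] by blast
  have "\<forall>v\<in>tot L. f' (f v) = v"
    using hom_of_sections_inverse[OF U L \<sigma>(1) f(1) f'(1)] f(2) f'(2) by simp
  moreover have "\<forall>w\<in>tot L'. f (f' w) = w"
    using hom_of_sections_inverse[OF U L(2,1) \<sigma>(2) f'(1) f(1)] f(2) f'(2) by simp
  ultimately have "bundle_iso U L L' f" unfolding bundle_iso_def using f(1) f'(1) by blast
  with f(2) have "refinement_iso U L s L' s' f" unfolding iff by blast
  moreover have "h = f" if "refinement_iso U L s L' s' h" for h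
    using that f hom_of_sections_unique[OF U L \<sigma>(1), of h f] unfolding iff bundle_iso_def by auto
  ultimately show ?thesis by blast
qed

section \<open>Every orientation has a refinement\<close>

lemma holo_sub_mono: "holo_sub S f \<Longrightarrow> S' \<subseteq> S \<Longrightarrow> holo_sub S' f"
  unfolding holo_sub_def by (metis IntE IntI subsetD)

lemma holo_sub_binop:
  assumes f: "holo_sub S f" and g: "holo_sub S g"
    and h: "\<And>F G N. F holomorphic_on N \<Longrightarrow> G holomorphic_on N \<Longrightarrow> (\<lambda>x. h (F x) (G x)) holomorphic_on N"
  shows "holo_sub S (\<lambda>x. h (f x) (g x))"
  unfolding holo_sub_def
proof
  fix p assume p: "p \<in> S"
  obtain N F where N: "open N" "p \<in> N" "F holomorphic_on N" "\<forall>x\<in>N \<inter> S. f x = F x"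
    using f p unfolding holo_sub_def by blast
  obtain M G where M: "open M" "p \<in> M" "G holomorphic_on M" "\<forall>x\<in>M \<inter> S. g x = G x"
    using g p unfolding holo_sub_def by blast
  have "(\<lambda>x. h (F x) (G x)) holomorphic_on N \<inter> M"
    using holomorphic_on_subset[OF N(3)] holomorphic_on_subset[OF M(3)] by (intro h) auto
  then show "\<exists>N F. open N \<and> p \<in> N \<and> F holomorphic_on N \<and> (\<forall>x\<in>N \<inter> S. h (f x) (g x) = F x)"
    using N M by (intro exI[of _ "N \<inter> M"] exI[of _ "\<lambda>x. h (F x) (G x)"]) auto
qed

lemma holo_sub_const: "holo_sub S (\<lambda>_. c)"
  unfolding holo_sub_def by (intro ballI exI[of _ UNIV] exI[of _ "\<lambda>_. c"]) auto

lemma holo_sub_sum: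
  assumes "finite I" "\<And>i. i \<in> I \<Longrightarrow> holo_sub S (f i)"
  shows "holo_sub S (\<lambda>x. \<Sum>i\<in>I. f i x)"
  using assms
proof (induction I rule: finite_induct)
  case empty
  show ?case by (simp add: holo_sub_const)
next
  case (insert i I)
  have "holo_sub S (\<lambda>x. f i x + (\<Sum>i\<in>I. f i x))"
    by (rule holo_sub_binop[of S "f i" "\<lambda>x. \<Sum>i\<in>I. f i x" "(+)"])
       (use insert in \<open>auto intro: holomorphic_on_add\<close>)
  then show ?case using insert(1,2) by simp
qed

lemma holo_sub_inverse:
  assumes f: "holo_sub S f" and nz: "\<And>x. x \<in> S \<Longrightarrow> f x \<noteq> 0"
  shows "holo_sub S (\<lambda>x. 1 / f x)"
  unfolding holo_sub_def
proof
  fix p assume p: "p \<in> S"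
  obtain N F where N: "open N" "p \<in> N" "F holomorphic_on N" "\<forall>x\<in>N \<inter> S. f x = F x"
    using f p unfolding holo_sub_def by blast
  define M where "M = F -` (-{0}) \<inter> N"
  have "open M" unfolding M_def
    using continuous_open_preimage[OF holomorphic_on_imp_continuous_on[OF N(3)] N(1), of "-{0}"]
    by (simp add: Int_commute open_Compl)
  moreover have "(\<lambda>x. 1 / F x) holomorphic_on M"
    using holomorphic_on_subset[OF N(3), of M] by (intro holomorphic_intros) (auto simp: M_def)
  moreover have "p \<in> M" using N p nz[OF p] by (auto simp: M_def)
  ultimately show "\<exists>N F. open N \<and> p \<in> N \<and> F holomorphic_on N \<and> (\<forall>x\<in>N \<inter> S. 1 / f x = F x)"
    using N(4) by (intro exI[of _ M] exI[of _ "\<lambda>x. 1 / F x"]) (auto simp: M_def)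
qed

text \<open>The coefficients of a quotient of power series are given by a recursion which divides
  by the leading coefficient of the denominator only.\<close>

lemma holo_sub_fps_quotient:
  assumes eq: "\<And>\<tau>. \<tau> \<in> S \<Longrightarrow> t \<tau> * e \<tau> = c \<tau>"
    and e: "\<And>k. holo_sub S (\<lambda>\<tau>. fps_nth (e \<tau>) k)" and c: "\<And>k. holo_sub S (\<lambda>\<tau>. fps_nth (c \<tau>) k)"
    and e0: "\<And>\<tau>. \<tau> \<in> S \<Longrightarrow> fps_nth (e \<tau>) 0 = 0" and e1: "\<And>\<tau>. \<tau> \<in> S \<Longrightarrow> fps_nth (e \<tau>) 1 \<noteq> 0"
  shows "holo_sub S (\<lambda>\<tau>. fps_nth (t \<tau>) k)"
proof (induction k rule: less_induct)
  case (less k)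
  let ?r = "\<lambda>\<tau>. (fps_nth (c \<tau>) (Suc k) - (\<Sum>i<k. fps_nth (t \<tau>) i * fps_nth (e \<tau>) (Suc k - i))) * (1 / fps_nth (e \<tau>) 1)"
  have r: "fps_nth (t \<tau>) k = ?r \<tau>" if "\<tau> \<in> S" for \<tau>
  proof -
    have "fps_nth (c \<tau>) (Suc k) = (\<Sum>i\<le>Suc k. fps_nth (t \<tau>) i * fps_nth (e \<tau>) (Suc k - i))"
      unfolding eq[OF that, symmetric] fps_mult_nth by (simp add: atMost_atLeast0)
    also have "\<dots> = (\<Sum>i<k. fps_nth (t \<tau>) i * fps_nth (e \<tau>) (Suc k - i)) + fps_nth (t \<tau>) k * fps_nth (e \<tau>) 1"
      using e0[OF that] by (simp add: lessThan_Suc_atMost[symmetric] Suc_diff_le)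
    finally show ?thesis using e1[OF that] by (simp add: field_simps)
  qed
  have "holo_sub S (\<lambda>\<tau>. \<Sum>i<k. fps_nth (t \<tau>) i * fps_nth (e \<tau>) (Suc k - i))"
    by (intro holo_sub_sum holo_sub_binop[where h = "(*)"] less e) (auto intro: holomorphic_on_mult)
  then have "holo_sub S (\<lambda>\<tau>. fps_nth (c \<tau>) (Suc k) - (\<Sum>i<k. fps_nth (t \<tau>) i * fps_nth (e \<tau>) (Suc k - i)))"
    by (intro holo_sub_binop[where h = "(-)"] c) (auto intro: holomorphic_on_diff)
  then have "holo_sub S ?r"
    by (intro holo_sub_binop[where h = "(*)"] holo_sub_inverse e e1) (auto intro: holomorphic_on_mult)
  then show ?case
    unfolding holo_sub_def using r by (metis (no_types, lifting) IntD2)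
qed

text \<open>In each chart the trivialization is forced to be \<open>c / e\<close>, where \<open>e\<close> is the expansion of the
  coordinate of \<open>\<sigma>\<close>. Both series have order one, so after division by \<open>z\<close> the quotient is
  invertible; and \<open>e\<close> changes by the transition function, so the quotient changes by its
  inverse, as a trivialization does.\<close>

theorem refinement_of_section:
  fixes L :: "'l lbundle"
  assumes U: "U \<subseteq> upper_half_plane" and L: "line_bundle U L"
    and \<sigma>: "cuts_out_zero_section U L \<sigma>" and c: "complex_orientation U c"
  shows "\<exists>t. twisted_refinement U c L (\<lambda>x\<in>dual_family U. tensor_beta U L (\<sigma> x)) t"
proof -
  define s where "s = (\<lambda>x\<in>dual_family U. tensor_beta U L (\<sigma> x))"
  define e :: "'l chart \<Rightarrow> complex \<Rightarrow> complex fps" where "e = (\<lambda>A. expansion_at_zero (\<lambda>x. snd A (\<sigma> x)))"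
  define t where "t = (\<lambda>A \<tau>. fps_shift 1 (c \<tau>) * inverse (fps_shift 1 (e A \<tau>)))"
  have od: "open_dual U (fst A)" if "A \<in> atlas L" for A using line_bundle_chart_open[OF L that] .
  have nbhd: "\<forall>\<^sub>F z in nhds 0. orbit (z, \<tau>) \<in> W"
    if W: "open_dual U W" and \<tau>: "\<tau> \<in> U" "zero_section \<tau> \<in> W" for W \<tau>
  proof -
    obtain N where N: "open N" "(0, \<tau>) \<in> N" "\<And>x. x \<in> N \<Longrightarrow> snd x \<in> U \<Longrightarrow> orbit x \<in> W"
      using open_dual_nbhd[OF W, of "(0, \<tau>)"] \<tau> by (auto simp: zero_section_def)
    obtain r where r: "r > 0" "cball 0 r \<times> cball \<tau> r \<subseteq> N"
      using open_contains_cball_Times[OF N(1,2)] .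
    have "\<forall>\<^sub>F z in nhds 0. z \<in> ball (0::complex) r"
      using r(1) by (intro eventually_nhds_in_open) auto
    then show ?thesis
    proof eventually_elim
      case (elim z)
      then have "(z, \<tau>) \<in> N" using r(1) by (intro subsetD[OF r(2)]) auto
      then show ?case using N(3) \<tau>(1) by auto
    qed
  qed
  have expansion: "(\<lambda>z. h (orbit (z, \<tau>))) has_fps_expansion expansion_at_zero h \<tau>"
    if "holo_dual U W h" "open_dual U W" "\<tau> \<in> U" "zero_section \<tau> \<in> W" for h W \<tau>
    unfolding expansion_at_zero_def
  proof (rule analytic_at_imp_has_fps_expansion_0)
    have "holo2_germ U (\<lambda>q. h (orbit q)) (0, \<tau>)"
      using that by (intro holo_dualD[of U W]) (auto simp: zero_section_def)
    then show "(\<lambda>z. h (orbit (z, \<tau>))) analytic_on {0}"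
      using holo2_germ_slice_analytic that(3) by blast
  qed
  have e_exp: "(\<lambda>z. snd A (\<sigma> (orbit (z, \<tau>)))) has_fps_expansion e A \<tau>"
    if "A \<in> atlas L" "\<tau> \<in> U" "zero_section \<tau> \<in> fst A" for A \<tau>
    unfolding e_def by (rule expansion[OF cuts_outD(3)[OF \<sigma> that(1)] od[OF that(1)] that(2,3)])
  have e01: "fps_nth (e A \<tau>) 0 = 0" "fps_nth (e A \<tau>) 1 \<noteq> 0"
    if A: "A \<in> atlas L" and \<tau>: "\<tau> \<in> U" "zero_section \<tau> \<in> fst A" for A \<tau>
  proof -
    obtain N G where N: "open N" "(0, \<tau>) \<in> N" "\<And>p. p \<in> N \<Longrightarrow> snd p \<in> U \<Longrightarrow> holo2_germ U G p"
      "\<And>p. p \<in> N \<Longrightarrow> snd p \<in> U \<Longrightarrow> G p \<noteq> 0"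
      "\<And>p. p \<in> N \<Longrightarrow> snd p \<in> U \<Longrightarrow> snd A (\<sigma> (orbit p)) = fst p * G p"
      using cuts_out_local_form[OF \<sigma> A \<tau>] by metis
    obtain r where r: "r > 0" "cball 0 r \<times> cball \<tau> r \<subseteq> N"
      using open_contains_cball_Times[OF N(1,2)] .
    have "(\<lambda>z. G (z, \<tau>)) analytic_on {0}"
      using N(2,3) \<tau>(1) by (intro holo2_germ_slice_analytic) auto
    then have G: "(\<lambda>z. G (z, \<tau>)) has_fps_expansion fps_expansion (\<lambda>z. G (z, \<tau>)) 0"
      by (rule analytic_at_imp_has_fps_expansion_0)
    have "\<forall>\<^sub>F z in nhds 0. z \<in> ball (0::complex) r"
      using r(1) by (intro eventually_nhds_in_open) auto
    then have "\<forall>\<^sub>F z in nhds 0. z * G (z, \<tau>) = snd A (\<sigma> (orbit (z, \<tau>)))"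
    proof eventually_elim
      case (elim z)
      then have "(z, \<tau>) \<in> N" using r(1) by (intro subsetD[OF r(2)]) auto
      then show ?case using N(5) \<tau>(1) by simp
    qed
    moreover have "(\<lambda>z. z * G (z, \<tau>)) has_fps_expansion fps_X * fps_expansion (\<lambda>z. G (z, \<tau>)) 0"
      by (intro fps_expansion_intros G)
    ultimately have "(\<lambda>z. snd A (\<sigma> (orbit (z, \<tau>)))) has_fps_expansion fps_X * fps_expansion (\<lambda>z. G (z, \<tau>)) 0"
      by (rule has_fps_expansion_cong[THEN iffD1, OF _ refl])
    from fps_expansion_unique_complex[OF e_exp[OF A \<tau>] this]
    have eq: "e A \<tau> = fps_X * fps_expansion (\<lambda>z. G (z, \<tau>)) 0" .
    show "fps_nth (e A \<tau>) 0 = 0" unfolding eq by simp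
    have "fps_nth (e A \<tau>) 1 = G (0, \<tau>)" unfolding eq by (simp add: fps_expansion_def)
    then show "fps_nth (e A \<tau>) 1 \<noteq> 0" using N(2,4) \<tau>(1) by simp
  qed
  have c01: "fps_nth (c \<tau>) 0 = 0" "fps_nth (c \<tau>) 1 = 1" if "\<tau> \<in> U" for \<tau>
    using c that by (auto simp: complex_orientation_def)
  have te: "t A \<tau> * e A \<tau> = c \<tau>" if "A \<in> atlas L" "\<tau> \<in> U" "zero_section \<tau> \<in> fst A" for A \<tau>
  proof -
    have X: "f = fps_shift 1 f * fps_X" if "fps_nth f 0 = 0" for f :: "complex fps"
      by (rule fps_ext) (use that in \<open>auto simp: fps_mult_fps_X_commute[symmetric]\<close>)
    have "inverse (fps_shift 1 (e A \<tau>)) * fps_shift 1 (e A \<tau>) = 1"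
      using e01(2)[OF that] by (intro inverse_mult_eq_1) simp
    moreover have "f * g * (h * k) = f * k" if "g * h = 1" for f g h k :: "complex fps"
      using that by (metis mult.assoc mult.right_neutral)
    ultimately have "t A \<tau> * (fps_shift 1 (e A \<tau>) * fps_X) = fps_shift 1 (c \<tau>) * fps_X"
      unfolding t_def by blast
    then show ?thesis by (simp only: X[OF e01(1)[OF that], symmetric] X[OF c01(1)[OF that(2)], symmetric])
  qed
  have e_holo: "holo_sub {\<tau>\<in>U. zero_section \<tau> \<in> fst A} (\<lambda>\<tau>. fps_nth (e A \<tau>) k)" if A: "A \<in> atlas L" for A k
    unfolding holo_sub_def
  proof
    fix \<tau> assume "\<tau> \<in> {\<tau>\<in>U. zero_section \<tau> \<in> fst A}"
    then have \<tau>: "\<tau> \<in> U" "zero_section \<tau> \<in> fst A" by auto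
    then have g: "holo2_germ U (\<lambda>q. snd A (\<sigma> (orbit q))) (0, \<tau>)"
      by (intro holo_dualD[OF cuts_outD(3)[OF \<sigma> A] od[OF A]]) (auto simp: zero_section_def)
    obtain N F where "open N" "\<tau> \<in> N" "F holomorphic_on N"
      "\<And>\<tau>. \<tau> \<in> N \<Longrightarrow> \<tau> \<in> U \<Longrightarrow> fps_nth (fps_expansion (\<lambda>z. snd A (\<sigma> (orbit (z, \<tau>)))) 0) k = F \<tau>"
      by (rule holo2_germ_coefficient[OF g \<tau>(1)]) blast
    then show "\<exists>N F. open N \<and> \<tau> \<in> N \<and> F holomorphic_on N \<and>
       (\<forall>x\<in>N \<inter> {\<tau>\<in>U. zero_section \<tau> \<in> fst A}. fps_nth (e A x) k = F x)"
      by (intro exI[of _ N] exI[of _ F]) (auto simp: e_def expansion_at_zero_def)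
  qed
  have t0: "fps_nth (t A \<tau>) 0 \<noteq> 0" if "A \<in> atlas L" "\<tau> \<in> U" "zero_section \<tau> \<in> fst A" for A \<tau>
    using e01(2)[OF that] c01(2)[OF that(2)] by (simp add: t_def)
  have t_trans: "t A \<tau> = t A' \<tau> * expansion_at_zero (transition L A A') \<tau>"
    if A: "A \<in> atlas L" "A' \<in> atlas L" and \<tau>: "\<tau> \<in> U" "zero_section \<tau> \<in> fst A \<inter> fst A'" for A A' \<tau>
  proof -
    note W = open_dual_Int[OF od[OF A(1)] od[OF A(2)]]
    have z: "zero_section \<tau> \<in> fst A" "zero_section \<tau> \<in> fst A'" using \<tau>(2) by auto
    have "(\<lambda>z. transition L A A' (orbit (z, \<tau>)) * snd A (\<sigma> (orbit (z, \<tau>))))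
        has_fps_expansion expansion_at_zero (transition L A A') \<tau> * e A \<tau>"
      by (rule has_fps_expansion_mult[OF expansion[OF line_bundle_transition(1)[OF L A] W \<tau>] e_exp[OF A(1) \<tau>(1) z(1)]])
    moreover have "\<forall>\<^sub>F z in nhds 0. transition L A A' (orbit (z, \<tau>)) * snd A (\<sigma> (orbit (z, \<tau>))) = snd A' (\<sigma> (orbit (z, \<tau>)))"
      using nbhd[OF W \<tau>]
    proof eventually_elim
      case (elim z)
      have "orbit (z, \<tau>) \<in> dual_family U" using \<tau>(1) by simp
      note s = cuts_outD(1,2)[OF \<sigma> this]
      show ?case using line_bundle_transition(3)[OF L A s(1)] s(2) elim by simp
    qed
    ultimately have "(\<lambda>z. snd A' (\<sigma> (orbit (z, \<tau>)))) has_fps_expansion expansion_at_zero (transition L A A') \<tau> * e A \<tau>"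
      by (rule has_fps_expansion_cong[THEN iffD1, OF _ refl, rotated])
    then have "e A' \<tau> = expansion_at_zero (transition L A A') \<tau> * e A \<tau>"
      using e_exp[OF A(2) \<tau>(1) z(2)] fps_expansion_unique_complex by blast
    then have "(t A' \<tau> * expansion_at_zero (transition L A A') \<tau>) * e A \<tau> = t A \<tau> * e A \<tau>"
      using te[OF A(1) \<tau>(1) z(1)] te[OF A(2) \<tau>(1) z(2)] by (simp add: mult.assoc)
    moreover have "e A \<tau> \<noteq> 0" using e01(2)[OF A(1) \<tau>(1) z(1)] by auto
    ultimately show ?thesis by simp
  qed
  have "formal_trivialization U L t"
    unfolding formal_trivialization_def
  proof (intro conjI ballI allI impI)
    fix A k assume A: "A \<in> atlas L"
    show "holo_sub {\<tau>\<in>U. zero_section \<tau> \<in> fst A} (\<lambda>\<tau>. fps_nth (t A \<tau>) k)"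
    proof (rule holo_sub_fps_quotient[where e = "e A" and c = c])
      have "holo_sub U (\<lambda>\<tau>. fps_nth (c \<tau>) k)" for k using c by (simp add: complex_orientation_def)
      then show "holo_sub {\<tau>\<in>U. zero_section \<tau> \<in> fst A} (\<lambda>\<tau>. fps_nth (c \<tau>) k)" for k
        by (rule holo_sub_mono) auto
    qed (use te e_holo e01 A in auto)
  next
    fix A \<tau> assume "A \<in> atlas L" "\<tau> \<in> U" "zero_section \<tau> \<in> fst A"
    then show "fps_nth (t A \<tau>) 0 \<noteq> 0" by (rule t0)
  next
    fix A A' \<tau> assume "A \<in> atlas L" "A' \<in> atlas L" "\<tau> \<in> U" "zero_section \<tau> \<in> fst A \<inter> fst A'"
    then show "t A \<tau> = t A' \<tau> * expansion_at_zero (transition L A A') \<tau>" by (rule t_trans)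
  qed
  moreover have "t A \<tau> * expansion_at_zero (\<lambda>x. snd (tensor_chart A (beta_inv_chart U)) (s x)) \<tau> = c \<tau>"
    if A: "A \<in> atlas L" and \<tau>: "\<tau> \<in> U" "zero_section \<tau> \<in> fst A" for A \<tau>
  proof -
    have "expansion_at_zero (\<lambda>x. snd (tensor_chart A (beta_inv_chart U)) (s x)) \<tau> = e A \<tau>"
      unfolding e_def expansion_at_zero_def
    proof (rule fps_expansion_cong)
      show "\<forall>\<^sub>F z in nhds 0. snd (tensor_chart A (beta_inv_chart U)) (s (orbit (z, \<tau>))) = snd A (\<sigma> (orbit (z, \<tau>)))"
        using nbhd[OF od[OF A] \<tau>]
      proof eventually_elim
        case (elim z)
        have x: "orbit (z, \<tau>) \<in> dual_family U" using \<tau>(1) by simp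
        note sx = cuts_outD(1,2)[OF \<sigma> x]
        show ?case using tensor_chart_tensor_beta[OF U L sx(1) A] sx(2) elim x by (simp add: s_def)
      qed
    qed
    then show ?thesis using te[OF A \<tau>] by simp
  qed
  moreover have "holo_section U (tensor_bundle L (omega_inv U)) s \<and>
      nonvanishing_off_zero U (tensor_bundle L (omega_inv U)) s \<and>
      first_order_at_zero U (tensor_bundle L (omega_inv U)) s"
    using \<sigma> by (subst tensor_beta_section_iff[OF U L cuts_outD(1,2)[OF \<sigma>]]) (auto simp: s_def)
  ultimately have "twisted_refinement U c L s t"
    unfolding twisted_refinement_def using L by blast
  then show ?thesis unfolding s_def by blast
qed

section \<open>Descent of the trivial bundle along a cocycle\<close>

text \<open>Holomorphic automorphy factors for the action of \<open>\<int>\<^sup>2\<close> on \<open>\<complex> \<times> U\<close>, with exactly the properties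
  that make the quotient of the trivial bundle a line bundle.\<close>

definition descent_cocycle :: "complex set \<Rightarrow> (int \<Rightarrow> int \<Rightarrow> complex \<times> complex \<Rightarrow> complex) \<Rightarrow> bool" where
  "descent_cocycle U j \<longleftrightarrow> (\<forall>p. snd p \<in> U \<longrightarrow> j 0 0 p = 1 \<and>
     (\<forall>n m n' m'. j (n + n') (m + m') p = j n' m' (dual_act n m p) * j n m p) \<and>
     (\<forall>n m. j n m p \<noteq> 0 \<and> holo2_germ U (j n m) p))"

lemma descent_cocycleD:
  assumes "descent_cocycle U j" "snd p \<in> U"
  shows "j 0 0 p = 1" "j (n + n') (m + m') p = j n' m' (dual_act n m p) * j n m p"
    "j n m p \<noteq> 0" "holo2_germ U (j n m) p"
  using assms(1)[unfolded descent_cocycle_def, THEN spec, THEN mp, OF assms(2)] by simp_all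

text \<open>By the cocycle identity, moving the representative only reindexes the class.\<close>

lemma descent_class_dual_act:
  assumes "descent_cocycle U j" "snd p \<in> U"
  shows "descent_class j (dual_act n m p, j n m p * w) = descent_class j (p, w)"
proof -
  have *: "(dual_act a b (dual_act n m p), j a b (dual_act n m p) * (j n m p * w))
      = (dual_act (n + a) (m + b) p, j (n + a) (m + b) p * w)" for a b
    by (simp add: dual_act_dual_act descent_cocycleD(2)[OF assms])
  have "(\<exists>a b. x = (dual_act (n + a) (m + b) p, j (n + a) (m + b) p * w)) \<longleftrightarrow>
      (\<exists>a b. x = (dual_act a b p, j a b p * w))" for x
    by (metis add_diff_cancel_left' diff_add_cancel add.commute)
  then show ?thesis unfolding descent_class_def by (simp add: *)
qed

lemma proj_descent_class: "proj (descent_bundle U j) (descent_class j (p, w)) = orbit p"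
  unfolding descent_bundle_def descent_class_def orbit_def by force

lemma fst_descent_chart [simp]: "fst (descent_chart V) = orbit ` V"
  by (simp add: descent_chart_def)

text \<open>As the action is free, an evenly covered set meets each class in one vector at most.\<close>

lemma descent_chart_class:
  assumes U: "U \<subseteq> upper_half_plane" and j: "descent_cocycle U j"
    and V: "V \<subseteq> UNIV \<times> U" "inj_on orbit V" and p: "p \<in> V"
  shows "snd (descent_chart V) (descent_class j (p, w)) = w"
proof -
  have pU: "snd p \<in> U" using V(1) p by (auto simp: mem_Times_iff)
  then have "Im (snd p) > 0" using U by (auto simp: upper_half_plane_def)
  have "descent_class j (p, w) \<inter> V \<times> UNIV = {(p, w)}"
  proof
    show "{(p, w)} \<subseteq> descent_class j (p, w) \<inter> V \<times> UNIV"
      using p descent_cocycleD(1)[OF j pU] unfolding descent_class_def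
      by (auto intro!: exI[of _ 0])
    show "descent_class j (p, w) \<inter> V \<times> UNIV \<subseteq> {(p, w)}"
    proof
      fix y assume y: "y \<in> descent_class j (p, w) \<inter> V \<times> UNIV"
      then obtain n m where nm: "y = (dual_act n m p, j n m p * w)" unfolding descent_class_def by auto
      have "dual_act n m p = p" using inj_onD[OF V(2), of "dual_act n m p" p] y p nm by auto
      then have "n = 0 \<and> m = 0" using \<open>Im (snd p) > 0\<close> by (rule dual_act_free)
      then show "y \<in> {(p, w)}" using nm descent_cocycleD(1)[OF j pU] by simp
    qed
  qed
  then show ?thesis by (simp add: descent_chart_def)
qed

text \<open>Equivariance moves a representative along its orbit to the given lift.\<close>

lemma descent_class_over:
  assumes j: "descent_cocycle U j" and "\<xi> \<in> tot (descent_bundle U j)" "proj (descent_bundle U j) \<xi> = orbit p"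
  obtains w where "\<xi> = descent_class j (p, w)"
proof -
  obtain p0 w0 where \<xi>: "\<xi> = descent_class j (p0, w0)" "snd p0 \<in> U"
    using assms(2) by (auto simp: descent_bundle_def mem_Times_iff)
  then have "orbit p0 = orbit p" using assms(3) by (simp add: proj_descent_class)
  then obtain n m where "p = dual_act n m p0" by (rule orbit_eqE)
  then show ?thesis using that \<xi> descent_class_dual_act[OF j \<xi>(2)] by metis
qed

lemma evenly_covered_chart:
  assumes "openin (top_of_set (UNIV \<times> U)) V"
  shows "open_dual U (orbit ` V)"
    and "snd p \<in> U \<Longrightarrow> dual_act n m p \<in> V \<Longrightarrow>
      \<exists>N. open N \<and> p \<in> N \<and> (\<forall>x\<in>N. snd x \<in> U \<longrightarrow> dual_act n m x \<in> V)"
proof -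
  obtain T where T: "open T" "V = UNIV \<times> U \<inter> T" using assms openin_open by blast
  have memV: "x \<in> V \<longleftrightarrow> snd x \<in> U \<and> x \<in> T" for x by (simp add: T(2) mem_Times_iff)
  have o: "open (dual_act n m -` T)" for n m
    using T(1) continuous_on_dual_act[of UNIV n m] by (metis continuous_on_open_vimage open_UNIV Int_UNIV_right)
  have "lift_set U (orbit ` V) = UNIV \<times> U \<inter> (\<Union>n m. dual_act n m -` T)"
  proof (rule set_eqI)
    fix q
    show "q \<in> lift_set U (orbit ` V) \<longleftrightarrow> q \<in> UNIV \<times> U \<inter> (\<Union>n m. dual_act n m -` T)"
    proof
      assume "q \<in> lift_set U (orbit ` V)"
      then obtain p where p: "snd q \<in> U" "p \<in> V" "orbit q = orbit p" by auto
      from p(3) obtain n m where "p = dual_act n m q" by (rule orbit_eqE)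
      then show "q \<in> UNIV \<times> U \<inter> (\<Union>n m. dual_act n m -` T)"
        using p by (auto simp: memV mem_Times_iff)
    next
      assume "q \<in> UNIV \<times> U \<inter> (\<Union>n m. dual_act n m -` T)"
      then obtain n m where q: "snd q \<in> U" "dual_act n m q \<in> T" by (auto simp: mem_Times_iff)
      then have "dual_act n m q \<in> V" by (simp add: memV)
      then have "orbit (dual_act n m q) \<in> orbit ` V" by (rule imageI)
      then show "q \<in> lift_set U (orbit ` V)" using q(1) by simp
    qed
  qed
  moreover have "open (\<Union>n m. dual_act n m -` T)" using o by blast
  moreover have "orbit ` V \<subseteq> dual_family U" by (auto simp: memV)
  ultimately show "open_dual U (orbit ` V)" unfolding open_dual_def openin_open by blast
  show "snd p \<in> U \<Longrightarrow> dual_act n m p \<in> V \<Longrightarrow>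
      \<exists>N. open N \<and> p \<in> N \<and> (\<forall>x\<in>N. snd x \<in> U \<longrightarrow> dual_act n m x \<in> V)"
    by (intro exI[of _ "dual_act n m -` T"]) (auto simp: o memV)
qed

text \<open>Lattice translates are at distance at least \<open>min 1 (Im \<tau>)\<close>, so small balls inject.\<close>

lemma evenly_covered_nbhd:
  assumes U: "U \<subseteq> upper_half_plane" and p: "snd p \<in> U"
  obtains V where "openin (top_of_set (UNIV \<times> U)) V" "inj_on orbit V" "p \<in> V"
proof -
  obtain z0 \<tau>0 where p0: "p = (z0, \<tau>0)" by force
  have im: "Im \<tau>0 > 0" using assms p0 by (auto simp: upper_half_plane_def)
  \<comment> \<open>two points of the set differ by less than \<open>2 r\<close>, which has to be at most \<open>1\<close> and at most
    \<open>Im \<tau>\<close>; the latter is at least \<open>Im \<tau>0 - r\<close>\<close>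
  define r where "r = min (1/2) (Im \<tau>0 / 3)"
  have r: "r > 0" "r \<le> 1/2" "r \<le> Im \<tau>0 / 3" using im by (auto simp: r_def)
  define V where "V = (UNIV \<times> U) \<inter> (ball z0 r \<times> ball \<tau>0 r)"
  have "inj_on orbit V"
  proof (rule inj_onI)
    fix x y assume xy: "x \<in> V" "y \<in> V" "orbit x = orbit y"
    from xy(3) obtain n m where nm: "y = dual_act n m x" by (rule orbit_eqE)
    obtain z \<tau> where x: "x = (z, \<tau>)" by force
    have d: "dist z0 z < r" "dist z0 (z + of_int n - \<tau> * of_int m) < r" "dist \<tau>0 \<tau> < r"
      using xy nm x by (auto simp: V_def dual_act_def)
    have "norm (of_int n - \<tau> * of_int m) = dist z (z + of_int n - \<tau> * of_int m)"
      by (simp add: dist_norm norm_minus_commute algebra_simps)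
    also have "\<dots> < 2 * r" using d(1,2) dist_triangle3[of z "z + of_int n - \<tau> * of_int m" z0] by linarith
    finally have *: "norm (of_int n - \<tau> * of_int m) < 2 * r" .
    have "Im \<tau>0 - Im \<tau> \<le> dist \<tau>0 \<tau>"
      using abs_Im_le_cmod[of "\<tau>0 - \<tau>"] by (simp add: dist_norm)
    then have "Im \<tau> \<ge> 2 * r" using d(3) r(3) by linarith
    then have "n = 0 \<and> m = 0" using * r by (intro lattice_discrete[of \<tau> n m]) linarith+
    then show "x = y" using nm by simp
  qed
  moreover have "openin (top_of_set (UNIV \<times> U)) V"
    unfolding V_def by (intro openin_open_Int open_Times open_ball)
  moreover have "p \<in> V" using p p0 r(1) by (simp add: V_def)
  ultimately show ?thesis using that by blast
qed

lemma atlas_descent: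
  "A \<in> atlas (descent_bundle U j) \<longleftrightarrow>
    (\<exists>V. A = descent_chart V \<and> openin (top_of_set (UNIV \<times> U)) V \<and> inj_on orbit V)"
  by (auto simp: descent_bundle_def)

lemma descent_class_in_tot: "snd p \<in> U \<Longrightarrow> descent_class j (p, w) \<in> tot (descent_bundle U j)"
  unfolding descent_bundle_def lbundle.simps by (intro imageI) (simp add: mem_Times_iff)

text \<open>The charts are bijective because evenly covered sets contain one lift of each point, and the
  transition function between two of them is the cocycle at the lattice vector that relates the two
  lifts, which is locally constant.\<close>

theorem line_bundle_descent:
  assumes U: "U \<subseteq> upper_half_plane" and j: "descent_cocycle U j"
  shows "line_bundle U (descent_bundle U j)"
proof -
  let ?L = "descent_bundle U j"
  have Vsub: "snd p \<in> U" if "openin (top_of_set (UNIV \<times> U)) V" "p \<in> V" for p and V :: "(complex \<times> complex) set"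
    using openin_imp_subset[OF that(1)] that(2) by (auto simp: mem_Times_iff)
  have coord: "snd (descent_chart V) (descent_class j (p, w)) = w"
    if "openin (top_of_set (UNIV \<times> U)) V" "inj_on orbit V" "p \<in> V" for V p w
    using descent_chart_class[OF U j openin_imp_subset[OF that(1)] that(2,3)] .
  have p1: "proj ?L \<in> tot ?L \<rightarrow> dual_family U"
  proof
    fix v assume "v \<in> tot ?L"
    then obtain p w where "v = descent_class j (p, w)" "snd p \<in> U"
      by (auto simp: descent_bundle_def mem_Times_iff)
    then show "proj ?L v \<in> dual_family U" by (simp add: proj_descent_class)
  qed
  have p2: "(\<Union>(W, \<phi>)\<in>atlas ?L. W) = dual_family U"
  proof
    show "(\<Union>(W, \<phi>)\<in>atlas ?L. W) \<subseteq> dual_family U"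
      using Vsub by (auto simp: descent_bundle_def descent_chart_def)
    show "dual_family U \<subseteq> (\<Union>(W, \<phi>)\<in>atlas ?L. W)"
    proof
      fix x assume "x \<in> dual_family U"
      then obtain p where p: "x = orbit p" "snd p \<in> U" by (rule dual_familyE)
      obtain V where V: "openin (top_of_set (UNIV \<times> U)) V" "inj_on orbit V" "p \<in> V"
        using evenly_covered_nbhd[OF U p(2)] .
      then have "descent_chart V \<in> atlas ?L" by (auto simp: atlas_descent)
      moreover have "x \<in> fst (descent_chart V)" using p V by simp
      ultimately show "x \<in> (\<Union>(W, \<phi>)\<in>atlas ?L. W)" by (force simp: case_prod_unfold)
    qed
  qed
  have p3: "bij_betw (\<lambda>v. (proj ?L v, snd (descent_chart V) v)) {v \<in> tot ?L. proj ?L v \<in> orbit ` V} (orbit ` V \<times> UNIV)"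
    if V: "openin (top_of_set (UNIV \<times> U)) V" "inj_on orbit V" for V
    unfolding bij_betw_def
  proof
    show "inj_on (\<lambda>v. (proj ?L v, snd (descent_chart V) v)) {v \<in> tot ?L. proj ?L v \<in> orbit ` V}"
    proof (rule inj_onI)
      fix v v' assume v: "v \<in> {v \<in> tot ?L. proj ?L v \<in> orbit ` V}" "v' \<in> {v \<in> tot ?L. proj ?L v \<in> orbit ` V}"
        and eq: "(proj ?L v, snd (descent_chart V) v) = (proj ?L v', snd (descent_chart V) v')"
      from v obtain p where p: "p \<in> V" "proj ?L v = orbit p" by auto
      obtain w where w: "v = descent_class j (p, w)" using descent_class_over[OF j _ p(2)] v by blast
      obtain w' where w': "v' = descent_class j (p, w')" using descent_class_over[OF j, of v' p] v eq p by auto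
      show "v = v'" using eq coord[OF V p(1)] w w' by simp
    qed
    show "(\<lambda>v. (proj ?L v, snd (descent_chart V) v)) ` {v \<in> tot ?L. proj ?L v \<in> orbit ` V} = orbit ` V \<times> UNIV"
    proof
      show "orbit ` V \<times> UNIV \<subseteq> (\<lambda>v. (proj ?L v, snd (descent_chart V) v)) ` {v \<in> tot ?L. proj ?L v \<in> orbit ` V}"
      proof
        fix y assume "y \<in> orbit ` V \<times> (UNIV :: complex set)"
        then obtain p w where y: "p \<in> V" "y = (orbit p, w)" by auto
        then have "y = (proj ?L (descent_class j (p, w)), snd (descent_chart V) (descent_class j (p, w)))"
          using coord[OF V] by (simp add: proj_descent_class)
        then show "y \<in> (\<lambda>v. (proj ?L v, snd (descent_chart V) v)) ` {v \<in> tot ?L. proj ?L v \<in> orbit ` V}"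
          using y Vsub[OF V(1)] by (intro image_eqI[of _ _ "descent_class j (p, w)"]) (auto simp: descent_class_in_tot proj_descent_class)
      qed
    qed auto
  qed
  have p4: "\<exists>g. holo_dual U (orbit ` V \<inter> orbit ` V') g \<and> (\<forall>x\<in>orbit ` V \<inter> orbit ` V'. g x \<noteq> 0) \<and>
     (\<forall>v\<in>tot ?L. proj ?L v \<in> orbit ` V \<inter> orbit ` V' \<longrightarrow> snd (descent_chart V') v = g (proj ?L v) * snd (descent_chart V) v)"
    if V: "openin (top_of_set (UNIV \<times> U)) V" "inj_on orbit V"
      and V': "openin (top_of_set (UNIV \<times> U)) V'" "inj_on orbit V'" for V V'
  proof -
    \<comment> \<open>the coordinate in \<open>V'\<close> of the vector whose coordinate in \<open>V\<close> is \<open>1\<close>\<close>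
    define g where "g = (\<lambda>x. snd (descent_chart V') (descent_class j (the_inv_into V orbit x, 1)))"
    have act: "snd (descent_chart V') (descent_class j (p, w)) = j n m p * w"
      if "p \<in> V" "dual_act n m p \<in> V'" for p w n m
      using coord[OF V' that(2), of "j n m p * w"] descent_class_dual_act[OF j Vsub[OF V(1) that(1)]] by simp
    have g: "g (orbit p) = j n m p" if "p \<in> V" "dual_act n m p \<in> V'" for p n m
      using act[OF that, of 1] the_inv_into_f_f[OF V(2) that(1)] by (simp add: g_def)
    have rep: "\<exists>p n m. x = orbit p \<and> p \<in> V \<and> dual_act n m p \<in> V'" if x: "x \<in> orbit ` V \<inter> orbit ` V'" for x
    proof -
      from x obtain p p' where p: "x = orbit p" "p \<in> V" "x = orbit p'" "p' \<in> V'" by (elim IntE imageE)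
      then have "orbit p = orbit p'" by simp
      then obtain n m where "p' = dual_act n m p" by (rule orbit_eqE)
      then show ?thesis using p by blast
    qed
    note W = open_dual_Int[OF evenly_covered_chart(1)[OF V(1)] evenly_covered_chart(1)[OF V'(1)]]
    have "holo_dual U (orbit ` V \<inter> orbit ` V') g"
    proof (rule holo_dualI[OF W])
      fix q assume "snd q \<in> U" "orbit q \<in> orbit ` V \<inter> orbit ` V'"
      with rep obtain p n m where p: "orbit q = orbit p" "p \<in> V" "dual_act n m p \<in> V'" by metis
      have pU: "snd p \<in> U" using Vsub[OF V(1) p(2)] .
      obtain N where N: "open N" "p \<in> N" "\<forall>x\<in>N. snd x \<in> U \<longrightarrow> x \<in> V"
        using evenly_covered_chart(2)[OF V(1) pU, of 0 0] p(2) by auto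
      obtain N' where N': "open N'" "p \<in> N'" "\<forall>x\<in>N'. snd x \<in> U \<longrightarrow> dual_act n m x \<in> V'"
        using evenly_covered_chart(2)[OF V'(1) pU p(3)] by blast
      have "holo2_germ U (\<lambda>q. g (orbit q)) p"
        by (rule holo2_germ_cong[OF descent_cocycleD(4)[OF j pU], of "N \<inter> N'"]) (use N N' g in auto)
      then show "\<exists>p. orbit p = orbit q \<and> holo2_germ U (\<lambda>q. g (orbit q)) p" using p(1) by metis
    qed
    moreover have "g x \<noteq> 0" if x: "x \<in> orbit ` V \<inter> orbit ` V'" for x
      using rep[OF x] g Vsub[OF V(1)] descent_cocycleD(3)[OF j] by metis
    moreover have "snd (descent_chart V') v = g (proj ?L v) * snd (descent_chart V) v"
      if v: "v \<in> tot ?L" "proj ?L v \<in> orbit ` V \<inter> orbit ` V'" for v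
    proof -
      obtain p n m where p: "proj ?L v = orbit p" "p \<in> V" "dual_act n m p \<in> V'" using rep[OF v(2)] by blast
      obtain w where w: "v = descent_class j (p, w)" using descent_class_over[OF j v(1) p(1)] .
      show ?thesis unfolding p(1) g[OF p(2,3)] using act[OF p(2,3)] coord[OF V p(2)] w by simp
    qed
    ultimately show ?thesis by blast
  qed
  show ?thesis
    unfolding line_bundle_def case_prod_unfold
  proof (intro conjI ballI)
    fix A assume "A \<in> atlas ?L"
    then obtain V where A: "A = descent_chart V" "openin (top_of_set (UNIV \<times> U)) V" "inj_on orbit V"
      by (auto simp: atlas_descent)
    show "open_dual U (fst A)" using evenly_covered_chart(1)[OF A(2)] A(1) by simp
    show "bij_betw (\<lambda>v. (proj ?L v, snd A v)) {v \<in> tot ?L. proj ?L v \<in> fst A} (fst A \<times> UNIV)"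
      using p3[OF A(2,3)] A(1) by simp
    fix A' assume "A' \<in> atlas ?L"
    then obtain V' where A': "A' = descent_chart V'" "openin (top_of_set (UNIV \<times> U)) V'" "inj_on orbit V'"
      by (auto simp: atlas_descent)
    show "\<exists>g. holo_dual U (fst A \<inter> fst A') g \<and> (\<forall>x\<in>fst A \<inter> fst A'. g x \<noteq> 0) \<and>
        (\<forall>v\<in>tot ?L. proj ?L v \<in> fst A \<inter> fst A' \<longrightarrow> snd A' v = g (proj ?L v) * snd A v)"
      using p4[OF A(2,3) A'(2,3)] A(1) A'(1) by simp
  qed (use p1 p2 in \<open>simp_all add: case_prod_unfold\<close>)
qed

text \<open>An equivariant function is a section of the bundle defined by its cocycle.\<close>

definition descent_section ::
  "(int \<Rightarrow> int \<Rightarrow> complex \<times> complex \<Rightarrow> complex) \<Rightarrow> (complex \<times> complex \<Rightarrow> complex) \<Rightarrow> point \<Rightarrow> ((complex \<times> complex) \<times> complex) set" where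
  "descent_section j u x = the_elem ((\<lambda>p. descent_class j (p, u p)) ` x)"

lemma descent_section_orbit:
  assumes j: "descent_cocycle U j" and p: "snd p \<in> U"
    and u: "\<And>n m. u (dual_act n m p) = j n m p * u p"
  shows "descent_section j u (orbit p) = descent_class j (p, u p)"
proof -
  have "(\<lambda>p. descent_class j (p, u p)) ` orbit p = {descent_class j (p, u p)}"
    by (rule image_eq_singletonI[OF mem_orbit_self])
       (auto elim!: mem_orbitE simp: u descent_class_dual_act[OF j p])
  then show ?thesis by (simp add: descent_section_def)
qed

text \<open>In the chart of an evenly covered set the section is the function \<open>u\<close> itself. At the zero
  section that set may contain the lift \<open>(n - \<tau> m, \<tau>)\<close> instead of \<open>(0, \<tau>)\<close>, and equivariance turns
  the factorization \<open>u = z K\<close> at \<open>(0, \<tau>)\<close> into \<open>z\<close> times \<open>j K\<close>.\<close>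

theorem descent_section_cuts_out:
  assumes U: "U \<subseteq> upper_half_plane" and j: "descent_cocycle U j"
    and u: "\<And>p n m. snd p \<in> U \<Longrightarrow> u (dual_act n m p) = j n m p * u p"
    and nz: "\<And>p. snd p \<in> U \<Longrightarrow> u p = 0 \<Longrightarrow> orbit p \<in> zero_section ` U"
    and K: "\<And>p. snd p \<in> U \<Longrightarrow> u p = fst p * K p" "\<And>p. snd p \<in> U \<Longrightarrow> holo2_germ U K p"
      "\<And>\<tau>. \<tau> \<in> U \<Longrightarrow> K (0, \<tau>) \<noteq> 0"
  shows "cuts_out_zero_section U (descent_bundle U j) (descent_section j u)"
proof -
  let ?L = "descent_bundle U j"
  have ugerm: "holo2_germ U u p" if "snd p \<in> U" for p
  proof -
    have "holo2_germ U (\<lambda>p. fst p * K p) p"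
      by (rule holo2_germ_mult[OF holo2_on_imp_germ[OF holo2_on_fst open_UNIV] K(2)[OF that]]) simp
    then show ?thesis by (rule holo2_germ_cong[of _ _ _ UNIV]) (auto simp: K(1))
  qed
  have coord: "snd (descent_chart V) (descent_section j u (orbit p)) = u p"
    if V: "openin (top_of_set (UNIV \<times> U)) V" "inj_on orbit V" and p: "p \<in> V" for V p
  proof -
    have "snd p \<in> U" using openin_imp_subset[OF V(1)] p by (auto simp: mem_Times_iff)
    then show ?thesis
      using descent_section_orbit[OF j, of p u] u descent_chart_class[OF U j openin_imp_subset[OF V(1)] V(2) p]
      by simp
  qed
  show ?thesis
    unfolding cuts_out_zero_section_def
  proof (intro conjI ballI impI)
    fix x assume "x \<in> dual_family U"
    then obtain p where p: "x = orbit p" "snd p \<in> U" by (rule dual_familyE)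
    then have "descent_section j u x = descent_class j (p, u p)" using descent_section_orbit[OF j p(2)] u by simp
    then show "descent_section j u x \<in> tot ?L" "proj ?L (descent_section j u x) = x"
      using p by (simp_all add: descent_class_in_tot proj_descent_class)
  next
    fix A assume "A \<in> atlas ?L"
    then obtain V where A: "A = descent_chart V" and V: "openin (top_of_set (UNIV \<times> U)) V" "inj_on orbit V"
      by (auto simp: atlas_descent)
    have Vsub: "snd p \<in> U" if "p \<in> V" for p using openin_imp_subset[OF V(1)] that by (auto simp: mem_Times_iff)
    note W = evenly_covered_chart(1)[OF V(1)]
    show "holo_dual U (fst A) (\<lambda>x. snd A (descent_section j u x))"
      unfolding A fst_descent_chart
    proof (rule holo_dualI[OF W])
      fix q assume "snd q \<in> U" "orbit q \<in> orbit ` V"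
      then obtain p where p: "orbit q = orbit p" "p \<in> V" by auto
      obtain N where N: "open N" "p \<in> N" "\<forall>x\<in>N. snd x \<in> U \<longrightarrow> x \<in> V"
        using evenly_covered_chart(2)[OF V(1) Vsub[OF p(2)], of 0 0] p(2) by auto
      have "holo2_germ U (\<lambda>q. snd (descent_chart V) (descent_section j u (orbit q))) p"
        by (rule holo2_germ_cong[OF ugerm[OF Vsub[OF p(2)]] N(1,2)]) (use N(3) coord[OF V] in auto)
      then show "\<exists>p. orbit p = orbit q \<and> holo2_germ U (\<lambda>q. snd (descent_chart V) (descent_section j u (orbit q))) p"
        using p(1) by metis
    qed
    show "snd A (descent_section j u x) \<noteq> 0" if x: "x \<in> fst A - zero_section ` U" for x
    proof -
      obtain p where p: "x = orbit p" "p \<in> V" using x by (auto simp: A)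
      then show ?thesis using coord[OF V p(2)] nz[OF Vsub[OF p(2)]] x by (auto simp: A)
    qed
    show "\<exists>N G. open N \<and> (0, \<tau>) \<in> N \<and> holo2_sub (N \<inter> UNIV \<times> U) G \<and>
           (\<forall>p\<in>N \<inter> UNIV \<times> U. orbit p \<in> fst A \<and> G p \<noteq> 0 \<and>
             snd A (descent_section j u (orbit p)) = fst p * G p)"
      if \<tau>: "\<tau> \<in> U" "zero_section \<tau> \<in> fst A" for \<tau>
    proof -
      obtain p0 where p0: "orbit (0, \<tau>) = orbit p0" "p0 \<in> V" using \<tau>(2) by (auto simp: A zero_section_def)
      from p0(1) obtain n m where nm: "p0 = dual_act n m (0, \<tau>)" by (rule orbit_eqE)
      obtain N where N: "open N" "(0, \<tau>) \<in> N" "\<forall>x\<in>N. snd x \<in> U \<longrightarrow> dual_act n m x \<in> V"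
        using evenly_covered_chart(2)[OF V(1), of "(0, \<tau>)" n m] p0(2) nm \<tau>(1) by auto
      define G where "G = (\<lambda>p. j n m p * K p)"
      have G: "holo2_germ U G p" if "snd p \<in> U" for p
        unfolding G_def by (rule holo2_germ_mult[OF descent_cocycleD(4)[OF j that] K(2)[OF that]])
      have G0: "G (0, \<tau>) \<noteq> 0" using K(3)[OF \<tau>(1)] descent_cocycleD(3)[OF j] \<tau>(1) by (simp add: G_def)
      obtain M where M: "open M" "(0, \<tau>) \<in> M" "\<And>x. x \<in> M \<Longrightarrow> snd x \<in> U \<Longrightarrow> G x \<noteq> 0"
        using holo2_germ_nonzero[OF G, of "(0, \<tau>)"] G0 \<tau>(1) by auto
      have op: "openin (top_of_set (UNIV \<times> U)) ((M \<inter> N) \<inter> UNIV \<times> U)"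
        using openin_open_Int[of "M \<inter> N" "UNIV \<times> U"] M(1) N(1) by (simp add: Int_commute open_Int)
      have "holo2_sub ((M \<inter> N) \<inter> UNIV \<times> U) G"
        unfolding holo2_sub_iff_germ[OF op] using G by (auto simp: mem_Times_iff)
      moreover have "orbit p \<in> fst A \<and> G p \<noteq> 0 \<and> snd A (descent_section j u (orbit p)) = fst p * G p"
        if "p \<in> (M \<inter> N) \<inter> UNIV \<times> U" for p
      proof -
        have p: "p \<in> M" "p \<in> N" "snd p \<in> U" using that by (auto simp: mem_Times_iff)
        then have d: "dual_act n m p \<in> V" using N(3) by blast
        have "orbit (dual_act n m p) \<in> orbit ` V" using d by (rule imageI)
        moreover have "snd (descent_chart V) (descent_section j u (orbit (dual_act n m p))) = fst p * G p"
          unfolding coord[OF V d] u[OF p(3)] K(1)[OF p(3)] G_def by (simp add: ac_simps)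
        ultimately show ?thesis using M(3)[OF p(1,3)] by (simp add: A)
      qed
      ultimately show ?thesis using M(1,2) N(1,2) by (intro exI[of _ "M \<inter> N"] exI[of _ G]) (simp add: open_Int)
    qed
  qed
qed

section \<open>The bundle of \<open>\<upsilon>\<close>\<close>

lemma descent_cocycle_upsilon:
  assumes "U \<subseteq> upper_half_plane"
  shows "descent_cocycle U (transformation_cocycle upsilon)"
proof -
  have im: "Im (snd p) > 0" if "snd p \<in> U" for p :: "complex \<times> complex"
    using assms that by (auto simp: upper_half_plane_def)
  have eq: "transformation_cocycle upsilon n m p = upsilon_automorphy n m p" if "snd p \<in> U" for n m p
    by (rule transformation_cocycle_upsilon[OF im[OF that]])
  have "holo2_germ U (transformation_cocycle upsilon n m) p" if "snd p \<in> U" for n m p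
    by (rule holo2_germ_cong[OF holo2_on_imp_germ[OF holo2_on_upsilon_automorphy open_UNIV], of _ UNIV]) (auto simp: eq)
  then show ?thesis
    unfolding descent_cocycle_def using eq upsilon_automorphy_cocycle by simp
qed

text \<open>The zeros of \<open>\<upsilon>\<close> are lattice points, which lie on the zero section, and \<open>\<upsilon> / z\<close> does not vanish at
  \<open>z = 0\<close>.\<close>

lemma upsilon_cuts_out:
  assumes U: "U \<subseteq> upper_half_plane"
  shows "cuts_out_zero_section U (upsilon_bundle U)
    (descent_section (transformation_cocycle upsilon) (\<lambda>p. upsilon (snd p) (fst p)))"
  unfolding upsilon_bundle_def
proof (rule descent_section_cuts_out[OF U descent_cocycle_upsilon[OF U]])
  have im: "Im (snd p) > 0" if "snd p \<in> U" for p :: "complex \<times> complex"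
    using U that by (auto simp: upper_half_plane_def)
  show "upsilon (snd (dual_act n m p)) (fst (dual_act n m p)) = transformation_cocycle upsilon n m p * upsilon (snd p) (fst p)"
    if "snd p \<in> U" for p n m
    using upsilon_transform[OF im[OF that], of n m "fst p"] transformation_cocycle_upsilon[OF im[OF that]] by simp
  show "orbit p \<in> zero_section ` U" if p: "snd p \<in> U" "upsilon (snd p) (fst p) = 0" for p
  proof -
    obtain n m where "fst p = of_int n - snd p * of_int m" using upsilon_eq_0_imp_lattice[OF im[OF p(1)] p(2)] .
    then have "p = dual_act n m (0, snd p)" by (simp add: dual_act_def prod_eq_iff)
    then have "orbit p = zero_section (snd p)" unfolding zero_section_def by (metis orbit_dual_act)
    then show ?thesis using p(1) by blast
  qed
  show "upsilon (snd p) (fst p) = fst p * upsilon_cofactor p" for p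
    using upsilon_eq_cofactor[of "snd p" "fst p"] by simp
  show "holo2_germ U upsilon_cofactor p" if "snd p \<in> U" for p
    using U that by (intro holo2_on_imp_germ[OF holo2_on_upsilon_cofactor open_UNIV_times_upper_half_plane])
      (auto simp: mem_Times_iff)
  show "upsilon_cofactor (0, \<tau>) \<noteq> 0" if "\<tau> \<in> U" for \<tau>
    using upsilon_cofactor_0 U that by (auto simp: upper_half_plane_def)
qed

lemma upsilon_section_eq:
  assumes U: "U \<subseteq> upper_half_plane"
  shows "upsilon_section U = (\<lambda>x\<in>dual_family U. tensor_beta U (upsilon_bundle U)
    (descent_section (transformation_cocycle upsilon) (\<lambda>p. upsilon (snd p) (fst p)) x))"
  unfolding upsilon_section_def tensor_beta_def
  using cuts_outD(2)[OF upsilon_cuts_out[OF U]]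
  by (intro restrict_ext) (simp add: descent_section_def case_prod_unfold)

theorem proposition7p8:
  fixes U :: "complex set" and c :: "complex \<Rightarrow> complex fps"
  assumes "holomorphic_submanifold U" and "complex_orientation U c"
  shows
    "(\<exists>(L :: ((complex \<times> complex) \<times> complex) set lbundle) s t. twisted_refinement U c L s t) \<and>
     (\<forall>(L :: 'l lbundle) s t (L' :: 'k lbundle) s' t'.
        twisted_refinement U c L s t \<longrightarrow> twisted_refinement U c L' s' t' \<longrightarrow>
        (\<exists>!f. refinement_iso U L s L' s' f)) \<and>
     line_bundle U (upsilon_bundle U) \<and>
     holo_section U (tensor_bundle (upsilon_bundle U) (omega_inv U)) (upsilon_section U) \<and>
     (\<forall>(L :: 'l lbundle) s t.
        twisted_refinement U c L s t \<longrightarrow>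
        (\<exists>!f. refinement_iso U L s (upsilon_bundle U) (upsilon_section U) f))"
proof -
  have U: "U \<subseteq> upper_half_plane" using assms(1) by (simp add: holomorphic_submanifold_def)
  define \<sigma> where "\<sigma> = descent_section (transformation_cocycle upsilon) (\<lambda>p. upsilon (snd p) (fst p))"
  have \<sigma>: "cuts_out_zero_section U (upsilon_bundle U) \<sigma>"
    unfolding \<sigma>_def by (rule upsilon_cuts_out[OF U])
  have s: "upsilon_section U = (\<lambda>x\<in>dual_family U. tensor_beta U (upsilon_bundle U) (\<sigma> x))"
    unfolding \<sigma>_def by (rule upsilon_section_eq[OF U])
  have L: "line_bundle U (upsilon_bundle U)"
    unfolding upsilon_bundle_def by (rule line_bundle_descent[OF U descent_cocycle_upsilon[OF U]])
  obtain t where t: "twisted_refinement U c (upsilon_bundle U) (upsilon_section U) t"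
    using refinement_of_section[OF U L \<sigma> assms(2)] unfolding s by blast
  have unique: "\<exists>!f. refinement_iso U M r (upsilon_bundle U) (upsilon_section U) f"
    if R: "twisted_refinement U c M r t'" for M :: "'l lbundle" and r t'
  proof (rule twisted_refinement_section[OF U R])
    fix \<rho> assume \<rho>: "cuts_out_zero_section U M \<rho>" "\<And>x. x \<in> dual_family U \<Longrightarrow> r x = tensor_beta U M (\<rho> x)"
    have "line_bundle U M" using R by (simp add: twisted_refinement_def)
    from unique_iso_of_sections[OF U this L \<rho>(1) \<sigma> \<rho>(2)] show ?thesis by (simp add: s)
  qed
  have unique': "\<exists>!f. refinement_iso U M r M' r' f"
    if R: "twisted_refinement U c M r t1" "twisted_refinement U c M' r' t2"
    for M :: "'l lbundle" and r t1 and M' :: "'k lbundle" and r' t2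
  proof (rule twisted_refinement_section[OF U R(1)], rule twisted_refinement_section[OF U R(2)])
    fix \<rho> \<rho>'
    assume \<rho>: "cuts_out_zero_section U M \<rho>" "\<And>x. x \<in> dual_family U \<Longrightarrow> r x = tensor_beta U M (\<rho> x)"
      and \<rho>': "cuts_out_zero_section U M' \<rho>'" "\<And>x. x \<in> dual_family U \<Longrightarrow> r' x = tensor_beta U M' (\<rho>' x)"
    have "line_bundle U M" "line_bundle U M'" using R by (simp_all add: twisted_refinement_def)
    from unique_iso_of_sections[OF U this \<rho>(1) \<rho>'(1) \<rho>(2) \<rho>'(2)] show ?thesis .
  qed
  have "holo_section U (tensor_bundle (upsilon_bundle U) (omega_inv U)) (upsilon_section U)"
    using t by (simp add: twisted_refinement_def)
  with t unique unique' L show ?thesis by blast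
qed

end
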